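(* Let $(M,g_0,J)$ be a pluriclosed manifold with Kähler form $\omega_0$, and consider the associated orthogonal holomorphic vector bundle $\mathcal Q=\mathcal Q_{\sqrt{-1}\partial\omega_0}$. Let $\omega$ be (the Kähler form of) a pluriclosed metric $g$ and $\beta\in\Lambda^{2,0}$ with $\bar\partial\beta=\partial\omega_0-\partial\omega$, and let $G=G(\omega,\beta)$ be the induced generalized Hermitian metric on $\mathcal Q$. Then the second Ricci curvature of the Chern connection of $G$ satisfies $$S^G_g=\sqrt{-1}\,(e^{\sqrt{-1}\beta})^*\begin{pmatrix}-g^{-1}\rho_B^{1,1} & g^{-1}\rho_B^{0,2}g^{-1}\\ \rho_B^{2,0} & -\rho_B^{1,1}g^{-1}\end{pmatrix},$$ where $\rho_B$ is the Bismut-Ricci form of $g$. Consequently, $g$ is Bismut Hermitian-Einstein if and only if $G$ is Hermitian-Einstein with respect to $g$, that is, if and only if $S^G_g=0$.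
   Context: Hermitian conventions: for a Hermitian metric $g$ on $(M,J)$, $\omega(X,Y)=g(JX,Y)$, $d^c=\sqrt{-1}(\bar\partial-\partial)$; $g$ is pluriclosed if $\partial\bar\partial\omega=0$. Bismut connection: $g(\nabla^B_XY,Z)=g(\nabla_XY,Z)-\tfrac12d^c\omega(X,Y,Z)$ ($\nabla$ Levi-Civita), with curvature $R^B(X,Y)Z=\nabla^B_X\nabla^B_YZ-\nabla^B_Y\nabla^B_XZ-\nabla^B_{[X,Y]}Z$ and Bismut-Ricci form $\rho_B(X,Y)=\tfrac12\sum_i g(R^B(X,Y)Je_i,e_i)$ ($\{e_i\}$ orthonormal). $g$ is Bismut Hermitian-Einstein if it is pluriclosed and $\rho_B\equiv0$. The bundle: $\mathcal Q_{\sqrt{-1}\partial\omega_0}$ is the smooth bundle $T^{1,0}\oplus T^*_{1,0}$ ($T^*_{1,0}$ = bundle of $(1,0)$-forms) with pairing $\langle X+\xi,X+\xi\rangle=\xi(X)$ and Dolbeault operator $\bar\partial(X+\xi)=\bar\partial X+\bar\partial\xi-\sqrt{-1}\,i_X\partial\omega_0$ (the $(1,1)$-forms $\bar\partial\xi$ and $i_X\partial\omega_0$ are viewed as $(0,1)$-forms with values in $T^*_{1,0}$ by contracting a $(0,1)$-vector in the first slot). Write $\beta(X)=i_X\beta$ and $e^{\sqrt{-1}\beta}(X+\xi)=X+\xi+\sqrt{-1}\beta(X)$. Let $g$ also denote its $\mathbb C$-bilinear extension, viewed as a map $X\mapsto g(X,\cdot)$ with inverse $g^{-1}$ (so $g^{-1}:T^*_{1,0}\to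 T^{0,1}$). The generalized Hermitian metric is $$G(X+\xi,X+\xi)=g(X,\overline X)+g^{-1}\big(\xi+\sqrt{-1}\beta(X),\overline{\xi+\sqrt{-1}\beta(X)}\big).$$ For a Hermitian metric $h$ on a holomorphic bundle with Chern curvature $\Omega^h$, $S^h_g=\sqrt{-1}\,\mathrm{tr}_\omega\Omega^h$, i.e. in coordinates $S^h_g=g^{\bar ji}\Omega^h(\partial_i,\partial_{\bar j})$. The block matrix acts on columns $(X,\xi)^T\in T^{1,0}\oplus T^*_{1,0}$; two-forms are viewed as maps $X\mapsto\rho(X,\cdot)$; and $(e^{\sqrt{-1}\beta})^*A=e^{-\sqrt{-1}\beta}\circ A\circ e^{\sqrt{-1}\beta}$. *)

theory Defs
  imports "HOL-Analysis.Analysis"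
begin

section \<open>Conventions\<close>

text \<open>
  A complex manifold is a topological space with a holomorphic atlas, and tensor fields are given
  classically: by their local expressions in all charts of the atlas, which have to be smooth and
  to obey the transformation law. The image of a chart is an open set of \<open>\<complex>\<^sup>n\<close>. All differential
  operators are local and are defined on such open sets.

  At a point of \<open>\<complex>\<^sup>n\<close> the real tangent space is \<^typ>\<open>complex ^ 'n\<close> itself, with complex structure
  \<open>J v = \<i> *s v\<close>. The complexified tangent space has the frame \<open>\<partial>\<^sub>i = \<partial>/\<partial>z\<^sub>i\<close>, \<open>\<partial>/\<partial>zbar\<^sub>i\<close>;
  the pair \<open>(a, b)\<close> stands for the vector \<open>\<Sum>i. a\<^sub>i \<partial>/\<partial>z\<^sub>i + b\<^sub>i \<partial>/\<partial>zbar\<^sub>i\<close>. Thus \<open>(a, 0)\<close> is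
  a \<open>(1,0)\<close>-vector and \<open>(0, b)\<close> a \<open>(0,1)\<close>-vector, and a real vector \<open>v\<close> is the pair
  \<open>(v, cnj_vec v)\<close>.

  A \<open>k\<close>-form at a point is a complex-valued, real-multilinear, alternating function of \<open>k\<close> real
  tangent vectors, encoded as a function on lists of which only the values at lists of length \<open>k\<close>
  matter.
\<close>

type_synonym 'n ctan = "(complex ^ 'n) \<times> (complex ^ 'n)"
type_synonym 'n form = "(complex ^ 'n) list \<Rightarrow> complex"
type_synonym 'n form_field = "complex ^ 'n \<Rightarrow> 'n form"
type_synonym 'n metric = "complex ^ 'n \<Rightarrow> complex ^ 'n \<Rightarrow> complex ^ 'n \<Rightarrow> real"

abbreviation dir_deriv ::
  "('v::real_normed_vector \<Rightarrow> 'w::real_normed_vector) \<Rightarrow> 'v \<Rightarrow> 'v \<Rightarrow> 'w"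
  where "dir_deriv f z v \<equiv> frechet_derivative f (at z) v"

text \<open>For open \<open>S\<close> in finite dimension the following is the usual class \<open>C\<^sup>k\<close>.\<close>

primrec Ck_on :: "nat \<Rightarrow> 'v::real_normed_vector set \<Rightarrow> ('v \<Rightarrow> 'w::real_normed_vector) \<Rightarrow> bool" where
  "Ck_on 0 S f \<longleftrightarrow> continuous_on S f"
| "Ck_on (Suc k) S f \<longleftrightarrow>
     (\<forall>z\<in>S. f differentiable (at z)) \<and> (\<forall>v. Ck_on k S (\<lambda>z. dir_deriv f z v))"

definition smooth_on :: "'v::real_normed_vector set \<Rightarrow> ('v \<Rightarrow> 'w::real_normed_vector) \<Rightarrow> bool" where
  "smooth_on S f \<longleftrightarrow> (\<forall>k. Ck_on k S f)"

definition cnj_vec :: "complex ^ 'n::finite \<Rightarrow> complex ^ 'n" where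
  "cnj_vec v = (\<chi> i. cnj (v $ i))"

definition cnj_tan :: "'n::finite ctan \<Rightarrow> 'n ctan" where
  "cnj_tan w = (cnj_vec (snd w), cnj_vec (fst w))"


section \<open>Forms, type decomposition, and the operators \<open>\<partial>\<close> and \<open>\<partial>bar\<close>\<close>

text \<open>
  Complex-linear extension of a real-linear map from real to complexified tangent vectors. It uses
  \<open>\<Sum>i. a\<^sub>i \<partial>/\<partial>z\<^sub>i = (a - \<i> J a) / 2\<close> and \<open>\<Sum>i. b\<^sub>i \<partial>/\<partial>zbar\<^sub>i = (b' + \<i> J b') / 2\<close> with
  \<open>b' = cnj_vec b\<close>.
\<close>

definition clin :: "(complex ^ 'n::finite \<Rightarrow> complex) \<Rightarrow> 'n ctan \<Rightarrow> complex" where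
  "clin L w = (L (fst w) - \<i> * L (\<i> *s fst w)) / 2
     + (L (cnj_vec (snd w)) + \<i> * L (\<i> *s cnj_vec (snd w))) / 2"

text \<open>Complex-multilinear extension of a form.\<close>

primrec cext :: "'n::finite form \<Rightarrow> 'n ctan list \<Rightarrow> complex" where
  "cext a [] = a []"
| "cext a (w # ws) = clin (\<lambda>v. cext (\<lambda>vs. a (v # vs)) ws) w"

text \<open>
  The component of type \<open>(p,q)\<close>: expand each argument into its \<open>(1,0)\<close>- and its \<open>(0,1)\<close>-part and
  keep the terms with exactly \<open>p\<close> arguments of the first and \<open>q\<close> of the second kind.
\<close>

definition pq_part :: "nat \<Rightarrow> nat \<Rightarrow> 'n::finite form \<Rightarrow> 'n form" where
  "pq_part p q a vs =
     (\<Sum>ts | length ts = length vs \<and> count_list ts True = p \<and> count_list ts False = q.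
        cext a (map2 (\<lambda>t v. if t then (v, 0) else (0, cnj_vec v)) ts vs))"

text \<open>Exterior derivative, evaluated on constant vector fields (whose brackets vanish).\<close>

definition ext_d :: "'n::finite form_field \<Rightarrow> 'n form_field" where
  "ext_d \<alpha> z vs =
     (\<Sum>i<length vs. (-1) ^ i * dir_deriv (\<lambda>y. \<alpha> y (take i vs @ drop (Suc i) vs)) z (vs ! i))"

text \<open>
  On \<open>(p,q)\<close>-forms \<open>\<partial>\<close> and \<open>\<partial>bar\<close> are the components of \<open>d\<close> of types \<open>(p+1,q)\<close> and \<open>(p,q+1)\<close>.
  A list \<open>vs\<close> of arguments of the derivative belongs to a form of degree \<open>length vs - 1\<close>.
\<close>

definition del :: "'n::finite form_field \<Rightarrow> 'n form_field" where
  "del \<alpha> z vs = (let k = length vs - 1 in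
     \<Sum>p\<le>k. pq_part (p + 1) (k - p) (ext_d (\<lambda>y. pq_part p (k - p) (\<alpha> y)) z) vs)"

definition delbar :: "'n::finite form_field \<Rightarrow> 'n form_field" where
  "delbar \<alpha> z vs = (let k = length vs - 1 in
     \<Sum>p\<le>k. pq_part p (k - p + 1) (ext_d (\<lambda>y. pq_part p (k - p) (\<alpha> y)) z) vs)"

definition dc :: "'n::finite form_field \<Rightarrow> 'n form_field" where
  "dc \<alpha> z vs = \<i> * (delbar \<alpha> z vs - del \<alpha> z vs)"


section \<open>Connections on trivialised bundles\<close>

text \<open>The connection \<open>d + A\<close> and its curvature.\<close>

definition cov ::
  "('v::real_normed_vector \<Rightarrow> 'v \<Rightarrow> 'f \<Rightarrow> 'f) \<Rightarrow> ('v \<Rightarrow> 'v) \<Rightarrow> ('v \<Rightarrow> 'f) \<Rightarrow> 'v \<Rightarrow> 'f::real_normed_vector"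
  where "cov A X s z = dir_deriv s z (X z) + A z (X z) (s z)"

definition lie_bracket ::
  "('v::real_normed_vector \<Rightarrow> 'v) \<Rightarrow> ('v \<Rightarrow> 'v) \<Rightarrow> 'v \<Rightarrow> 'v"
  where "lie_bracket X Y z = dir_deriv Y z (X z) - dir_deriv X z (Y z)"

definition curvature ::
  "('v::real_normed_vector \<Rightarrow> 'v \<Rightarrow> 'f \<Rightarrow> 'f) \<Rightarrow> ('v \<Rightarrow> 'v) \<Rightarrow> ('v \<Rightarrow> 'v) \<Rightarrow> ('v \<Rightarrow> 'f)
     \<Rightarrow> 'v \<Rightarrow> 'f::real_normed_vector"
  where "curvature A X Y s z =
    cov A X (cov A Y s) z - cov A Y (cov A X s) z - cov A (lie_bracket X Y) s z"

text \<open>The curvature as a tensor, obtained by extending the three arguments to constant fields.\<close>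

definition curv ::
  "('v::real_normed_vector \<Rightarrow> 'v \<Rightarrow> 'f \<Rightarrow> 'f) \<Rightarrow> 'v \<Rightarrow> 'v \<Rightarrow> 'v \<Rightarrow> 'f \<Rightarrow> 'f::real_normed_vector"
  where "curv A z u v f = curvature A (\<lambda>_. u) (\<lambda>_. v) (\<lambda>_. f) z"


section \<open>Local Hermitian geometry\<close>

definition kahler_form :: "'n::finite metric \<Rightarrow> 'n form_field" where
  "kahler_form g z vs = complex_of_real (g z (\<i> *s (vs ! 0)) (vs ! 1))"

text \<open>
  The connection form at \<open>z\<close> of the Levi-Civita connection, i.e. of the torsion-free metric
  connection.
\<close>

definition levi_civita ::
  "'n::finite metric \<Rightarrow> complex ^ 'n \<Rightarrow> complex ^ 'n \<Rightarrow> complex ^ 'n \<Rightarrow> complex ^ 'n" where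
  "levi_civita g z = (THE A. bilinear A
     \<and> (\<forall>X Y. X differentiable (at z) \<longrightarrow> Y differentiable (at z) \<longrightarrow>
          cov (\<lambda>_. A) X Y z - cov (\<lambda>_. A) Y X z = lie_bracket X Y z)
     \<and> (\<forall>X Y Z. X differentiable (at z) \<longrightarrow> Y differentiable (at z) \<longrightarrow> Z differentiable (at z) \<longrightarrow>
          dir_deriv (\<lambda>y. g y (Y y) (Z y)) z (X z) =
            g z (cov (\<lambda>_. A) X Y z) (Z z) + g z (Y z) (cov (\<lambda>_. A) X Z z)))"

text \<open>
  The Bismut connection form: \<open>g(\<nabla>\<^sup>B\<^sub>X Y, Z) = g(\<nabla>\<^sub>X Y, Z) - 1/2 d\<^sup>c\<omega>(X,Y,Z)\<close>, where the derivative
  term common to both connections is cancelled. The form \<open>d\<^sup>c\<omega>\<close> is real.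
\<close>

definition bismut ::
  "'n::finite metric \<Rightarrow> complex ^ 'n \<Rightarrow> complex ^ 'n \<Rightarrow> complex ^ 'n \<Rightarrow> complex ^ 'n" where
  "bismut g z u v = (THE w. \<forall>x.
     g z w x = g z (levi_civita g z u v) x - 1 / 2 * Re (dc (kahler_form g) z [u, v, x]))"

definition orthonormal_basis :: "(complex ^ 'n::finite \<Rightarrow> complex ^ 'n \<Rightarrow> real) \<Rightarrow> (complex ^ 'n) set \<Rightarrow> bool" where
  "orthonormal_basis b B \<longleftrightarrow>
     span B = UNIV \<and> (\<forall>e\<in>B. \<forall>f\<in>B. b e f = (if e = f then 1 else 0))"

definition bismut_ricci :: "'n::finite metric \<Rightarrow> 'n form_field" where
  "bismut_ricci g z vs = complex_of_real
     (1 / 2 * (\<Sum>e\<in>(SOME B. orthonormal_basis (g z) B).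
        g z (curv (bismut g) z (vs ! 0) (vs ! 1) (\<i> *s e)) e))"

text \<open>
  The complex-bilinear extension of \<open>g\<close>, the inverse of \<open>w \<mapsto> g(w, \<cdot>)\<close> on complexified covectors
  (complex-linear functionals on complexified tangent vectors), the induced bilinear form on
  covectors, and the conjugate of a covector.
\<close>

definition metric_c :: "'n::finite metric \<Rightarrow> complex ^ 'n \<Rightarrow> 'n ctan \<Rightarrow> 'n ctan \<Rightarrow> complex" where
  "metric_c g z v w = cext (\<lambda>vs. complex_of_real (g z (vs ! 0) (vs ! 1))) [v, w]"

definition metric_inv :: "'n::finite metric \<Rightarrow> complex ^ 'n \<Rightarrow> ('n ctan \<Rightarrow> complex) \<Rightarrow> 'n ctan" where
  "metric_inv g z \<theta> = (THE w. \<forall>v. metric_c g z w v = \<theta> v)"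

definition cometric_c ::
  "'n::finite metric \<Rightarrow> complex ^ 'n \<Rightarrow> ('n ctan \<Rightarrow> complex) \<Rightarrow> ('n ctan \<Rightarrow> complex) \<Rightarrow> complex" where
  "cometric_c g z \<theta> \<eta> = metric_c g z (metric_inv g z \<theta>) (metric_inv g z \<eta>)"

definition cnj_cov :: "('n::finite ctan \<Rightarrow> complex) \<Rightarrow> 'n ctan \<Rightarrow> complex" where
  "cnj_cov \<theta> w = cnj (\<theta> (cnj_tan w))"


section \<open>The bundle \<open>T\<^sup>1\<^sup>,\<^sup>0 \<oplus> T\<^sup>*\<^sub>1\<^sub>,\<^sub>0\<close>\<close>

text \<open>
  In a chart the bundle is trivialised by the frame \<open>\<partial>/\<partial>z\<^sub>i, dz\<^sub>i\<close>: the pair \<open>(X, \<xi>)\<close> of component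
  vectors stands for \<open>\<Sum>i. X\<^sub>i \<partial>/\<partial>z\<^sub>i + \<Sum>i. \<xi>\<^sub>i dz\<^sub>i\<close>.
\<close>

type_synonym 'n qvec = "(complex ^ 'n) \<times> (complex ^ 'n)"

definition qscale :: "complex \<Rightarrow> 'n::finite qvec \<Rightarrow> 'n qvec" where
  "qscale c s = (c *s fst s, c *s snd s)"

text \<open>Complex-linear extension as in \<^const>\<open>clin\<close>, for maps with values in the fibre.\<close>

definition qclin :: "(complex ^ 'n::finite \<Rightarrow> 'n qvec) \<Rightarrow> 'n ctan \<Rightarrow> 'n qvec" where
  "qclin L w = qscale (1 / 2) (L (fst w) - qscale \<i> (L (\<i> *s fst w)))
     + qscale (1 / 2) (L (cnj_vec (snd w)) + qscale \<i> (L (\<i> *s cnj_vec (snd w))))"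

text \<open>The \<open>(1,0)\<close>-form \<open>\<Sum>k. \<xi>\<^sub>k dz\<^sub>k\<close>, and the components \<open>\<theta>(\<partial>/\<partial>z\<^sub>k)\<close> of a covector \<open>\<theta>\<close>.\<close>

definition form10 :: "complex ^ 'n::finite \<Rightarrow> 'n form" where
  "form10 \<xi> vs = (\<Sum>k\<in>UNIV. \<xi> $ k * (vs ! 0) $ k)"

definition comp10 :: "('n ctan \<Rightarrow> complex) \<Rightarrow> complex ^ 'n::finite" where
  "comp10 \<theta> = (\<chi> k. \<theta> (axis k 1, 0))"

text \<open>\<open>e\<^sup>i\<^sup>b(X + \<xi>) = X + \<xi> + \<i> b(X, \<cdot>)\<close> for a \<open>(2,0)\<close>-form \<open>b\<close> at a point.\<close>

definition exp_b :: "'n::finite form \<Rightarrow> 'n qvec \<Rightarrow> 'n qvec" where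
  "exp_b b s = (fst s, snd s + \<i> *s comp10 (\<lambda>w. cext b [(fst s, 0), w]))"

text \<open>
  The Dolbeault operator \<open>\<partial>bar(X + \<xi>) = \<partial>bar X + \<partial>bar \<xi> - \<i> i\<^sub>X \<partial>\<omega>\<^sub>0\<close>, evaluated on the
  \<open>(0,1)\<close>-vector with components \<open>b\<close>. The frame \<open>\<partial>/\<partial>z\<^sub>k\<close> being holomorphic, \<open>\<partial>bar X\<close> is taken
  componentwise. In the \<open>(1,1)\<close>-forms \<open>\<partial>bar \<xi>\<close> and \<open>i\<^sub>X \<partial>\<omega>\<^sub>0\<close> the \<open>(0,1)\<close>-vector is inserted first.
\<close>

definition dolbeault_Q ::
  "'n::finite form_field \<Rightarrow> (complex ^ 'n \<Rightarrow> 'n qvec) \<Rightarrow> complex ^ 'n \<Rightarrow> complex ^ 'n \<Rightarrow> 'n qvec" where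
  "dolbeault_Q \<omega>0 s z b =
     ((\<chi> k. clin (dir_deriv (\<lambda>y. fst (s y) $ k) z) (0, b)),
      (\<chi> k. cext (delbar (\<lambda>y. form10 (snd (s y))) z) [(0, b), (axis k 1, 0)]
            - \<i> * cext (del \<omega>0 z) [(fst (s z), 0), (0, b), (axis k 1, 0)]))"

text \<open>
  The generalized Hermitian metric \<open>G(\<omega>,\<beta>)\<close>, polarised to a sesquilinear form that is linear in
  the first argument.
\<close>

definition gen_metric ::
  "'n::finite metric \<Rightarrow> 'n form_field \<Rightarrow> complex ^ 'n \<Rightarrow> 'n qvec \<Rightarrow> 'n qvec \<Rightarrow> complex" where
  "gen_metric g \<beta> z s t =
     metric_c g z (fst s, 0) (cnj_tan (fst t, 0))
     + cometric_c g z (\<lambda>w. cext (form10 (snd (exp_b (\<beta> z) s))) [w])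
         (cnj_cov (\<lambda>w. cext (form10 (snd (exp_b (\<beta> z) t))) [w]))"

text \<open>
  The connection form at \<open>z\<close> of the Chern connection of the Hermitian metric \<open>h\<close> on the bundle
  with Dolbeault operator \<open>db\<close>, i.e. of the complex connection that is compatible with \<open>h\<close> and
  has \<open>(0,1)\<close>-part \<open>db\<close>.
\<close>

definition chern ::
  "((complex ^ 'n \<Rightarrow> 'n qvec) \<Rightarrow> complex ^ 'n \<Rightarrow> complex ^ 'n \<Rightarrow> 'n qvec)
   \<Rightarrow> (complex ^ 'n \<Rightarrow> 'n qvec \<Rightarrow> 'n qvec \<Rightarrow> complex)
   \<Rightarrow> complex ^ 'n::finite \<Rightarrow> complex ^ 'n \<Rightarrow> 'n qvec \<Rightarrow> 'n qvec" where
  "chern db h z = (THE A. bilinear A \<and> (\<forall>u c f. A u (qscale c f) = qscale c (A u f))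
     \<and> (\<forall>s b. s differentiable (at z) \<longrightarrow> qclin (\<lambda>u. cov (\<lambda>_. A) (\<lambda>_. u) s z) (0, b) = db s z b)
     \<and> (\<forall>s t u. s differentiable (at z) \<longrightarrow> t differentiable (at z) \<longrightarrow>
          dir_deriv (\<lambda>y. h y (s y) (t y)) z u =
            h z (cov (\<lambda>_. A) (\<lambda>_. u) s z) (t z) + h z (s z) (cov (\<lambda>_. A) (\<lambda>_. u) t z)))"

text \<open>
  \<open>S = g\<^sup>j\<^sup>i \<Omega>(\<partial>/\<partial>z\<^sub>i, \<partial>/\<partial>zbar\<^sub>j)\<close>, where \<open>(g\<^sup>j\<^sup>i)\<close> is the inverse of the matrix
  \<open>g\<^sub>i\<^sub>j = g(\<partial>/\<partial>z\<^sub>i, \<partial>/\<partial>zbar\<^sub>j)\<close>.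
\<close>

definition herm_matrix :: "'n::finite metric \<Rightarrow> complex ^ 'n \<Rightarrow> complex ^ 'n ^ 'n" where
  "herm_matrix g z = (\<chi> i j. metric_c g z (axis i 1, 0) (0, axis j 1))"

definition second_ricci ::
  "'n::finite metric \<Rightarrow> ((complex ^ 'n \<Rightarrow> 'n qvec) \<Rightarrow> complex ^ 'n \<Rightarrow> complex ^ 'n \<Rightarrow> 'n qvec)
   \<Rightarrow> (complex ^ 'n \<Rightarrow> 'n qvec \<Rightarrow> 'n qvec \<Rightarrow> complex) \<Rightarrow> complex ^ 'n \<Rightarrow> 'n qvec \<Rightarrow> 'n qvec" where
  "second_ricci g db h z s =
     (\<Sum>i\<in>UNIV. \<Sum>j\<in>UNIV. qscale (matrix_inv (herm_matrix g z) $ j $ i)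
        (qclin (\<lambda>u. qclin (\<lambda>v. curv (chern db h) z u v s) (0, axis j 1)) (axis i 1, 0)))"

text \<open>A two-form viewed as a map from vectors to covectors, and the block matrix of the theorem.\<close>

definition flat :: "'n::finite form \<Rightarrow> 'n ctan \<Rightarrow> 'n ctan \<Rightarrow> complex" where
  "flat a w = (\<lambda>v. cext a [w, v])"

definition ricci_block :: "'n::finite metric \<Rightarrow> complex ^ 'n \<Rightarrow> 'n qvec \<Rightarrow> 'n qvec" where
  "ricci_block g z s =
     (let \<rho>11 = flat (pq_part 1 1 (bismut_ricci g z));
          \<rho>20 = flat (pq_part 2 0 (bismut_ricci g z));
          \<rho>02 = flat (pq_part 0 2 (bismut_ricci g z));
          X = (fst s, 0);
          Y = metric_inv g z (\<lambda>w. cext (form10 (snd s)) [w])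
      in (- fst (metric_inv g z (\<rho>11 X)) + fst (metric_inv g z (\<rho>02 Y)),
          comp10 (\<rho>20 X) - comp10 (\<rho>11 Y)))"


section \<open>Complex manifolds and tensor fields on them\<close>

type_synonym ('a, 'n) chart = "'a set \<times> ('a \<Rightarrow> complex ^ 'n)"

abbreviation chart_img :: "('a, 'n) chart \<Rightarrow> (complex ^ 'n) set" where
  "chart_img c \<equiv> snd c ` fst c"

definition coord_change :: "('a, 'n::finite) chart \<Rightarrow> ('a, 'n) chart \<Rightarrow> complex ^ 'n \<Rightarrow> complex ^ 'n" where
  "coord_change c c' = snd c' \<circ> inv_into (fst c) (snd c)"

definition holomorphic_map_on ::
  "(complex ^ 'n::finite) set \<Rightarrow> (complex ^ 'n \<Rightarrow> complex ^ 'n) \<Rightarrow> bool" where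
  "holomorphic_map_on S f \<longleftrightarrow>
     (\<forall>z\<in>S. \<exists>L. (f has_derivative L) (at z) \<and> (\<forall>c v. L (c *s v) = c *s L v))"

definition complex_manifold :: "'a topology \<Rightarrow> ('a, 'n::finite) chart set \<Rightarrow> bool" where
  "complex_manifold M \<A> \<longleftrightarrow>
     Hausdorff_space M \<and> second_countable M \<and> (\<Union>c\<in>\<A>. fst c) = topspace M
     \<and> (\<forall>c\<in>\<A>. openin M (fst c) \<and> open (chart_img c)
          \<and> homeomorphic_map (subtopology M (fst c)) (top_of_set (chart_img c)) (snd c))
     \<and> (\<forall>c\<in>\<A>. \<forall>c'\<in>\<A>. holomorphic_map_on (snd c ` (fst c \<inter> fst c')) (coord_change c c'))"

definition hermitian_metric ::
  "('a, 'n::finite) chart set \<Rightarrow> (('a, 'n) chart \<Rightarrow> 'n metric) \<Rightarrow> bool" where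
  "hermitian_metric \<A> g \<longleftrightarrow>
     (\<forall>c\<in>\<A>. (\<forall>u v. smooth_on (chart_img c) (\<lambda>z. g c z u v))
        \<and> (\<forall>z\<in>chart_img c. bilinear (g c z)
             \<and> (\<forall>u v. g c z u v = g c z v u)
             \<and> (\<forall>u. u \<noteq> 0 \<longrightarrow> g c z u u > 0)
             \<and> (\<forall>u v. g c z (\<i> *s u) (\<i> *s v) = g c z u v)))
     \<and> (\<forall>c\<in>\<A>. \<forall>c'\<in>\<A>. \<forall>z\<in>snd c ` (fst c \<inter> fst c'). \<forall>u v.
          g c z u v = g c' (coord_change c c' z)
            (dir_deriv (coord_change c c') z u) (dir_deriv (coord_change c c') z v))"

definition alternating_form :: "nat \<Rightarrow> 'n::finite form \<Rightarrow> bool" where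
  "alternating_form k a \<longleftrightarrow>
     (\<forall>vs i. length vs = k \<longrightarrow> i < k \<longrightarrow> linear (\<lambda>v. a (vs[i := v])))
     \<and> (\<forall>vs i j. length vs = k \<longrightarrow> i < j \<longrightarrow> j < k \<longrightarrow> vs ! i = vs ! j \<longrightarrow> a vs = 0)"

definition pq_form ::
  "nat \<Rightarrow> nat \<Rightarrow> ('a, 'n::finite) chart set \<Rightarrow> (('a, 'n) chart \<Rightarrow> 'n form_field) \<Rightarrow> bool" where
  "pq_form p q \<A> \<beta> \<longleftrightarrow>
     (\<forall>c\<in>\<A>. (\<forall>vs. length vs = p + q \<longrightarrow> smooth_on (chart_img c) (\<lambda>z. \<beta> c z vs))
        \<and> (\<forall>z\<in>chart_img c. alternating_form (p + q) (\<beta> c z)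
             \<and> (\<forall>vs. length vs = p + q \<longrightarrow> pq_part p q (\<beta> c z) vs = \<beta> c z vs)))
     \<and> (\<forall>c\<in>\<A>. \<forall>c'\<in>\<A>. \<forall>z\<in>snd c ` (fst c \<inter> fst c'). \<forall>vs. length vs = p + q \<longrightarrow>
          \<beta> c z vs = \<beta> c' (coord_change c c' z) (map (dir_deriv (coord_change c c') z) vs))"

definition pluriclosed ::
  "('a, 'n::finite) chart set \<Rightarrow> (('a, 'n) chart \<Rightarrow> 'n metric) \<Rightarrow> bool" where
  "pluriclosed \<A> g \<longleftrightarrow>
     (\<forall>c\<in>\<A>. \<forall>z\<in>chart_img c. \<forall>vs. length vs = 4 \<longrightarrow> del (delbar (kahler_form (g c))) z vs = 0)"

definition bismut_hermitian_einstein ::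
  "('a, 'n::finite) chart set \<Rightarrow> (('a, 'n) chart \<Rightarrow> 'n metric) \<Rightarrow> bool" where
  "bismut_hermitian_einstein \<A> g \<longleftrightarrow> pluriclosed \<A> g
     \<and> (\<forall>c\<in>\<A>. \<forall>z\<in>chart_img c. \<forall>u v. bismut_ricci (g c) z [u, v] = 0)"

text \<open>
  \<open>S\<^sup>G\<^sub>g\<close> for \<open>G = G(\<omega>,\<beta>)\<close> on the bundle determined by \<open>\<omega>\<^sub>0\<close>, at the point \<open>z\<close> of the chart \<open>c\<close>.
\<close>

definition S_G ::
  "(('a, 'n::finite) chart \<Rightarrow> 'n metric) \<Rightarrow> (('a, 'n) chart \<Rightarrow> 'n metric)
   \<Rightarrow> (('a, 'n) chart \<Rightarrow> 'n form_field) \<Rightarrow> ('a, 'n) chart \<Rightarrow> complex ^ 'n \<Rightarrow> 'n qvec \<Rightarrow> 'n qvec" where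
  "S_G g0 g \<beta> c =
     second_ricci (g c) (dolbeault_Q (kahler_form (g0 c))) (gen_metric (g c) (\<beta> c))"

definition hermitian_einstein ::
  "('a, 'n::finite) chart set \<Rightarrow> (('a, 'n) chart \<Rightarrow> 'n metric) \<Rightarrow> (('a, 'n) chart \<Rightarrow> 'n metric)
   \<Rightarrow> (('a, 'n) chart \<Rightarrow> 'n form_field) \<Rightarrow> bool" where
  "hermitian_einstein \<A> g0 g \<beta> \<longleftrightarrow> (\<forall>c\<in>\<A>. \<forall>z\<in>chart_img c. \<forall>s. S_G g0 g \<beta> c z s = 0)"

end

theory Submission
  imports Defs
begin

text \<open>
  The map \<open>X + \<xi> \<mapsto> X - g\<^sup>-\<^sup>1(\<xi> + \<i> \<beta>(X))\<close> identifies the bundle with the complexified tangent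
  bundle. It carries \<open>G\<close> to the Hermitian extension of \<open>g\<close>, and by \<open>\<partial>bar \<beta> = \<partial>\<omega>\<^sub>0 - \<partial>\<omega>\<close> it carries the
  Dolbeault operator to the \<open>(0,1)\<close>-part of the connection \<open>\<nabla>\<^sup>-\<close> with \<open>g(\<nabla>\<^sup>-\<^sub>X Y, Z) = g(\<nabla>\<^sub>X Y, Z) + 1/2 d\<^sup>c\<omega>(X, Y, Z)\<close>.
  So the Chern connection of \<open>G\<close> is \<open>\<nabla>\<^sup>-\<close>. As \<open>d d\<^sup>c \<omega> = 0\<close>, its curvature satisfies
  \<open>g(R\<^sup>-(X, Y) Z, W) = g(R\<^sup>B(Z, W) X, Y)\<close>, and tracing over \<open>X, Y\<close> turns the left-hand side into \<open>S\<close> and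
  the right-hand side into \<open>- \<i> \<rho>\<^sub>B(Z, W)\<close>. Splitting into types gives the block matrix.
\<close>

section \<open>Calculus\<close>

text \<open>The Levi-Civita and Chern connections are definite descriptions over fields
  differentiable at one point only. Neither the inverse metric nor the inverse bundle map is given
  by a formula: both are differentiated by a lemma on inverses of families of linear maps, and
  curvature is computed with its last index lowered, where metric compatibility removes the
  derivatives of the raised connection. The pair symmetry has two halves. Its quadratic terms agree
  because swapping the arguments of a connection form reverses the torsion; its second-derivative
  terms differ by half of dd^c \<omega>. Pluriclosedness kills only the (2,2)-part of that form, so
  the other types must vanish for every Hermitian metric. The factor -i comes from comparing traces:
  R^B commutes with J and is skew, so its complex trace is imaginary, while \<rho>_B, half the real
  trace of R^B J, is minus the imaginary part of that trace. Tangent vectors already carry J, so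
  complexified ones are kept as pairs of real vectors, on which J and the scalar i act
  independently.\<close>

lemma dir_deriv_eq: "(f has_derivative f') (at z) \<Longrightarrow> dir_deriv f z v = f' v"
  using frechet_derivative_at by metis

lemma has_derivative_dir_deriv: "f differentiable (at z) \<Longrightarrow> (f has_derivative dir_deriv f z) (at z)"
  by (simp add: frechet_derivative_works)

lemma linear_dir_deriv: "f differentiable (at z) \<Longrightarrow> linear (dir_deriv f z)"
  by (rule linear_frechet_derivative)

lemma differentiable_cong_open:
  assumes "open S" "z \<in> S" "\<And>y. y \<in> S \<Longrightarrow> f y = h y"
  shows "f differentiable (at z) \<longleftrightarrow> h differentiable (at z)"
proof -
  have "(f has_derivative f') (at z) \<longleftrightarrow> (h has_derivative f') (at z)" for f'
    using assms has_derivative_transform_within_open[of f f' z UNIV S h]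
      has_derivative_transform_within_open[of h f' z UNIV S f] by auto
  then show ?thesis unfolding differentiable_def by simp
qed

lemma dir_deriv_cong_open:
  assumes "open S" "z \<in> S" "\<And>y. y \<in> S \<Longrightarrow> f y = h y"
  shows "dir_deriv f z v = dir_deriv h z v"
proof -
  have "(f has_derivative f') (at z) \<longleftrightarrow> (h has_derivative f') (at z)" for f'
    using assms has_derivative_transform_within_open[of f f' z UNIV S h]
      has_derivative_transform_within_open[of h f' z UNIV S f] by auto
  then show ?thesis unfolding frechet_derivative_def by simp
qed

lemma dir_deriv_add:
  assumes "f differentiable (at z)" "h differentiable (at z)"
  shows "dir_deriv (\<lambda>y. f y + h y) z v = dir_deriv f z v + dir_deriv h z v"
  by (rule dir_deriv_eq) (intro has_derivative_add has_derivative_dir_deriv assms)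

lemma dir_deriv_diff:
  assumes "f differentiable (at z)" "h differentiable (at z)"
  shows "dir_deriv (\<lambda>y. f y - h y) z v = dir_deriv f z v - dir_deriv h z v"
  by (rule dir_deriv_eq) (intro has_derivative_diff has_derivative_dir_deriv assms)

lemma dir_deriv_bounded_linear:
  assumes "bounded_linear T" "f differentiable (at z)"
  shows "dir_deriv (\<lambda>y. T (f y)) z v = T (dir_deriv f z v)"
  by (rule dir_deriv_eq) (rule bounded_linear.has_derivative[OF assms(1) has_derivative_dir_deriv[OF assms(2)]])

lemma differentiable_bounded_linear:
  assumes "bounded_linear T" "f differentiable (at z)"
  shows "(\<lambda>y. T (f y)) differentiable (at z)"
  using bounded_linear.has_derivative[OF assms(1) has_derivative_dir_deriv[OF assms(2)]]
  by (auto simp: differentiable_def)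

text \<open>Expanding \<open>s\<close> in a basis of the finite-dimensional fibre reduces this
  Leibniz rule to products of scalar functions with the fixed columns \<open>B y b\<close>.
  Differentiability is asked at \<open>z\<close> alone, to match the sections over which
  \<open>levi_civita\<close> and \<open>chern\<close> quantify.\<close>

lemma linear_family_has_derivative:
  fixes B :: "'v::real_normed_vector \<Rightarrow> 'f::euclidean_space \<Rightarrow> 'w::real_normed_vector"
  assumes S: "open S" "z \<in> S" and lin: "\<And>y. y \<in> S \<Longrightarrow> linear (B y)"
    and B: "\<And>f. (\<lambda>y. B y f) differentiable (at z)" and s: "s differentiable (at z)"
  shows "((\<lambda>y. B y (s y)) has_derivative
    (\<lambda>u. dir_deriv (\<lambda>y. B y (s z)) z u + B z (dir_deriv s z u))) (at z)"
proof -
  have exp: "B y f = (\<Sum>b\<in>Basis. (f \<bullet> b) *\<^sub>R B y b)" if "y \<in> S" for y f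
    using linear_sum[OF lin[OF that], of "\<lambda>b. (f \<bullet> b) *\<^sub>R b" Basis]
    by (simp add: euclidean_representation linear_scale[OF lin[OF that]])
  have 1: "((\<lambda>y. \<Sum>b\<in>Basis. (s y \<bullet> b) *\<^sub>R B y b) has_derivative
    (\<lambda>u. \<Sum>b\<in>Basis. (s z \<bullet> b) *\<^sub>R dir_deriv (\<lambda>y. B y b) z u +
        (dir_deriv s z u \<bullet> b) *\<^sub>R B z b)) (at z)"
    by (intro has_derivative_sum has_derivative_scaleR has_derivative_inner_left
        has_derivative_dir_deriv B s)
  have 2: "dir_deriv (\<lambda>y. B y f) z u = (\<Sum>b\<in>Basis. (f \<bullet> b) *\<^sub>R dir_deriv
      (\<lambda>y. B y b) z u)" for f u
  proof -
    have "dir_deriv (\<lambda>y. B y f) z u = dir_deriv (\<lambda>y. \<Sum>b\<in>Basis. (f \<bullet> b) *\<^sub>R B y b) z u"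
      by (rule dir_deriv_cong_open[OF S exp])
    also have "\<dots> = (\<Sum>b\<in>Basis. (f \<bullet> b) *\<^sub>R dir_deriv (\<lambda>y. B y b) z u)"
      by (rule dir_deriv_eq) (intro has_derivative_sum has_derivative_scaleR_right has_derivative_dir_deriv B)
    finally show ?thesis .
  qed
  have "(\<lambda>u. \<Sum>b\<in>Basis. (s z \<bullet> b) *\<^sub>R dir_deriv (\<lambda>y. B y b) z u +
      (dir_deriv s z u \<bullet> b) *\<^sub>R B z b)
    = (\<lambda>u. dir_deriv (\<lambda>y. B y (s z)) z u + B z (dir_deriv s z u))"
    by (simp add: fun_eq_iff sum.distrib 2[of "s z"] exp[OF S(2), symmetric])
  with 1 have "((\<lambda>y. \<Sum>b\<in>Basis. (s y \<bullet> b) *\<^sub>R B y b) has_derivative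
    (\<lambda>u. dir_deriv (\<lambda>y. B y (s z)) z u + B z (dir_deriv s z u))) (at z)" by simp
  then show ?thesis by (rule has_derivative_transform_within_open[OF _ S]) (simp add: exp)
qed

lemma linear_family_differentiable:
  fixes B :: "'v::real_normed_vector \<Rightarrow> 'f::euclidean_space \<Rightarrow> 'w::real_normed_vector"
  assumes "open S" "z \<in> S" "\<And>y. y \<in> S \<Longrightarrow> linear (B y)"
    and "\<And>f. (\<lambda>y. B y f) differentiable (at z)" and "s differentiable (at z)"
  shows "(\<lambda>y. B y (s y)) differentiable (at z)"
  using linear_family_has_derivative[OF assms] by (auto simp: differentiable_def)

lemma linear_family_dir_deriv:
  fixes B :: "'v::real_normed_vector \<Rightarrow> 'f::euclidean_space \<Rightarrow> 'w::real_normed_vector"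
  assumes "open S" "z \<in> S" "\<And>y. y \<in> S \<Longrightarrow> linear (B y)"
    and "\<And>f. (\<lambda>y. B y f) differentiable (at z)" and "s differentiable (at z)"
  shows "dir_deriv (\<lambda>y. B y (s y)) z u = dir_deriv (\<lambda>y. B y (s z)) z u + B z (dir_deriv s z u)"
  by (rule dir_deriv_eq[OF linear_family_has_derivative[OF assms]])

text \<open>As \<open>k\<close> is differentiable and vanishes at \<open>z\<close>, it is of order
  \<open>norm (y - z)\<close>; the factor \<open>f\<close> tending to 0 makes the product of smaller
  order. So \<open>f\<close> may be merely continuous, which is all that is known of the unknown
  section when the lemma is applied.\<close>

lemma has_derivative_mult_vanishing:
  fixes f :: "'v::real_normed_vector \<Rightarrow> real" and k :: "'v \<Rightarrow> 'w::real_normed_vector"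
  assumes f: "(f \<longlongrightarrow> 0) (at z)" and k: "k differentiable (at z)" "k z = 0" and fz: "f z = 0"
  shows "((\<lambda>y. f y *\<^sub>R k y) has_derivative (\<lambda>_. 0)) (at z)"
proof -
  obtain k' where k': "(k has_derivative k') (at z)" using k by (auto simp: differentiable_def)
  then have "bounded_linear k'" by (rule has_derivative_bounded_linear)
  then obtain C where C: "\<And>x. norm (k' x) \<le> norm x * C" using bounded_linear.bounded by blast
  have lim: "((\<lambda>y. norm (k y - k z - k' (y - z)) / norm (y - z)) \<longlongrightarrow> 0) (at z)"
    using k' by (simp add: has_derivative_iff_norm)
  have "((\<lambda>y. \<bar>f y\<bar> * (norm (k y - k z - k' (y - z)) / norm (y - z)
      + C)) \<longlongrightarrow> \<bar>0\<bar> * (0 + C)) (at z)"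
    by (intro tendsto_intros f lim)
  then have lim2: "((\<lambda>y. \<bar>f y\<bar> * (norm (k y - k z - k' (y - z)) / norm (y - z)
      + C)) \<longlongrightarrow> 0) (at z)" by simp
  have est: "norm (norm (f y *\<^sub>R k y) / norm (y - z)) \<le> \<bar>f y\<bar> * (norm (k y - k z - k' (y - z)) / norm
      (y - z) + C)"
    if "y \<noteq> z" for y
  proof -
    have "norm (k y) \<le> norm (k y - k z - k' (y - z)) + norm (k' (y - z))"
      using norm_triangle_sub[of "k y" "k' (y - z)"] k(2) by (simp add: algebra_simps)
    also have "\<dots> \<le> norm (k y - k z - k' (y - z)) + norm (y - z) * C" using C by simp
    finally have "norm (k y) / norm (y - z) \<le> norm (k y - k z - k' (y - z)) / norm (y - z) + C"
      using that by (simp add: divide_simps mult.commute)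
    then have "\<bar>f y\<bar> * (norm (k y) / norm (y - z)) \<le> \<bar>f y\<bar> * (norm (k y - k z - k' (y - z)) / norm
        (y - z) + C)"
      by (rule mult_left_mono) simp
    then show ?thesis by simp
  qed
  have "((\<lambda>y. norm (f y *\<^sub>R k y) / norm (y - z)) \<longlongrightarrow> 0) (at z)"
  proof (rule Lim_null_comparison[OF _ lim2])
    show "\<forall>\<^sub>F y in at z. norm (norm (f y *\<^sub>R k y) / norm (y - z))
      \<le> \<bar>f y\<bar> * (norm (k y - k z - k' (y - z)) / norm (y - z) + C)"
      unfolding eventually_at by (intro exI[of _ 1] conjI ballI impI est zero_less_one) blast
  qed
  then show ?thesis by (simp add: has_derivative_iff_norm fz)
qed

text \<open>The fixed-point form \<open>s = r - (M - 1) s\<close> with \<open>M z = 1\<close> first bounds \<open>s\<close>,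
  then gives its continuity, and then its differentiability.\<close>

lemma linear_family_inverse_differentiable:
  fixes B :: "'v::real_normed_vector \<Rightarrow> 'f::euclidean_space \<Rightarrow> 'w::euclidean_space"
  assumes S: "open S" "z \<in> S" and lin: "\<And>y. y \<in> S \<Longrightarrow> linear (B y)" and inj: "inj (B z)"
    and B: "\<And>f. (\<lambda>y. B y f) differentiable (at z)"
    and Bs: "(\<lambda>y. B y (s y)) differentiable (at z)"
  shows "s differentiable (at z)"
proof -
  obtain L where L: "linear L" "L \<circ> B z = id"
    using linear_injective_left_inverse[OF lin[OF S(2)] inj] by blast
  have bL: "bounded_linear L" using L(1) by (simp add: linear_conv_bounded_linear)
  define r where "r y = L (B y (s y))" for y
  define k where "k b y = L (B y b) - b" for b :: 'f and y
  have r: "r differentiable (at z)" unfolding r_def by (rule differentiable_bounded_linear[OF bL Bs])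
  have k: "k b differentiable (at z)" for b
    unfolding k_def by (intro differentiable_diff differentiable_bounded_linear[OF bL B] differentiable_const)
  have kz: "k b z = 0" for b using L(2) by (simp add: k_def fun_eq_iff)
  have rz: "r z = s z" using L(2) by (simp add: r_def fun_eq_iff)
  have klim: "(k b \<longlongrightarrow> 0) (at z)" for b
    using differentiable_imp_continuous_within[OF k[of b]] kz[of b] by (simp add: continuous_within)
  have rlim: "(r \<longlongrightarrow> s z) (at z)"
    using differentiable_imp_continuous_within[OF r] rz by (simp add: continuous_within)
  have expand: "L (B y f) - f = (\<Sum>b\<in>Basis. (f \<bullet> b) *\<^sub>R k b y)" if "y \<in> S" for y f
  proof -
    have "linear (\<lambda>f. L (B y f) - f)"
      using linear_compose[OF lin[OF that] L(1)] by (intro linear_compose_sub linear_ident) (simp add: o_def)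
    then have "linear (\<lambda>f. k f y)" by (simp add: k_def)
    from linear_sum[OF this, of "\<lambda>b. (f \<bullet> b) *\<^sub>R b" Basis] show ?thesis
      by (simp add: euclidean_representation linear_scale[OF \<open>linear (\<lambda>f. k f y)\<close>])
        (simp add: k_def)
  qed
  have fp: "s y = r y - (\<Sum>b\<in>Basis. (s y \<bullet> b) *\<^sub>R k b y)" if "y \<in> S" for y
    using expand[OF that, of "s y"] by (simp add: r_def algebra_simps)
  define \<kappa> where "\<kappa> y = (\<Sum>b\<in>Basis. norm (k b y))" for y
  have "(\<kappa> \<longlongrightarrow> (\<Sum>b\<in>(Basis::'f set). norm (0::'f))) (at z)"
    unfolding \<kappa>_def by (intro tendsto_intros klim)
  then have \<kappa>: "(\<kappa> \<longlongrightarrow> 0) (at z)" by simp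
  have \<kappa>0: "\<kappa> y \<ge> 0" for y unfolding \<kappa>_def by (intro sum_nonneg) auto
  have sr: "norm (s y - r y) \<le> norm (s y) * \<kappa> y" if "y \<in> S" for y
  proof -
    have "norm (s y - r y) = norm (\<Sum>b\<in>Basis. (s y \<bullet> b) *\<^sub>R k b y)" using fp[OF that]
      by (metis add_diff_cancel_left' diff_add_cancel minus_diff_eq norm_minus_cancel)
    also have "\<dots> \<le> (\<Sum>b\<in>Basis. norm (s y) * norm (k b y))"
      by (intro sum_norm_le) (auto intro!: mult_right_mono Basis_le_norm)
    finally show ?thesis by (simp add: \<kappa>_def sum_distrib_left)
  qed
  have evS: "eventually (\<lambda>y. y \<in> S) (at z)" using S by (rule eventually_at_in_open')
  \<comment> \<open>Below 1/2 the error term \<open>norm (s y) * \<kappa> y\<close> can be absorbed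
    into the left-hand side, which gives \<open>norm (s y) \<le> 2 * norm (r y)\<close> although
    nothing is known about \<open>s\<close> yet.\<close>
  have ev: "eventually (\<lambda>y. \<kappa> y < 1/2) (at z)" using \<kappa> by (rule order_tendstoD) simp
  have bd: "eventually (\<lambda>y. norm (s y - r y) \<le> 2 * norm (r y) * \<kappa> y) (at z)"
    using evS ev
  proof eventually_elim
    case (elim y)
    have "norm (s y) * \<kappa> y \<le> norm (s y) * (1/2)" using elim by (intro mult_left_mono) auto
    then have "norm (s y) \<le> norm (r y) + norm (s y) / 2"
      using sr[OF elim(1)] norm_triangle_sub[of "s y" "r y"] by linarith
    then have "norm (s y) * \<kappa> y \<le> (2 * norm (r y)) * \<kappa> y" using \<kappa>0 by (intro mult_right_mono) auto
    then show ?case using sr[OF elim(1)] by simp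
  qed
  have "((\<lambda>y. 2 * norm (r y) * \<kappa> y) \<longlongrightarrow> 2 * norm (s z) * 0) (at z)" by
      (intro tendsto_intros rlim \<kappa>)
  then have "((\<lambda>y. s y - r y) \<longlongrightarrow> 0) (at z)" using Lim_null_comparison[OF bd] by simp
  then have "((\<lambda>y. (s y - r y) + r y) \<longlongrightarrow> 0 + s z) (at z)" by (intro tendsto_intros rlim)
  then have slim: "(s \<longlongrightarrow> s z) (at z)" by simp
  \<comment> \<open>Continuity of \<open>s\<close> is now available, so the products of
    \<open>s - s z\<close> with the vanishing \<open>k b\<close> have derivative 0. What remains of
    the fixed-point equation contains only the constant value \<open>s z\<close>.\<close>
  have 0: "((\<lambda>y. \<Sum>b\<in>Basis. ((s y - s z) \<bullet> b) *\<^sub>R k b y) has_derivative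
      (\<lambda>u. \<Sum>b\<in>(Basis::'f set). 0)) (at z)"
  proof (intro has_derivative_sum has_derivative_mult_vanishing k kz)
    fix b :: 'f
    have "((\<lambda>y. (s y - s z) \<bullet> b) \<longlongrightarrow> (s z - s z) \<bullet> b) (at z)" by
        (intro tendsto_intros slim)
    then show "((\<lambda>y. (s y - s z) \<bullet> b) \<longlongrightarrow> 0) (at z)" by simp
  qed simp
  then have "(\<lambda>y. \<Sum>b\<in>Basis. ((s y - s z) \<bullet> b) *\<^sub>R k b y) differentiable (at z)"
    by (rule differentiableI)
  then have D: "(\<lambda>y. r y - (\<Sum>b\<in>Basis. ((s y - s z) \<bullet> b) *\<^sub>R k b y) - (L (B y (s z))
      - s z)) differentiable (at z)"
    by (intro differentiable_diff r differentiable_bounded_linear[OF bL B] differentiable_const)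
  have eq: "r y - (\<Sum>b\<in>Basis. ((s y - s z) \<bullet> b) *\<^sub>R k b y) - (L (B y (s z)) - s z) = s y" if
      "y \<in> S" for y
  proof -
    have "r y = s y + (\<Sum>b\<in>Basis. (s y \<bullet> b) *\<^sub>R k b y)"
      using fp[OF that] by (metis diff_add_cancel)
    then show ?thesis
      unfolding expand[OF that, of "s z"] inner_diff_left scaleR_diff_left sum_subtractf by simp
  qed
  show ?thesis by (rule iffD1[OF differentiable_cong_open[OF S eq] D])
qed

section \<open>Symmetry of second derivatives from pointwise differentiability\<close>

lemma second_difference_tendsto:
  fixes f :: "'v::real_normed_vector \<Rightarrow> real"
  assumes S: "open S" "z \<in> S" and f: "\<And>y. y \<in> S \<Longrightarrow> f differentiable (at y)"
    and p: "(\<lambda>y. dir_deriv f y u) differentiable (at z)"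
  shows "((\<lambda>h. (f (z + h *\<^sub>R u + h *\<^sub>R v) - f (z + h *\<^sub>R u) - f (z + h *\<^sub>R v) + f z) / h\<^sup>2)
    \<longlongrightarrow> dir_deriv (\<lambda>y. dir_deriv f y u) z v) (at_right 0)"
proof (rule tendstoI)
  fix e :: real assume e: "e > 0"
  define p where "p y = dir_deriv f y u" for y
  define p' where "p' = dir_deriv p z"
  have p': "(p has_derivative p') (at z)"
    using p has_derivative_dir_deriv unfolding p_def p'_def by blast
  then have lp': "linear p'" using has_derivative_linear by blast
  define K where "K = norm u + norm v + 1"
  have K: "K > 0" unfolding K_def by (simp add: add_nonneg_pos)
  \<comment> \<open>The remainders at \<open>c = 0\<close> and \<open>c = h\<close> are each at most
    \<open>e' * (h * K)\<close>; together they are \<open>h * (e / 2)\<close>, which leaves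
    \<open>e / 2\<close> after division by \<open>h\<close>.\<close>
  define e' where "e' = e / (4 * K)"
  have e': "e' > 0" using e K by (simp add: e'_def)
  obtain d where d: "d > 0" "\<And>y. norm (y - z) < d \<Longrightarrow> norm (p y - p z - p' (y - z)) \<le> e' * norm (y - z)"
    using p' e' unfolding has_derivative_at_alt by blast
  obtain d2 where d2: "d2 > 0" "\<And>y. dist y z < d2 \<Longrightarrow> y \<in> S" using S open_dist by blast
  define \<delta> where "\<delta> = min d d2 / K"
  have \<delta>: "\<delta> > 0" using d d2 K by (simp add: \<delta>_def)
  show "\<forall>\<^sub>F h in at_right 0. dist ((f (z + h *\<^sub>R u + h *\<^sub>R v) - f (z + h *\<^sub>R u) - f (z
      + h *\<^sub>R v) + f z) / h\<^sup>2)
     (dir_deriv (\<lambda>y. dir_deriv f y u) z v) < e"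
    unfolding eventually_at_right_field
  proof (intro exI[of _ \<delta>] conjI \<delta> allI impI)
    fix h :: real assume h: "h > 0" "h < \<delta>"
    have hK: "h * K < min d d2" using h(2) K by (simp add: \<delta>_def field_simps)
    have small: "norm (t *\<^sub>R u + c *\<^sub>R v) \<le> h * K" if "0 \<le> t" "t \<le> h" "0 \<le> c" "c \<le> h" for t c
    proof -
      have "norm (t *\<^sub>R u + c *\<^sub>R v) \<le> t * norm u + c * norm v"
        using norm_triangle_ineq[of "t *\<^sub>R u" "c *\<^sub>R v"] that by simp
      also have "\<dots> \<le> h * norm u + h * norm v" using that by (intro add_mono mult_right_mono) auto
      also have "\<dots> \<le> h * K" using h by (simp add: K_def algebra_simps)
      finally show ?thesis .
    qed
    have inS: "z + t *\<^sub>R u + c *\<^sub>R v \<in> S" if "0 \<le> t" "t \<le> h" "0 \<le> c" "c \<le> h" for t c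
      using small[OF that] hK d2(2)[of "z + t *\<^sub>R u + c *\<^sub>R v"] by (simp add: dist_norm add.assoc)
    \<comment> \<open>The increment in direction \<open>v\<close> is treated as a function of the
      parameter along \<open>u\<close>. The mean value theorem turns its total change into a
      difference of \<open>p\<close> at two points within \<open>h * K\<close> of \<open>z\<close>,
      where the differentiability of \<open>p\<close> at \<open>z\<close> applies. The summand
      \<open>0 *\<^sub>R v\<close> lets \<open>der\<close> cover both terms.\<close>
    define \<phi> where "\<phi> t = f (z + t *\<^sub>R u + h *\<^sub>R v) - f (z + t *\<^sub>R u + 0 *\<^sub>R v)" for t
    have der: "((\<lambda>t. f (z + t *\<^sub>R u + c *\<^sub>R v)) has_real_derivative p (z + t *\<^sub>R u
        + c *\<^sub>R v)) (at t)"
      if "0 \<le> t" "t \<le> h" "0 \<le> c" "c \<le> h" for t c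
    proof -
      let ?y = "z + t *\<^sub>R u + c *\<^sub>R v"
      have 1: "(f has_derivative dir_deriv f ?y) (at ?y)" using has_derivative_dir_deriv f inS that by blast
      have "((\<lambda>t. f (z + t *\<^sub>R u + c *\<^sub>R v)) has_derivative (\<lambda>s. dir_deriv f ?y
          (s *\<^sub>R u))) (at t)"
        by (rule has_derivative_compose[where g = f and g' = "dir_deriv f ?y" and f = "\<lambda>t. z + t *\<^sub>R u
            + c *\<^sub>R v", OF _ 1]) (auto intro!: derivative_eq_intros)
      then show ?thesis
        using linear_scale[OF has_derivative_linear[OF 1]]
        by (simp add: has_field_derivative_def p_def mult.commute[of _ "dir_deriv f _ u"])
    qed
    have "\<exists>t>0. t < h \<and> \<phi> h - \<phi> 0 = (h - 0) * (p (z + t *\<^sub>R u + h *\<^sub>R v) - p (z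
        + t *\<^sub>R u + 0 *\<^sub>R v))"
      unfolding \<phi>_def using h by (intro MVT2 DERIV_diff der) auto
    then obtain t where t: "0 < t" "t < h"
      and eq: "\<phi> h - \<phi> 0 = h * (p (z + t *\<^sub>R u + h *\<^sub>R v) - p (z + t *\<^sub>R u + 0 *\<^sub>R v))" by auto
    have R: "\<bar>p (z + t *\<^sub>R u + c *\<^sub>R v) - p z - p' (t *\<^sub>R u + c *\<^sub>R v)\<bar> \<le> e' *
        (h * K)" if "0 \<le> c" "c \<le> h" for c
    proof -
      have "\<bar>p (z + t *\<^sub>R u + c *\<^sub>R v) - p z - p' (t *\<^sub>R u + c *\<^sub>R v)\<bar> \<le> e' * norm
          (t *\<^sub>R u + c *\<^sub>R v)"
        using d(2)[of "z + t *\<^sub>R u + c *\<^sub>R v"] small[of t c] hK t that by (simp add: add.assoc)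
      also have "\<dots> \<le> e' * (h * K)" using small[of t c] t that e' by (intro mult_left_mono) auto
      finally show ?thesis .
    qed
    have lin: "p' (t *\<^sub>R u + h *\<^sub>R v) - p' (t *\<^sub>R u + 0 *\<^sub>R v) = h * p' v"
      using linear_add[OF lp'] linear_scale[OF lp'] by simp
    have "\<bar>(p (z + t *\<^sub>R u + h *\<^sub>R v) - p (z + t *\<^sub>R u + 0 *\<^sub>R v)) - h * p' v\<bar> \<le> 2 *
        (e' * (h * K))"
      using R[of h] R[of 0] h lin by linarith
    also have "2 * (e' * (h * K)) = h * (e / 2)" using K by (simp add: e'_def)
    finally have "\<bar>(p (z + t *\<^sub>R u + h *\<^sub>R v) - p (z + t *\<^sub>R u + 0 *\<^sub>R v))
        - h * p' v\<bar> / h \<le> e / 2"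
      using h by (simp add: field_simps)
    moreover have "(f (z + h *\<^sub>R u + h *\<^sub>R v) - f (z + h *\<^sub>R u) - f (z + h *\<^sub>R v)
        + f z) / h\<^sup>2 - p' v
      = ((p (z + t *\<^sub>R u + h *\<^sub>R v) - p (z + t *\<^sub>R u + 0 *\<^sub>R v)) - h * p' v) / h"
    proof -
      have "f (z + h *\<^sub>R u + h *\<^sub>R v) - f (z + h *\<^sub>R u) - f (z + h *\<^sub>R v) + f z = \<phi> h - \<phi> 0"
        by (simp add: \<phi>_def)
      then show ?thesis unfolding eq using h by (simp add: power2_eq_square diff_divide_distrib)
    qed
    moreover have "dir_deriv (\<lambda>y. dir_deriv f y u) z v = p' v"
      by (simp add: p'_def p_def[abs_def])
    moreover have "\<bar>((p (z + t *\<^sub>R u + h *\<^sub>R v) - p (z + t *\<^sub>R u + 0 *\<^sub>R v)) - h * p' v) / h\<bar>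
      = \<bar>(p (z + t *\<^sub>R u + h *\<^sub>R v) - p (z + t *\<^sub>R u + 0 *\<^sub>R v)) - h * p' v\<bar> / h"
      using h by (simp add: abs_divide)
    ultimately have "\<bar>(f (z + h *\<^sub>R u + h *\<^sub>R v) - f (z + h *\<^sub>R u) - f (z + h *\<^sub>R v)
        + f z) / h\<^sup>2
      - dir_deriv (\<lambda>y. dir_deriv f y u) z v\<bar> \<le> e / 2" by (simp only:)
    then show "dist ((f (z + h *\<^sub>R u + h *\<^sub>R v) - f (z + h *\<^sub>R u) - f (z + h *\<^sub>R v) + f z) / h\<^sup>2)
     (dir_deriv (\<lambda>y. dir_deriv f y u) z v) < e"
      using e by (simp only: dist_real_def)
  qed
qed

text \<open>The second difference is symmetric in \<open>u\<close> and \<open>v\<close>, so both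
  mixed derivatives are limits of the same quotient.\<close>

lemma dir_deriv_commute_real:
  fixes f :: "'v::real_normed_vector \<Rightarrow> real"
  assumes S: "open S" "z \<in> S" and f: "\<And>y. y \<in> S \<Longrightarrow> f differentiable (at y)"
    and p: "\<And>w. (\<lambda>y. dir_deriv f y w) differentiable (at z)"
  shows "dir_deriv (\<lambda>y. dir_deriv f y u) z v = dir_deriv (\<lambda>y. dir_deriv f y v) z u"
proof (rule tendsto_unique)
  show "((\<lambda>h. (f (z + h *\<^sub>R u + h *\<^sub>R v) - f (z + h *\<^sub>R u) - f (z + h *\<^sub>R v) + f z) / h\<^sup>2)
    \<longlongrightarrow> dir_deriv (\<lambda>y. dir_deriv f y u) z v) (at_right 0)"
    by (rule second_difference_tendsto[OF S f p])
  show "((\<lambda>h. (f (z + h *\<^sub>R u + h *\<^sub>R v) - f (z + h *\<^sub>R u) - f (z + h *\<^sub>R v) + f z) / h\<^sup>2)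
    \<longlongrightarrow> dir_deriv (\<lambda>y. dir_deriv f y v) z u) (at_right 0)"
    using second_difference_tendsto[OF S f p, of v u] by (simp add: algebra_simps)
qed simp

text \<open>Two derivatives are what curvature and the symmetry of second derivatives involve.
  Asking for them pointwise keeps the closure rules under sums and linear maps short.\<close>

definition C2_on :: "'v::real_normed_vector set \<Rightarrow> ('v \<Rightarrow> 'w::real_normed_vector) \<Rightarrow> bool" where
  "C2_on S f \<longleftrightarrow> (\<forall>z\<in>S. f differentiable (at z)) \<and> (\<forall>v. \<forall>z\<in>S.
      (\<lambda>y. dir_deriv f y v) differentiable (at z))"

lemma smooth_on_imp_C2_on: "smooth_on S f \<Longrightarrow> C2_on S f"
  unfolding smooth_on_def C2_on_def
  by (drule spec[of _ "Suc (Suc 0)"]) auto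

lemma C2_onD:
  assumes "C2_on S f" "z \<in> S"
  shows "f differentiable (at z)" "(\<lambda>y. dir_deriv f y v) differentiable (at z)"
  using assms by (auto simp: C2_on_def)

lemma C2_on_const: "C2_on S (\<lambda>_. c)"
  by (simp add: C2_on_def)

lemma C2_on_add:
  assumes S: "open S" and f: "C2_on S f" and h: "C2_on S h"
  shows "C2_on S (\<lambda>y. f y + h y)"
proof -
  have "(\<lambda>y. dir_deriv (\<lambda>y. f y + h y) y v) differentiable (at z)" if "z \<in> S" for v z
  proof -
    have "dir_deriv (\<lambda>y. f y + h y) y v = dir_deriv f y v + dir_deriv h y v" if "y \<in> S" for y
      using that f h by (intro dir_deriv_add) (auto simp: C2_on_def)
    then show ?thesis using that f h
      by (subst differentiable_cong_open[OF S that]) (auto simp: C2_on_def)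
  qed
  then show ?thesis using f h by (auto simp: C2_on_def)
qed

lemma C2_on_bounded_linear:
  assumes S: "open S" and f: "C2_on S f" and T: "bounded_linear T"
  shows "C2_on S (\<lambda>y. T (f y))"
proof -
  have "(\<lambda>y. dir_deriv (\<lambda>y. T (f y)) y v) differentiable (at z)" if "z \<in> S" for v z
  proof -
    have "dir_deriv (\<lambda>y. T (f y)) y v = T (dir_deriv f y v)" if "y \<in> S" for y
      using that f by (intro dir_deriv_bounded_linear T) (auto simp: C2_on_def)
    then show ?thesis using that f
      by (subst differentiable_cong_open[OF S that]) (auto simp: C2_on_def intro: differentiable_bounded_linear[OF T])
  qed
  then show ?thesis using f by (auto simp: C2_on_def intro: differentiable_bounded_linear[OF T])
qed

lemma C2_on_sum:
  assumes "open S" "\<And>i. i \<in> I \<Longrightarrow> C2_on S (f i)"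
  shows "C2_on S (\<lambda>y. \<Sum>i\<in>I. f i y)"
  using assms(2)
  by (induction I rule: infinite_finite_induct) (auto intro: C2_on_const C2_on_add assms(1))

lemma dir_deriv_commute:
  fixes f :: "'v::real_normed_vector \<Rightarrow> 'w::euclidean_space"
  assumes S: "open S" "z \<in> S" and f: "C2_on S f"
  shows "dir_deriv (\<lambda>y. dir_deriv f y u) z v = dir_deriv (\<lambda>y. dir_deriv f y v) z u"
proof (rule euclidean_eqI)
  fix b :: 'w assume "b \<in> Basis"
  have T: "bounded_linear (\<lambda>x::'w. x \<bullet> b)" by (rule bounded_linear_inner_left)
  have C: "C2_on S (\<lambda>y. f y \<bullet> b)" by (rule C2_on_bounded_linear[OF S(1) f T])
  have eq: "dir_deriv (\<lambda>y. dir_deriv f y u) z v \<bullet> b = dir_deriv (\<lambda>y. dir_deriv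
      (\<lambda>y. f y \<bullet> b) y u) z v" for u v
  proof -
    have "dir_deriv (\<lambda>y. dir_deriv (\<lambda>y. f y \<bullet> b) y u) z v = dir_deriv
        (\<lambda>y. dir_deriv f y u \<bullet> b) z v"
      by (rule dir_deriv_cong_open[OF S dir_deriv_bounded_linear[OF T C2_onD(1)[OF f]]])
    also have "\<dots> = dir_deriv (\<lambda>y. dir_deriv f y u) z v \<bullet> b"
      by (rule dir_deriv_bounded_linear[OF T C2_onD(2)[OF f S(2)]])
    finally show ?thesis by simp
  qed
  show "dir_deriv (\<lambda>y. dir_deriv f y u) z v \<bullet> b = dir_deriv (\<lambda>y. dir_deriv f y v) z u \<bullet> b"
    unfolding eq by (rule dir_deriv_commute_real[OF S C2_onD(1)[OF C] C2_onD(2)[OF C S(2)]])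
qed

section \<open>Curvature in components and under a change of frame\<close>

lemma curv_eq:
  assumes "bilinear (A z)"
  shows "curv A z u v f = dir_deriv (\<lambda>y. A y v f) z u - dir_deriv (\<lambda>y. A y u f) z v
    + A z u (A z v f) - A z v (A z u f)"
  by (simp add: curv_def curvature_def cov_def[abs_def] lie_bracket_def bilinear_lzero[OF assms])

text \<open>The hypothesis \<open>rel\<close> says that \<open>A'\<close> is the transport of \<open>A\<close> along the bundle map \<open>E\<close>.\<close>

lemma curv_gauge:
  fixes A :: "'v::real_normed_vector \<Rightarrow> 'v \<Rightarrow> 'f::euclidean_space \<Rightarrow> 'f"
    and A' :: "'v \<Rightarrow> 'v \<Rightarrow> 'k::euclidean_space \<Rightarrow> 'k" and E ::
        "'v \<Rightarrow> 'f \<Rightarrow> 'k"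
  assumes S: "open S" "z \<in> S" and E: "\<And>y. y \<in> S \<Longrightarrow> linear (E y)" "\<And>w. C2_on S
      (\<lambda>y. E y w)"
    and A: "\<And>y. y \<in> S \<Longrightarrow> bilinear (A y)" "\<And>v w. (\<lambda>y. A y v w) differentiable (at z)"
    and A': "\<And>y. y \<in> S \<Longrightarrow> bilinear (A' y)" "\<And>v w. (\<lambda>y. A' y v w) differentiable (at z)"
    and rel: "\<And>y u w. y \<in> S \<Longrightarrow> A' y u (E y w) = E y (A y u w) - dir_deriv (\<lambda>y. E y w) y u"
  shows "curv A' z u v (E z w) = E z (curv A z u v w)"
proof -
  note Ed = C2_onD[OF E(2) S(2)]
  have linA': "linear (A' y v)" if "y \<in> S" for y v using A'(1)[OF that] by (simp add: bilinear_def)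
  \<comment> \<open>This is the derivative of \<open>rel\<close> along \<open>u\<close>, with
    \<open>E\<close> moved out of \<open>A'\<close>. The last three terms together are symmetric in
    \<open>u\<close> and \<open>v\<close>, since second derivatives of \<open>E\<close> commute, so
    they disappear when the curvature antisymmetrises.\<close>
  have key: "dir_deriv (\<lambda>y. A' y v (E z w)) z u + A' z u (A' z v (E z w)) =
     E z (dir_deriv (\<lambda>y. A y v w) z u) + E z (A z u (A z v w))
     - dir_deriv (\<lambda>y. dir_deriv (\<lambda>y. E y w) y v) z u
     - A' z v (dir_deriv (\<lambda>y. E y w) z u) - A' z u (dir_deriv (\<lambda>y. E y w) z v)" for u v
  proof -
    have "dir_deriv (\<lambda>y. A' y v (E z w)) z u + A' z v (dir_deriv (\<lambda>y. E y w) z u)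
      = dir_deriv (\<lambda>y. A' y v (E y w)) z u"
      by (rule linear_family_dir_deriv[OF S linA' A'(2) Ed(1), symmetric])
    also have "\<dots> = dir_deriv (\<lambda>y. E y (A y v w) - dir_deriv (\<lambda>y. E y w) y v) z u"
      by (rule dir_deriv_cong_open[OF S rel])
    also have "\<dots> = dir_deriv (\<lambda>y. E y (A y v w)) z u - dir_deriv (\<lambda>y. dir_deriv
        (\<lambda>y. E y w) y v) z u"
      by (intro dir_deriv_diff linear_family_differentiable[OF S E(1) Ed(1) A(2)] Ed)
    also have "dir_deriv (\<lambda>y. E y (A y v w)) z u = dir_deriv (\<lambda>y. E y (A z v w)) z u + E z (dir_deriv
        (\<lambda>y. A y v w) z u)"
      by (rule linear_family_dir_deriv[OF S E(1) Ed(1) A(2)])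
    also have "dir_deriv (\<lambda>y. E y (A z v w)) z u = E z (A z u (A z v w)) - A' z u (E z (A z v w))"
      using rel[OF S(2), of u "A z v w"] by simp
    also have "E z (A z v w) = A' z v (E z w) + dir_deriv (\<lambda>y. E y w) z v"
      using rel[OF S(2), of v w] by simp
    finally show ?thesis using bilinear_radd[OF A'(1)[OF S(2)]] by (simp add: algebra_simps)
  qed
  have comm: "dir_deriv (\<lambda>y. dir_deriv (\<lambda>y. E y w) y v) z u = dir_deriv (\<lambda>y. dir_deriv
      (\<lambda>y. E y w) y u) z v"
    by (rule dir_deriv_commute[OF S E(2)])
  note lin = linear_add[OF E(1)[OF S(2)]] linear_diff[OF E(1)[OF S(2)]]
  show ?thesis
    unfolding curv_eq[of A, OF A(1)[OF S(2)]] curv_eq[of A', OF A'(1)[OF S(2)]] lin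
    using arg_cong2[OF key[of v u] key[of u v], of "(-)"] comm by (simp add: algebra_simps)
qed

section \<open>Types of forms\<close>

lemma i_smult_i_smult [simp]: "\<i> *s (\<i> *s v) = - (v :: complex ^ 'n)"
  by (simp add: vec_eq_iff)

lemma cnj_vec_cnj_vec [simp]: "cnj_vec (cnj_vec v) = v"
  by (simp add: cnj_vec_def vec_eq_iff)

lemma cnj_vec_0 [simp]: "cnj_vec 0 = 0"
  by (simp add: cnj_vec_def vec_eq_iff)

lemma linear_i_smult: "linear (\<lambda>v::complex ^ 'n. \<i> *s v)"
  by (intro linearI) (simp_all add: vec_eq_iff algebra_simps)

lemma bounded_linear_i_smult: "bounded_linear (\<lambda>v::complex ^ 'n::finite. \<i> *s v)"
  using linear_i_smult by (simp add: linear_conv_bounded_linear)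

lemmas linear_simps = linear_add linear_diff linear_neg linear_0 linear_scale

text \<open>The hypothesis \<open>L 0 = 0\<close> is needed since \<open>clin\<close> evaluates both halves of every pair.\<close>

lemma clin_10: "L 0 = 0 \<Longrightarrow> clin L (v, 0) = (L v - \<i> * L (\<i> *s v)) / 2"
  by (simp add: clin_def)

lemma clin_01: "L 0 = 0 \<Longrightarrow> clin L (0, b) = (L (cnj_vec b) + \<i> * L (\<i> *s cnj_vec b)) / 2"
  by (simp add: clin_def)

lemma clin_zero [simp]: "clin (\<lambda>_. 0) w = 0"
  by (simp add: clin_def)

lemma clin_add: "clin (\<lambda>v. L v + K v) w = clin L w + clin K w"
  by (simp add: clin_def algebra_simps add_divide_distrib diff_divide_distrib)

lemma clin_mult: "clin (\<lambda>v. c * L v) w = c * clin L w"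
  by (simp add: clin_def field_simps)

lemma clin_sum: "clin (\<lambda>v. \<Sum>i\<in>I. L i v) w = (\<Sum>i\<in>I. clin (L i) w)"
  by (induction I rule: infinite_finite_induct) (simp_all add: clin_add)

lemma clin_swap: "clin (\<lambda>u. clin (\<lambda>v. L u v) w) w' = clin (\<lambda>v. clin (\<lambda>u. L u v) w') w"
  by (simp add: clin_def algebra_simps add_divide_distrib diff_divide_distrib)

text \<open>The maps \<open>x \<mapsto> clin L (x, 0)\<close> and
  \<open>x \<mapsto> clin L (0, cnj_vec x)\<close> are the complex-linear and the antilinear part of
  \<open>L\<close>. The four rules from here on say that taking these parts gives complementary
  projections; the type calculus rests on them.\<close>

lemma clin_10_10:
  assumes "linear L" shows "clin (\<lambda>x. clin L (x, 0)) (v, 0) = clin L (v, 0)"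
  using linear_0[OF assms] linear_neg[OF assms] by (simp add: clin_def field_simps)

lemma clin_01_10:
  assumes "linear L" shows "clin (\<lambda>x. clin L (0, cnj_vec x)) (v, 0) = 0"
  using linear_0[OF assms] linear_neg[OF assms] by (simp add: clin_def field_simps)

lemma clin_10_01:
  assumes "linear L" shows "clin (\<lambda>x. clin L (x, 0)) (0, b) = 0"
  using linear_0[OF assms] linear_neg[OF assms] by (simp add: clin_def field_simps)

lemma clin_01_01:
  assumes "linear L" shows "clin (\<lambda>x. clin L (0, cnj_vec x)) (0, b) = clin L (0, b)"
  using linear_0[OF assms] linear_neg[OF assms] by (simp add: clin_def field_simps)

lemma linear_clin_family:
  assumes "\<And>v. linear (\<lambda>x. L x v)" shows "linear (\<lambda>x. clin (L x) w :: complex)"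
proof (rule linearI)
  show "clin (L (x + y)) w = clin (L x) w + clin (L y) w" for x y
    by (simp add: clin_def linear_add[OF assms] algebra_simps add_divide_distrib diff_divide_distrib)
  show "clin (L (r *\<^sub>R x)) w = r *\<^sub>R clin (L x) w" for r x
    unfolding clin_def linear_scale[OF assms]
    by (simp add: scaleR_conv_of_real algebra_simps add_divide_distrib diff_divide_distrib)
qed

section \<open>Complex-multilinear extension and the projections onto types\<close>

lemma cext_cong:
  "(\<And>vs. length vs = length ws \<Longrightarrow> a vs = b vs) \<Longrightarrow> cext a ws = cext b ws"
proof (induction ws arbitrary: a b)
  case (Cons w ws)
  have "cext (\<lambda>vs. a (v # vs)) ws = cext (\<lambda>vs. b (v # vs)) ws" for v
    by (rule Cons.IH) (simp add: Cons.prems)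
  then show ?case by simp
qed simp

lemma cext_zero [simp]: "cext (\<lambda>_. 0) ws = 0"
  by (induction ws) simp_all

lemma cext_add: "cext (\<lambda>vs. a vs + b vs) ws = cext a ws + cext b ws"
  by (induction ws arbitrary: a b) (simp_all add: clin_add)

lemma cext_clin: "cext (\<lambda>vs. clin (\<lambda>x. a x vs) w) ws = clin (\<lambda>x. cext (a x) ws) w"
proof (induction ws arbitrary: a)
  case (Cons w' ws)
  show ?case by (simp add: Cons.IH) (rule clin_swap)
qed simp

lemma linear_cext_family:
  assumes "\<And>vs. length vs = length ws \<Longrightarrow> linear (\<lambda>x. a x vs)"
  shows "linear (\<lambda>x. cext (a x) ws)"
  using assms
proof (induction ws arbitrary: a)
  case (Cons w ws)
  have "linear (\<lambda>x. cext (\<lambda>vs. a x (v # vs)) ws)" for v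
    by (rule Cons.IH) (simp add: Cons.prems)
  from linear_clin_family[OF this] show ?case by simp
qed simp

text \<open>The recursion on the first argument has the same shape as \<open>cext\<close>, so that
  inductions over argument lists apply directly.\<close>

primrec multilinear :: "nat \<Rightarrow> 'n::finite form \<Rightarrow> bool" where
  "multilinear 0 a \<longleftrightarrow> True"
| "multilinear (Suc k) a \<longleftrightarrow> (\<forall>vs. length vs = k \<longrightarrow> linear (\<lambda>v. a
    (v # vs))) \<and> (\<forall>v. multilinear k (\<lambda>vs. a (v # vs)))"

lemma pq_part_Nil: "pq_part p q a [] = (if p = 0 \<and> q = 0 then a [] else 0)"
proof -
  have "{ts::bool list. length ts = length ([]::(complex^'a) list) \<and> count_list ts True = p \<and> count_list ts False = q}
    = (if p = 0 \<and> q = 0 then {[]} else {})" by auto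
  then show ?thesis by (simp only: pq_part_def) simp
qed

text \<open>Splitting the patterns by their first entry turns the sum into a recursion that
  simplification can run in low degree.\<close>

lemma pq_part_Cons:
  "pq_part p q a (v # vs) =
     (case p of 0 \<Rightarrow> 0 | Suc p' \<Rightarrow> clin (\<lambda>x. pq_part p' q (\<lambda>l. a (x # l)) vs) (v, 0))
   + (case q of 0 \<Rightarrow> 0 | Suc q' \<Rightarrow> clin (\<lambda>x. pq_part p q' (\<lambda>l. a (x # l)) vs)
       (0, cnj_vec v))"
proof -
  let ?P = "\<lambda>t v. if t then (v, 0) else (0, cnj_vec v)"
  define A where "A n p q = {ts::bool list. length ts = n \<and> count_list ts True = p \<and> count_list ts False = q}" for n p q
  have fin: "finite (A n p q)" for n p q
    by (rule finite_subset[OF _ finite_lists_length_eq[of "UNIV::bool set" n]]) (auto simp: A_def)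
  have A: "A (Suc n) p q = (case p of 0 \<Rightarrow> {} | Suc p' \<Rightarrow> Cons True ` A n p' q)
     \<union> (case q of 0 \<Rightarrow> {} | Suc q' \<Rightarrow> Cons False ` A n p q')" for n
  proof (intro set_eqI)
    fix ts :: "bool list"
    show "ts \<in> A (Suc n) p q \<longleftrightarrow> ts \<in>
        (case p of 0 \<Rightarrow> {} | Suc p' \<Rightarrow> Cons True ` A n p' q)
     \<union> (case q of 0 \<Rightarrow> {} | Suc q' \<Rightarrow> Cons False ` A n p q')"
      by (cases ts) (auto simp: A_def image_iff split: nat.splits)
  qed
  have pq: "pq_part p q a vs = (\<Sum>ts\<in>A (length vs) p q. cext a (map2 ?P ts vs))" for p q a vs
    by (simp add: pq_part_def A_def)
  have img: "(\<Sum>ts\<in>Cons t ` A n p q. cext a (map2 ?P ts (v # vs)))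
      = clin (\<lambda>x. \<Sum>ts\<in>A n p q. cext (\<lambda>l. a (x # l)) (map2 ?P ts vs)) (?P t v)" for t n p q
    by (subst sum.reindex) (auto simp: clin_sum)
  have "pq_part p q a (v # vs) =
    (\<Sum>ts\<in>(case p of 0 \<Rightarrow> {} | Suc p' \<Rightarrow> Cons True ` A (length vs) p' q). cext a (map2 ?P ts
        (v # vs)))
    + (\<Sum>ts\<in>(case q of 0 \<Rightarrow> {} | Suc q' \<Rightarrow> Cons False ` A (length vs) p q'). cext a
        (map2 ?P ts (v # vs)))"
    unfolding pq length_Cons A
    by (rule sum.union_disjoint) (auto split: nat.splits simp: fin)
  also have "\<dots> = (case p of 0 \<Rightarrow> 0 | Suc p' \<Rightarrow> clin (\<lambda>x. pq_part p' q (\<lambda>l. a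
      (x # l)) vs) (v, 0))
   + (case q of 0 \<Rightarrow> 0 | Suc q' \<Rightarrow> clin (\<lambda>x. pq_part p q' (\<lambda>l. a (x # l)) vs)
       (0, cnj_vec v))"
  proof -
    have "(\<Sum>ts\<in>(case p of 0 \<Rightarrow> {} | Suc p' \<Rightarrow> Cons True ` A (length vs) p' q). cext a
        (map2 ?P ts (v # vs)))
      = (case p of 0 \<Rightarrow> 0 | Suc p' \<Rightarrow> clin (\<lambda>x. pq_part p' q (\<lambda>l. a (x # l)) vs) (v, 0))"
      using img[of True] by (simp only: pq if_True split: nat.splits) simp
    moreover have "(\<Sum>ts\<in>(case q of 0 \<Rightarrow> {} | Suc q' \<Rightarrow> Cons False ` A
        (length vs) p q'). cext a (map2 ?P ts (v # vs)))
      = (case q of 0 \<Rightarrow> 0 | Suc q' \<Rightarrow> clin (\<lambda>x. pq_part p q' (\<lambda>l. a (x # l)) vs)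
          (0, cnj_vec v))"
      using img[of False] by (simp only: pq if_False split: nat.splits) simp
    ultimately show ?thesis by simp
  qed
  finally show ?thesis .
qed

lemma pq_part_cong:
  "(\<And>l. length l = length vs \<Longrightarrow> a l = b l) \<Longrightarrow> pq_part p q a vs = pq_part p q b vs"
  unfolding pq_part_def by (intro sum.cong refl cext_cong) auto

lemma pq_part_zero [simp]: "pq_part p q (\<lambda>_. 0) vs = 0"
  by (simp add: pq_part_def)

text \<open>On arguments of pure type the projection keeps or kills the whole value. In each step of
  the induction the complementary projections of \<open>clin\<close> discard the summand that
  assigns the wrong type to the first argument.\<close>

lemma cext_pq_part:
  assumes "multilinear (length ts) a" "length vs = length ts"
  shows "cext (pq_part p q a) (map2 (\<lambda>t v. if t then (v, 0) else (0, cnj_vec v)) ts vs) =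
    (if count_list ts True = p \<and> count_list ts False = q
     then cext a (map2 (\<lambda>t v. if t then (v, 0) else (0, cnj_vec v)) ts vs) else 0)"
  using assms
proof (induction ts arbitrary: p q a vs)
  case Nil
  then show ?case by (simp add: pq_part_Nil)
next
  case (Cons t ts)
  let ?P = "\<lambda>t v. if t then (v, 0) else (0, cnj_vec v)"
  obtain v vs' where vs: "vs = v # vs'" "length vs' = length ts" using Cons.prems(2) by (cases vs) auto
  define K where "K p q x = cext (pq_part p q (\<lambda>l. a (x # l))) (map2 ?P ts vs')" for p q x
  have m: "multilinear (length ts) (\<lambda>l. a (x # l))" for x using Cons.prems(1) by simp
  have l: "linear (\<lambda>x. a (x # l))" if "length l = length ts" for l using Cons.prems(1) that by simp
  have Keq: "K p q x = (if count_list ts True = p \<and> count_list ts False = q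
     then cext (\<lambda>l. a (x # l)) (map2 ?P ts vs') else 0)" for p q x
    unfolding K_def by (rule Cons.IH[OF m vs(2)])
  have lc: "linear (\<lambda>x. cext (\<lambda>l. a (x # l)) (map2 ?P ts vs'))"
    by (rule linear_cext_family) (simp add: l vs)
  have lK: "linear (K p q)" for p q
    unfolding Keq using lc by (cases "count_list ts True = p \<and> count_list ts False = q") (auto simp: linear_zero)
  have "cext (pq_part p q a) (map2 ?P (t # ts) vs)
    = clin (\<lambda>x. cext (\<lambda>l. pq_part p q a (x # l)) (map2 ?P ts vs')) (?P t v)"
    by (simp add: vs)
  also have "(\<lambda>x. cext (\<lambda>l. pq_part p q a (x # l)) (map2 ?P ts vs')) =
    (\<lambda>x. (case p of 0 \<Rightarrow> 0 | Suc p' \<Rightarrow> clin (K p' q) (x, 0))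
       + (case q of 0 \<Rightarrow> 0 | Suc q' \<Rightarrow> clin (K p q') (0, cnj_vec x)))"
    unfolding pq_part_Cons K_def by (cases p; cases q) (simp_all add: cext_add cext_clin)
  also have "clin \<dots> (?P t v) = (if t then (case p of 0 \<Rightarrow> 0 | Suc p' \<Rightarrow> clin (K p' q) (v, 0))
      else (case q of 0 \<Rightarrow> 0 | Suc q' \<Rightarrow> clin (K p q') (0, cnj_vec v)))"
    by (cases p; cases q; cases t)
      (simp_all add: clin_add clin_10_10[OF lK] clin_01_10[OF lK] clin_10_01[OF lK] clin_01_01[OF lK])
  also have "\<dots> = (if count_list (t # ts) True = p \<and> count_list (t # ts) False = q
     then cext a (map2 ?P (t # ts) vs) else 0)"
    unfolding Keq by (cases p; cases q; cases t) (auto simp: vs)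
  finally show ?case .
qed

lemma cext_pq_2_1:
  fixes \<alpha> :: "'n::finite form"
  assumes "multilinear 3 \<alpha>"
  shows "cext (pq_part 2 1 \<alpha>) [(p, 0), (0, cnj_vec u), (c, 0)] = cext \<alpha> [(p, 0), (0, cnj_vec u), (c, 0)]"
  using cext_pq_part[of "[True, False, True]" \<alpha> "[p, u, c]" 2 1] assms
  by (simp add: numeral_3_eq_3 numeral_2_eq_2)

lemma cext_pq_1_1:
  assumes "multilinear 2 a"
  shows "cext (pq_part 1 1 a) [(0, cnj_vec u), (c, 0)] = cext a [(0, cnj_vec u), (c, 0)]"
  using cext_pq_part[of "[False, True]" a "[u, c]" 1 1] assms
  by (simp add: numeral_2_eq_2)

text \<open>In the second and fourth rule the last argument is an arbitrary complexified vector,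
  because \<open>metric_inv\<close> is characterised by testing against all of them; its component
  of the wrong type does not contribute. The other two rules feed \<open>comp10\<close>, which tests
  against (1,0)-vectors.\<close>

lemma cext_pair:
  fixes \<alpha> :: "'n::finite form"
  assumes "multilinear 2 \<alpha>"
  shows "cext (pq_part 2 0 \<alpha>) [(p, 0), (p', 0)] = cext \<alpha> [(p, 0), (p', 0)]"
    and "cext (pq_part 1 1 \<alpha>) [(p, 0), (p', cnj_vec q')] = cext \<alpha> [(p, 0), (0, cnj_vec q')]"
    and "cext (pq_part 1 1 \<alpha>) [(0, cnj_vec q), (p', 0)] = cext \<alpha> [(0, cnj_vec q), (p', 0)]"
    and "cext (pq_part 0 2 \<alpha>) [(0, cnj_vec q), (p', cnj_vec q')] = cext \<alpha> [(0, cnj_vec q), (0, cnj_vec q')]"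
proof -
  have l1: "linear (\<lambda>u. \<alpha> [u, v])" and l2: "linear (\<lambda>v. \<alpha> [u, v])" for u v
    using assms by (auto simp: numeral_2_eq_2 length_Suc_conv)
  note zero = linear_0[OF l1] linear_0[OF l2]
  have T: "cext (pq_part a b \<alpha>) (map2 (\<lambda>t v. if t then (v, 0) else (0, cnj_vec v)) ts [x, y])
      = (if count_list ts True = a \<and> count_list ts False = b
        then cext \<alpha> (map2 (\<lambda>t v. if t then (v, 0) else (0, cnj_vec v)) ts [x, y]) else 0)"
    if "length ts = 2" for ts x y a b
    by (rule cext_pq_part) (use assms that in simp_all)
  have 11: "cext (pq_part 1 1 \<alpha>) [(p, 0), (p', 0)] = 0" for p p'
    using T[of "[True, True]" 1 1 p p'] by simp
  have 02: "cext (pq_part 0 2 \<alpha>) [(0, cnj_vec q), (p', 0)] = 0" for q p'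
    using T[of "[False, True]" 0 2 q p'] by simp
  have split: "cext \<gamma> [w, (p', q')] = cext \<gamma> [w, (p', 0)] + cext \<gamma> [w, (0, q')]"
    if "\<And>u. \<gamma> [u, 0] = 0" for \<gamma> :: "'n form" and w p' q'
    by (simp add: that clin_def field_simps)
  have z11: "pq_part 1 1 \<alpha> [u, 0] = 0" and z02: "pq_part 0 2 \<alpha> [u, 0] = 0" for u
    by (simp_all add: numeral_2_eq_2 pq_part_Cons pq_part_Nil clin_def zero)
  show "cext (pq_part 2 0 \<alpha>) [(p, 0), (p', 0)] = cext \<alpha> [(p, 0), (p', 0)]"
    using T[of "[True, True]" 2 0 p p'] by simp
  show "cext (pq_part 1 1 \<alpha>) [(0, cnj_vec q), (p', 0)] = cext \<alpha> [(0, cnj_vec q), (p', 0)]"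
    using T[of "[False, True]" 1 1 q p'] by simp
  show "cext (pq_part 1 1 \<alpha>) [(p, 0), (p', cnj_vec q')] = cext \<alpha> [(p, 0), (0, cnj_vec q')]"
    using T[of "[True, False]" 1 1 p q'] split[of "pq_part 1 1 \<alpha>", OF z11, of "(p, 0)" p' "cnj_vec q'"] 11 by simp
  show "cext (pq_part 0 2 \<alpha>) [(0, cnj_vec q), (p', cnj_vec q')] = cext \<alpha> [(0, cnj_vec q), (0, cnj_vec q')]"
    using T[of "[False, False]" 0 2 q q'] split[of "pq_part 0 2 \<alpha>", OF z02, of "(0, cnj_vec q)" p' "cnj_vec q'"] 02 by simp
qed

text \<open>The outer projection evaluates the inner one on arguments of pure type only, where
  \<open>cext_pq_part\<close> decides it.\<close>

lemma pq_part_pq_part: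
  assumes "multilinear (length vs) a"
  shows "pq_part p q (pq_part p' q' a) vs = (if p = p' \<and> q = q' then pq_part p q a vs else 0)"
proof -
  let ?m = "\<lambda>ts. map2 (\<lambda>t v. if t then (v, 0) else (0, cnj_vec v)) ts vs"
  let ?A = "{ts. length ts = length vs \<and> count_list ts True = p \<and> count_list ts False = q}"
  have eq: "cext (pq_part p' q' a) (?m ts) = (if p = p' \<and> q = q' then cext a (?m ts) else 0)" if "ts \<in> ?A" for ts
  proof -
    have "cext (pq_part p' q' a) (?m ts)
      = (if count_list ts True = p' \<and> count_list ts False = q' then cext a (?m ts) else 0)"
      by (rule cext_pq_part) (use that assms in simp_all)
    also have "(count_list ts True = p' \<and> count_list ts False = q') = (p = p' \<and> q = q')"
      using that by simp
    finally show ?thesis .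
  qed
  have "pq_part p q (pq_part p' q' a) vs = (\<Sum>ts\<in>?A. if p = p' \<and> q = q' then cext a (?m ts) else 0)"
    unfolding pq_part_def[of p q "pq_part p' q' a"] by (rule sum.cong[OF refl eq])
  also have "\<dots> = (if p = p' \<and> q = q' then pq_part p q a vs else 0)"
  proof (cases "p = p' \<and> q = q'")
    case True
    show ?thesis by (simp only: if_P[OF True] pq_part_def)
  qed (simp only: if_False sum.neutral_const)
  finally show ?thesis .
qed

section \<open>Exterior derivative, \<open>del\<close> and \<open>delbar\<close> on forms of pure
  type\<close>

lemma ext_d_cong:
  assumes "open S" "z \<in> S" "\<And>y l. y \<in> S \<Longrightarrow> Suc (length l) = length vs
      \<Longrightarrow> \<alpha> y l = \<beta> y l"
  shows "ext_d \<alpha> z vs = ext_d \<beta> z vs"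
  unfolding ext_d_def
proof (intro sum.cong refl)
  fix i assume "i \<in> {..<length vs}"
  then have "dir_deriv (\<lambda>y. \<alpha> y (take i vs @ drop (Suc i) vs)) z (vs ! i)
      = dir_deriv (\<lambda>y. \<beta> y (take i vs @ drop (Suc i) vs)) z (vs ! i)"
    by (intro dir_deriv_cong_open[OF assms(1,2)] assms(3)) auto
  then show "(- 1) ^ i * dir_deriv (\<lambda>y. \<alpha> y (take i vs @ drop (Suc i) vs)) z (vs ! i)
    = (- 1) ^ i * dir_deriv (\<lambda>y. \<beta> y (take i vs @ drop (Suc i) vs)) z (vs ! i)" by simp
qed

lemma ext_d_zero [simp]: "ext_d (\<lambda>_ _. 0) z vs = 0"
  by (simp add: ext_d_def)

text \<open>By orthogonality of the type projections only the summand with \<open>p' = p\<close> is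
  left. Purity is assumed on an open set because \<open>ext_d\<close> differentiates the projected
  form.\<close>

lemma
  assumes S: "open S" "z \<in> S" and m: "\<And>y. y \<in> S \<Longrightarrow> multilinear (p + q) (\<alpha> y)"
    and pq: "\<And>y l. y \<in> S \<Longrightarrow> length l = p + q \<Longrightarrow> pq_part p q (\<alpha> y) l = \<alpha> y l"
    and vs: "length vs = Suc (p + q)"
  shows del_pure: "del \<alpha> z vs = pq_part (Suc p) q (ext_d \<alpha> z) vs"
    and delbar_pure: "delbar \<alpha> z vs = pq_part p (Suc q) (ext_d \<alpha> z) vs"
proof -
  have proj: "pq_part p' (p + q - p') (\<alpha> y) l = (if p' = p then \<alpha> y l else 0)"
    if "y \<in> S" "length l = p + q" "p' \<le> p + q" for y l p'
  proof -
    have "pq_part p' (p + q - p') (\<alpha> y) l = pq_part p' (p + q - p') (pq_part p q (\<alpha> y)) l"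
      by (rule pq_part_cong) (simp add: pq that)
    then show ?thesis using pq_part_pq_part[of l "\<alpha> y" p' "p + q - p'" p q] m[OF that(1)] pq that by auto
  qed
  have ext: "ext_d (\<lambda>y. pq_part p' (p + q - p') (\<alpha> y)) z l = (if p' = p then ext_d \<alpha> z l else 0)"
    if "length l = Suc (p + q)" "p' \<le> p + q" for l p'
  proof -
    have "ext_d (\<lambda>y. pq_part p' (p + q - p') (\<alpha> y)) z l = ext_d (\<lambda>y l. if p'
        = p then \<alpha> y l else 0) z l"
      using that by (intro ext_d_cong[OF S]) (simp add: proj)
    then show ?thesis by (cases "p' = p") simp_all
  qed
  have "del \<alpha> z vs = (\<Sum>p'\<le>p + q. if p' = p then pq_part (Suc p) q (ext_d \<alpha> z) vs else 0)"
    unfolding del_def Let_def vs diff_Suc_1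
  proof (intro sum.cong refl)
    fix p' assume "p' \<in> {..p + q}"
    then have "pq_part (p' + 1) (p + q - p') (ext_d (\<lambda>y. pq_part p' (p + q - p') (\<alpha> y)) z) vs
      = pq_part (p' + 1) (p + q - p') (\<lambda>l. if p' = p then ext_d \<alpha> z l else 0) vs"
      by (intro pq_part_cong) (simp add: ext vs)
    then show "pq_part (p' + 1) (p + q - p') (ext_d (\<lambda>y. pq_part p' (p + q - p') (\<alpha> y)) z) vs
      = (if p' = p then pq_part (Suc p) q (ext_d \<alpha> z) vs else 0)" by (cases "p' = p") simp_all
  qed
  then show "del \<alpha> z vs = pq_part (Suc p) q (ext_d \<alpha> z) vs" by simp
  have "delbar \<alpha> z vs = (\<Sum>p'\<le>p + q. if p' = p then pq_part p (Suc q) (ext_d \<alpha> z) vs else 0)"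
    unfolding delbar_def Let_def vs diff_Suc_1
  proof (intro sum.cong refl)
    fix p' assume "p' \<in> {..p + q}"
    then have "pq_part p' (p + q - p' + 1) (ext_d (\<lambda>y. pq_part p' (p + q - p') (\<alpha> y)) z) vs
      = pq_part p' (p + q - p' + 1) (\<lambda>l. if p' = p then ext_d \<alpha> z l else 0) vs"
      by (intro pq_part_cong) (simp add: ext vs)
    then show "pq_part p' (p + q - p' + 1) (ext_d (\<lambda>y. pq_part p' (p + q - p') (\<alpha> y)) z) vs
      = (if p' = p then pq_part p (Suc q) (ext_d \<alpha> z) vs else 0)" by (cases "p' = p") simp_all
  qed
  then show "delbar \<alpha> z vs = pq_part p (Suc q) (ext_d \<alpha> z) vs" by simp
qed

lemmas i_smult_simps = linear_simps[OF linear_i_smult]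

section \<open>The Levi-Civita and Bismut connections\<close>

lemma multilinear_2I:
  assumes "\<And>v. linear (\<lambda>u. a [u, v])" "\<And>u. linear (\<lambda>v. a [u, v])"
  shows "multilinear 2 a"
  using assms by (auto simp: numeral_2_eq_2 length_Suc_conv)

lemma multilinear_3I:
  assumes "\<And>v x. linear (\<lambda>u. a [u, v, x])" "\<And>u x. linear (\<lambda>v. a [u, v, x])" "\<And>u v. linear
      (\<lambda>x. a [u, v, x])"
  shows "multilinear 3 a"
  using assms by (auto simp: numeral_3_eq_3 length_Suc_conv)

lemma all_length_2: "(\<And>u v. P [u, v]) \<Longrightarrow> length l = 2 \<Longrightarrow> P l"
  by (auto simp: numeral_2_eq_2 length_Suc_conv)

lemma pq_part_1_1_pair:
  assumes "\<And>v. a [0, v] = 0" "\<And>u. a [u, 0] = 0"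
  shows "pq_part 1 1 a [u, v] = (a [u, v] + a [\<i> *s u, \<i> *s v]) / 2"
  by (simp add: pq_part_Cons pq_part_Nil clin_def assms field_simps)

text \<open>Each of the three patterns contributes a product of factors (1 - iJ)/2 and (1 + iJ)/2.
  All three agree on the terms with no J or three J's, whence the coefficient 3; in the terms with
  one or two J's the signs partly cancel and leave 1. The (1,2)- and (2,2)-expansions arise in the
  same way.\<close>

lemma pq_part_2_1_triple:
  assumes "\<And>v x. a [0, v, x] = 0" "\<And>u x. a [u, 0, x] = 0" "\<And>u v. a [u, v, 0] = 0"
  shows "pq_part 2 1 a [u, v, x] =
    (3 * a [u, v, x] + a [\<i> *s u, \<i> *s v, x] + a [\<i> *s u, v, \<i> *s x] + a [u, \<i> *s v, \<i> *s x]
     - \<i> * (a [\<i> *s u, v, x] + a [u, \<i> *s v, x] + a [u, v, \<i> *s x]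
     + 3 * a [\<i> *s u, \<i> *s v, \<i> *s x])) / 8"
  by (simp add: numeral_2_eq_2 pq_part_Cons pq_part_Nil clin_def assms field_simps)

lemma pq_part_1_2_triple:
  assumes "\<And>v x. a [0, v, x] = 0" "\<And>u x. a [u, 0, x] = 0" "\<And>u v. a [u, v, 0] = 0"
  shows "pq_part 1 2 a [u, v, x] =
    (3 * a [u, v, x] + a [\<i> *s u, \<i> *s v, x] + a [\<i> *s u, v, \<i> *s x] + a [u, \<i> *s v, \<i> *s x]
     + \<i> * (a [\<i> *s u, v, x] + a [u, \<i> *s v, x] + a [u, v, \<i> *s x]
     + 3 * a [\<i> *s u, \<i> *s v, \<i> *s x])) / 8"
  by (simp add: numeral_2_eq_2 pq_part_Cons pq_part_Nil clin_def assms field_simps)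

lemma ext_d_3:
  "ext_d \<alpha> z [u, v, x] = dir_deriv (\<lambda>y. \<alpha> y [v, x]) z u - dir_deriv (\<lambda>y. \<alpha> y [u, x]) z v
     + dir_deriv (\<lambda>y. \<alpha> y [u, v]) z x"
  by (simp add: ext_d_def numeral_3_eq_3)

lemma ext_d_4:
  "ext_d \<alpha> z [u, v, x, t] = dir_deriv (\<lambda>y. \<alpha> y [v, x, t]) z u - dir_deriv
      (\<lambda>y. \<alpha> y [u, x, t]) z v
     + dir_deriv (\<lambda>y. \<alpha> y [u, v, t]) z x - dir_deriv (\<lambda>y. \<alpha> y [u, v, x]) z t"
  by (simp add: ext_d_def)

lemma linear_dir_deriv_family:
  assumes S: "open S" "z \<in> S" and lin: "\<And>y. y \<in> S \<Longrightarrow> linear (B y)"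
    and B: "\<And>f. (\<lambda>y. B y f) differentiable (at z)"
  shows "linear (\<lambda>f. dir_deriv (\<lambda>y. B y f) z w)"
proof (rule linearI)
  fix f h :: 'b and r :: real
  have "dir_deriv (\<lambda>y. B y (f + h)) z w = dir_deriv (\<lambda>y. B y f + B y h) z w"
    by (rule dir_deriv_cong_open[OF S]) (simp add: linear_add[OF lin])
  then show "dir_deriv (\<lambda>y. B y (f + h)) z w = dir_deriv (\<lambda>y. B y f) z w + dir_deriv (\<lambda>y. B y h) z w"
    by (simp add: dir_deriv_add B)
  have "dir_deriv (\<lambda>y. B y (r *\<^sub>R f)) z w = dir_deriv (\<lambda>y. r *\<^sub>R B y f) z w"
    by (rule dir_deriv_cong_open[OF S]) (simp add: linear_scale[OF lin])
  then show "dir_deriv (\<lambda>y. B y (r *\<^sub>R f)) z w = r *\<^sub>R dir_deriv (\<lambda>y. B y f) z w"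
    by (simp add: dir_deriv_bounded_linear[OF bounded_linear_scaleR_right B])
qed

lemma linear_of_real: "linear f \<Longrightarrow> linear (\<lambda>x. complex_of_real (f x))"
  by (intro linearI) (simp_all add: linear_simps scaleR_conv_of_real)

lemma has_derivative_of_real': "(f has_derivative f') F \<Longrightarrow> ((\<lambda>x. complex_of_real (f x))
    has_derivative (\<lambda>h. complex_of_real (f' h))) F"
  by (rule bounded_linear.has_derivative[OF bounded_linear_of_real])

lemma dir_deriv_of_real: "f differentiable (at z) \<Longrightarrow> dir_deriv (\<lambda>y. complex_of_real (f y)) z w
    = complex_of_real (dir_deriv f z w)"
  by (rule dir_deriv_bounded_linear[OF bounded_linear_of_real])

lemma bounded_linear_mult_of_real: "bounded_linear (\<lambda>x. c * complex_of_real x)"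
  by (rule bounded_linear_compose[OF bounded_linear_mult_right bounded_linear_of_real])

section \<open>A Hermitian metric in one chart: derivatives and connection forms\<close>

locale hermitian_chart =
  fixes S :: "(complex ^ 'n::finite) set" and g :: "'n metric"
  assumes S: "open S" and smooth: "\<And>u v. smooth_on S (\<lambda>z. g z u v)"
    and bil: "\<And>z. z \<in> S \<Longrightarrow> bilinear (g z)"
    and sym: "\<And>z u v. z \<in> S \<Longrightarrow> g z u v = g z v u"
    and pos: "\<And>z u. z \<in> S \<Longrightarrow> u \<noteq> 0 \<Longrightarrow> g z u u > 0"
    and J_inv: "\<And>z u v. z \<in> S \<Longrightarrow> g z (\<i> *s u) (\<i> *s v) = g z u v"
begin

definition "g1 z w u v = dir_deriv (\<lambda>y. g y u v) z w"
definition "g2 z w' w u v = dir_deriv (\<lambda>y. g1 y w u v) z w'"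

lemma C2: "C2_on S (\<lambda>y. g y u v)"
  by (rule smooth_on_imp_C2_on[OF smooth])

lemma g_diff: "z \<in> S \<Longrightarrow> (\<lambda>y. g y u v) differentiable (at z)"
  by (rule C2_onD(1)[OF C2])

lemma g1_diff: "z \<in> S \<Longrightarrow> (\<lambda>y. g1 y w u v) differentiable (at z)"
  unfolding g1_def by (rule C2_onD(2)[OF C2])

lemma g_linear:
  assumes "z \<in> S" shows "linear (\<lambda>u. g z u v)" "linear (\<lambda>v. g z u v)"
  using bil[OF assms] by (auto simp: bilinear_def)

lemma g1_linear:
  assumes z: "z \<in> S"
  shows "linear (\<lambda>w. g1 z w u v)" "linear (\<lambda>u. g1 z w u v)" "linear (\<lambda>v. g1 z w u v)"
  unfolding g1_def
  by (rule linear_dir_deriv[OF g_diff[OF z]])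
    (rule linear_dir_deriv_family[OF S z] g_linear g_diff z | assumption)+

lemma g2_linear:
  assumes z: "z \<in> S"
  shows "linear (\<lambda>x. g2 z x w u v)" "linear (\<lambda>w. g2 z x w u v)" "linear (\<lambda>u. g2 z x w u v)" "linear
      (\<lambda>v. g2 z x w u v)"
  unfolding g2_def
  by (rule linear_dir_deriv[OF g1_diff[OF z]])
    (rule linear_dir_deriv_family[OF S z] g1_linear g1_diff z | assumption)+

lemmas g_simps = linear_simps[OF g_linear(1)] linear_simps[OF g_linear(2)]
lemmas g1_simps = linear_simps[OF g1_linear(1)] linear_simps[OF g1_linear(2)] linear_simps[OF g1_linear(3)]
lemmas g2_simps = linear_simps[OF g2_linear(1)] linear_simps[OF g2_linear(2)]
  linear_simps[OF g2_linear(3)] linear_simps[OF g2_linear(4)]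

lemma g1_sym: "z \<in> S \<Longrightarrow> g1 z w u v = g1 z w v u"
  unfolding g1_def by (rule dir_deriv_cong_open[OF S _ sym])

lemma g2_sym: "z \<in> S \<Longrightarrow> g2 z x w u v = g2 z x w v u"
  unfolding g2_def by (rule dir_deriv_cong_open[OF S _ g1_sym])

lemma g1_J_J: "z \<in> S \<Longrightarrow> g1 z w (\<i> *s u) (\<i> *s v) = g1 z w u v"
  unfolding g1_def by (rule dir_deriv_cong_open[OF S _ J_inv])

lemma g2_J_J: "z \<in> S \<Longrightarrow> g2 z x w (\<i> *s u) (\<i> *s v) = g2 z x w u v"
  unfolding g2_def by (rule dir_deriv_cong_open[OF S _ g1_J_J])

lemma g_J: "z \<in> S \<Longrightarrow> g z u (\<i> *s v) = - g z (\<i> *s u) v"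
  using J_inv[of z u "\<i> *s v"] J_inv[of z "\<i> *s u" v] by (simp add: g_simps)

lemma g1_J: "z \<in> S \<Longrightarrow> g1 z w u (\<i> *s v) = - g1 z w (\<i> *s u) v"
  using g1_J_J[of z w "\<i> *s u" v] by (simp add: g1_simps)

lemma g2_J: "z \<in> S \<Longrightarrow> g2 z x w u (\<i> *s v) = - g2 z x w (\<i> *s u) v"
  using g2_J_J[of z x w "\<i> *s u" v] by (simp add: g2_simps)

lemma g2_comm: "z \<in> S \<Longrightarrow> g2 z x w u v = g2 z w x u v"
  unfolding g2_def g1_def by (rule dir_deriv_commute[OF S _ C2])

text \<open>\<open>H\<close> is \<open>d\<^sup>c\<omega>\<close>, written as \<open>- d\<omega>(J, J, J)\<close>, and \<open>T\<close> is \<open>d\<omega>\<close>.\<close>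

definition "H z u v x = g1 z (\<i> *s u) v (\<i> *s x) - g1 z (\<i> *s v) u (\<i> *s x) + g1 z (\<i> *s x) u (\<i> *s v)"
definition "H1 z w u v x = g2 z w (\<i> *s u) v (\<i> *s x) - g2 z w (\<i> *s v) u (\<i> *s x) + g2 z w (\<i> *s x) u (\<i> *s v)"
definition "T z u v x = g1 z u (\<i> *s v) x - g1 z v (\<i> *s u) x + g1 z x (\<i> *s u) v"

lemma H_has_derivative: "z \<in> S \<Longrightarrow> ((\<lambda>y. H y u v x) has_derivative (\<lambda>w. H1 z w u v x)) (at z)"
  unfolding H_def H1_def g2_def
  by (intro has_derivative_add has_derivative_diff has_derivative_dir_deriv g1_diff)

lemma H_linear:
  assumes z: "z \<in> S"
  shows "linear (\<lambda>u. H z u v x)" "linear (\<lambda>v. H z u v x)" "linear (\<lambda>x. H z u v x)"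
  unfolding H_def
  by (rule linearI; simp add: z g1_simps i_smult_simps algebra_simps)+

text \<open>The lowered connection form of the metric connection with torsion \<open>e H\<close>: Bismut
  for \<open>e = -1\<close>, Levi-Civita for \<open>e = 0\<close>. The value \<open>e = 1\<close> yields the Chern connection of \<open>G\<close>.\<close>

definition "\<Gamma> e z u v x = 1 / 2 * (g1 z u v x + g1 z v u x - g1 z x u v + e * H z u v x)"
definition "\<Gamma>1 e z w u v x = 1 / 2 * (g2 z w u v x + g2 z w v u x - g2 z w x u v + e * H1 z w u v x)"

lemma \<Gamma>_has_derivative: "z \<in> S \<Longrightarrow> ((\<lambda>y. \<Gamma> e y u v x) has_derivative
    (\<lambda>w. \<Gamma>1 e z w u v x)) (at z)"
  unfolding \<Gamma>_def \<Gamma>1_def g2_def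
  by (rule has_derivative_add has_derivative_diff has_derivative_dir_deriv
      has_derivative_mult_right H_has_derivative g1_diff | assumption)+

lemma \<Gamma>_linear:
  assumes z: "z \<in> S"
  shows "linear (\<lambda>u. \<Gamma> e z u v x)" "linear (\<lambda>v. \<Gamma> e z u v x)" "linear
      (\<lambda>x. \<Gamma> e z u v x)"
  unfolding \<Gamma>_def
  by (rule linearI; simp add: z g1_simps linear_simps[OF H_linear(1)] linear_simps[OF H_linear(2)]
      linear_simps[OF H_linear(3)] field_simps)+

lemma H_alternating:
  assumes "z \<in> S"
  shows "H z v u x = - H z u v x" "H z u x v = - H z u v x"
  using assms g1_sym[of z] g1_J[of z] unfolding H_def by (smt (verit))+

lemma \<Gamma>_torsion: "z \<in> S \<Longrightarrow> \<Gamma> e z u v x = \<Gamma> (- e) z v u x"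
  using H_alternating(1)[of z u v x] g1_sym[of z x u v] by (simp add: \<Gamma>_def)

lemma \<Gamma>_metric: "z \<in> S \<Longrightarrow> \<Gamma> e z w u v + \<Gamma> e z w v u = g1 z w u v"
  using H_alternating(2)[of z w u v] g1_sym[of z w u v] g1_sym[of z u w v] g1_sym[of z v w u]
  by (simp add: \<Gamma>_def field_simps)

text \<open>For torsion sign \<open>e = 1\<close> the connection form in holomorphic coordinates is
  complex linear in the direction. This makes its (0,1)-part annihilate the (1,0)-component, as a
  Dolbeault operator in a holomorphic frame must. With the arguments swapped by
  \<open>\<Gamma>_torsion\<close> it says that the Bismut connection preserves J.\<close>

lemma \<Gamma>_J: "z \<in> S \<Longrightarrow> \<Gamma> 1 z (\<i> *s u) v x = - \<Gamma> 1 z u v (\<i> *s x)"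
  by (simp add: \<Gamma>_def H_def g1_J i_smult_simps g1_simps field_simps)

section \<open>Raising indices; the metric connections with torsion\<close>

lemma nondegenerate:
  assumes z: "z \<in> S" and eq: "\<And>x. g z w x = g z w' x"
  shows "w = w'"
proof -
  have "g z (w - w') (w - w') = 0" using eq by (simp add: z g_simps)
  then show ?thesis using pos[OF z, of "w - w'"] by auto
qed

text \<open>The Euclidean inner product turns \<open>g z w\<close> into a vector. The metric thereby
  becomes a family of endomorphisms, to which dimension counting and the lemma on inverse families
  apply.\<close>

definition lower :: "complex ^ 'n \<Rightarrow> complex ^ 'n \<Rightarrow> complex ^ 'n" where
  "lower z w = (\<Sum>b\<in>Basis. g z w b *\<^sub>R b)"

lemma lower_inner: "z \<in> S \<Longrightarrow> lower z w \<bullet> x = g z w x"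
proof -
  assume z: "z \<in> S"
  have "g z w x = g z w (\<Sum>b\<in>Basis. (x \<bullet> b) *\<^sub>R b)" by (simp add: euclidean_representation)
  also have "\<dots> = (\<Sum>b\<in>Basis. (x \<bullet> b) * g z w b)"
    by (simp only: linear_sum[OF g_linear(2)[OF z]] linear_scale[OF g_linear(2)[OF z]] real_scaleR_def)
  finally show ?thesis
    unfolding lower_def inner_sum_left inner_scaleR_left by (simp only: inner_commute[of x] mult.commute)
qed

lemma linear_lower: "z \<in> S \<Longrightarrow> linear (lower z)"
  unfolding lower_def
  by (intro linearI) (simp_all add: g_simps scaleR_add_left sum.distrib scaleR_sum_right)

lemma inj_lower: "z \<in> S \<Longrightarrow> inj (lower z)"
  by (rule injI, rule nondegenerate, assumption) (metis lower_inner)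

lemma lower_diff: "z \<in> S \<Longrightarrow> (\<lambda>y. lower y w) differentiable (at z)"
  unfolding lower_def by (intro differentiable_sum ballI finite_Basis differentiable_scaleR g_diff differentiable_const)

text \<open>The same description as in \<open>bismut\<close>, so that the two can be matched by
  unfolding.\<close>

definition raise :: "complex ^ 'n \<Rightarrow> (complex ^ 'n \<Rightarrow> real) \<Rightarrow> complex ^ 'n" where
  "raise z l = (THE w. \<forall>x. g z w x = l x)"

lemma raise_eqI: "z \<in> S \<Longrightarrow> (\<And>x. g z w x = l x) \<Longrightarrow> raise z l = w"
  unfolding raise_def by (rule the_equality) (auto intro!: nondegenerate)

lemma g_raise:
  assumes z: "z \<in> S" and l: "linear l"
  shows "g z (raise z l) x = l x"
proof -
  obtain w where w: "lower z w = (\<Sum>b\<in>Basis. l b *\<^sub>R b)"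
    using linear_injective_imp_surjective[OF linear_lower[OF z] inj_lower[OF z]] by (metis surjD)
  have lw: "g z w x = l x" for x
  proof -
    have "l x = l (\<Sum>b\<in>Basis. (x \<bullet> b) *\<^sub>R b)" by (simp add: euclidean_representation)
    also have "\<dots> = (\<Sum>b\<in>Basis. (x \<bullet> b) *\<^sub>R l b)"
      by (simp only: linear_sum[OF l] linear_scale[OF l])
    also have "\<dots> = (\<Sum>b\<in>Basis. l b *\<^sub>R b) \<bullet> x"
      unfolding inner_sum_left inner_scaleR_left by (simp only: real_scaleR_def inner_commute[of x] mult.commute)
    finally show ?thesis using lower_inner[OF z, of w x] unfolding w by simp
  qed
  then show ?thesis using raise_eqI[OF z lw] by simp
qed

definition "conn e z u v = raise z (\<Gamma> e z u v)"

lemma g_conn: "z \<in> S \<Longrightarrow> g z (conn e z u v) x = \<Gamma> e z u v x"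
  unfolding conn_def by (rule g_raise[OF _ \<Gamma>_linear(3)])

lemma conn_eqI: "z \<in> S \<Longrightarrow> (\<And>x. g z w x = \<Gamma> e z u v x) \<Longrightarrow> conn e z u v = w"
  unfolding conn_def by (rule raise_eqI)

lemma bilinear_conn:
  assumes z: "z \<in> S" shows "bilinear (conn e z)"
  unfolding bilinear_def
  by (intro conjI allI linearI; rule conn_eqI[OF z];
      simp add: z g_simps g_conn linear_simps[OF \<Gamma>_linear(1)] linear_simps[OF \<Gamma>_linear(2)])

lemma conn_torsion: "z \<in> S \<Longrightarrow> conn e z u v = conn (- e) z v u"
  by (rule conn_eqI) (simp_all add: g_conn \<Gamma>_torsion[of z e])

lemma conn_metric: "z \<in> S \<Longrightarrow> g1 z w u v = g z (conn e z w u) v + g z u (conn e z w v)"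
  using sym[of z u] by (simp add: g_conn \<Gamma>_metric)

lemma conn_J_left: "z \<in> S \<Longrightarrow> conn 1 z (\<i> *s u) v = \<i> *s conn 1 z u v"
proof (rule conn_eqI)
  assume z: "z \<in> S"
  show "g z (\<i> *s conn 1 z u v) x = \<Gamma> 1 z (\<i> *s u) v x" for x
    using g_J[OF z, of "conn 1 z u v" x] g_conn[OF z, of 1 u v "\<i> *s x"] \<Gamma>_J[OF z, of u v x] by simp
qed

lemma conn_J_right: "z \<in> S \<Longrightarrow> conn (- 1) z u (\<i> *s v) = \<i> *s conn (- 1) z u v"
  using conn_torsion[of z "- 1" u] conn_J_left[of z v u] by simp

text \<open>Lowering the index gives the components \<Gamma>, which are combinations of first
  derivatives of the metric; differentiability of the raised vector follows without a formula for
  the inverse metric.\<close>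

lemma conn_diff: assumes z: "z \<in> S" shows "(\<lambda>y. conn e y u v) differentiable (at z)"
proof (rule linear_family_inverse_differentiable[OF S z linear_lower inj_lower[OF z] lower_diff[OF z]])
  have ad: "(\<lambda>y. \<Gamma> e y u v b) differentiable (at z)" for b
    by (rule differentiableI[OF \<Gamma>_has_derivative[OF z]])
  have "(\<lambda>y. \<Sum>b\<in>Basis. \<Gamma> e y u v b *\<^sub>R b) differentiable (at z)"
    by (intro differentiable_sum ballI finite_Basis differentiable_scaleR ad differentiable_const)
  then show "(\<lambda>y. lower y (conn e y u v)) differentiable (at z)"
    by (rule iffD1[OF differentiable_cong_open[OF S z], rotated]) (simp add: lower_def g_conn)
qed

lemma dir_deriv_g:
  assumes z: "z \<in> S" and X: "X differentiable (at z)" and Y: "Y differentiable (at z)"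
  shows "dir_deriv (\<lambda>y. g y (X y) (Y y)) z w = g1 z w (X z) (Y z) + g z (dir_deriv X z w) (Y z) + g z (X z)
      (dir_deriv Y z w)"
proof -
  have d: "(\<lambda>y. g y v (Y y)) differentiable (at z)" for v
    by (rule linear_family_differentiable[OF S z g_linear(2) g_diff[OF z] Y])
  have "dir_deriv (\<lambda>y. g y (X y) (Y y)) z w = dir_deriv (\<lambda>y. g y (X z) (Y y)) z w + g z (dir_deriv X z w) (Y z)"
    by (rule linear_family_dir_deriv[where B = "\<lambda>y v. g y v (Y y)", OF S z g_linear(1) d X])
  also have "dir_deriv (\<lambda>y. g y (X z) (Y y)) z w = g1 z w (X z) (Y z) + g z (X z) (dir_deriv Y z w)"
    unfolding g1_def by (rule linear_family_dir_deriv[OF S z g_linear(2) g_diff[OF z] Y])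
  finally show ?thesis by simp
qed

lemma levi_civita_eq:
  assumes z: "z \<in> S"
  shows "levi_civita g z = conn 0 z"
  unfolding levi_civita_def
proof (rule the_equality, goal_cases)
  case 1
  show ?case
  proof (intro conjI allI impI bilinear_conn z)
    show "cov (\<lambda>_. conn 0 z) X Y z - cov (\<lambda>_. conn 0 z) Y X z = lie_bracket X Y z" for X Y
      using conn_torsion[OF z, of 0 "X z" "Y z"] by (simp add: cov_def lie_bracket_def)
    show "dir_deriv (\<lambda>y. g y (Y y) (Z y)) z (X z) =
            g z (cov (\<lambda>_. conn 0 z) X Y z) (Z z) + g z (Y z) (cov (\<lambda>_. conn 0 z) X Z z)"
      if "Y differentiable (at z)" "Z differentiable (at z)" for X Y Z
      using that by (simp add: dir_deriv_g z cov_def g_simps conn_metric[OF z, of "X z" "Y z" "Z z" 0])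
  qed
next
  case (2 A)
  \<comment> \<open>For uniqueness constant fields suffice: they turn the two axioms into symmetry
    of \<open>A\<close> and a formula for the derivative of \<open>g\<close>, and the Koszul
    combination of three such formulas isolates \<open>A\<close>.\<close>
  have sA: "A u v = A v u" for u v
    using 2[THEN conjunct2, THEN conjunct1, rule_format, of "\<lambda>_. u" "\<lambda>_. v"]
    by (simp add: cov_def lie_bracket_def)
  have mA: "g1 z w u v = g z (A w u) v + g z u (A w v)" for u v w
    using 2[THEN conjunct2, THEN conjunct2, rule_format, of "\<lambda>_. w" "\<lambda>_. u" "\<lambda>_. v"]
    by (simp add: cov_def g1_def)
  show ?case
  proof (intro ext)
    fix u v
    show "A u v = conn 0 z u v"
    proof (rule conn_eqI[OF z, symmetric])
      fix x
      show "g z (A u v) x = \<Gamma> 0 z u v x"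
        unfolding \<Gamma>_def mA using sym[OF z] sA[of u v] sA[of x u] sA[of v x]
        by (simp add: algebra_simps)
    qed
  qed
qed

section \<open>The Kaehler form and its derivatives\<close>

abbreviation "\<omega> \<equiv> kahler_form g"

lemma \<omega>_2: "\<omega> z [u, v] = complex_of_real (g z (\<i> *s u) v)"
  by (simp add: kahler_form_def)

lemma multilinear_\<omega>: "z \<in> S \<Longrightarrow> multilinear 2 (\<omega> z)"
  by (intro multilinear_2I; unfold \<omega>_2; intro linear_of_real linearI) (simp_all add: g_simps i_smult_simps)

lemma \<omega>_1_1:
  assumes z: "z \<in> S" shows "pq_part 1 1 (\<omega> z) [u, v] = \<omega> z [u, v]"
  by (subst pq_part_1_1_pair) (simp_all add: z \<omega>_2 g_simps i_smult_simps g_J)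

lemma ext_d_\<omega>: "z \<in> S \<Longrightarrow> ext_d \<omega> z [u, v, x] = complex_of_real (T z u v x)"
  by (simp add: ext_d_3 \<omega>_2 dir_deriv_of_real g_diff T_def g1_def)

lemma del_\<omega>:
  assumes z: "z \<in> S"
  shows "length vs = 3 \<Longrightarrow> del \<omega> z vs = pq_part 2 1 (ext_d \<omega> z) vs"
    and "length vs = 3 \<Longrightarrow> delbar \<omega> z vs = pq_part 1 2 (ext_d \<omega> z) vs"
proof -
  have pq: "pq_part 1 1 (\<omega> y) l = \<omega> y l" if "y \<in> S" "length l = 1 + 1" for y l
    using all_length_2[of "\<lambda>l. pq_part 1 1 (\<omega> y) l = \<omega> y l" l] \<omega>_1_1[OF that(1)] that(2) by simp
  have m: "multilinear (1 + 1) (\<omega> y)" if "y \<in> S" for y using multilinear_\<omega>[OF that] by (simp only: one_add_one)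
  show "length vs = 3 \<Longrightarrow> del \<omega> z vs = pq_part 2 1 (ext_d \<omega> z) vs"
    using del_pure[of S z 1 1 \<omega> vs, OF S z m pq] by (simp add: numeral_2_eq_2 numeral_3_eq_3)
  show "length vs = 3 \<Longrightarrow> delbar \<omega> z vs = pq_part 1 2 (ext_d \<omega> z) vs"
    using delbar_pure[of S z 1 1 \<omega> vs, OF S z m pq] by (simp add: numeral_2_eq_2 numeral_3_eq_3)
qed

lemma T_linear:
  assumes z: "z \<in> S"
  shows "linear (\<lambda>u. T z u v x)" "linear (\<lambda>v. T z u v x)" "linear (\<lambda>x. T z u v x)"
  unfolding T_def
  by (rule linearI; simp add: z g1_simps i_smult_simps algebra_simps)+

text \<open>The first and third identities express that d\<omega> has no (3,0)- or (0,3)-part,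
  \<omega> being of type (1,1). On types (2,1) and (1,2) inserting J once in each slot has the same
  effect as inserting it in all three.\<close>

lemma T_J:
  assumes z: "z \<in> S"
  shows "T z (\<i> *s u) (\<i> *s v) x + T z (\<i> *s u) v (\<i> *s x) + T z u (\<i> *s v) (\<i> *s x) = T z u v x"
    and "T z (\<i> *s u) (\<i> *s v) (\<i> *s x) = - H z u v x"
    and "T z (\<i> *s u) v x + T z u (\<i> *s v) x + T z u v (\<i> *s x) = - H z u v x"
  using z by (simp_all add: T_def H_def g1_J i_smult_simps g1_simps)

text \<open>These are the formulas (d + i d^c)/2 for the (1,0)-operator and (d - i d^c)/2 for its
  conjugate, applied to \<omega>.\<close>

lemma pq_part_ext_d_\<omega>:
  assumes z: "z \<in> S"
  shows "pq_part 2 1 (ext_d \<omega> z) [u, v, x] = (complex_of_real (T z u v x) + \<i> * complex_of_real (H z u v x)) / 2"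
    and "pq_part 1 2 (ext_d \<omega> z) [u, v, x] = (complex_of_real (T z u v x) - \<i> * complex_of_real (H z u v x)) / 2"
proof -
  note zero = linear_0[OF T_linear(1)] linear_0[OF T_linear(2)] linear_0[OF T_linear(3)]
  have 1: "complex_of_real (T z (\<i> *s u) (\<i> *s v) x) + complex_of_real (T z (\<i> *s u) v (\<i> *s x))
      + complex_of_real (T z u (\<i> *s v) (\<i> *s x)) = complex_of_real (T z u v x)"
    unfolding of_real_add[symmetric] T_J[OF z] ..
  have 2: "complex_of_real (T z (\<i> *s u) v x) + complex_of_real (T z u (\<i> *s v) x)
      + complex_of_real (T z u v (\<i> *s x)) = - complex_of_real (H z u v x)"
    unfolding of_real_add[symmetric] T_J[OF z] by simp
  have 3: "complex_of_real (T z (\<i> *s u) (\<i> *s v) (\<i> *s x)) = - complex_of_real (H z u v x)"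
    unfolding T_J[OF z] by simp
  have aux: "(3 * t + A + B + C - \<i> * (P + Q + R + 3 * W)) / 8 = (t + \<i> * h) / 2"
    "(3 * t + A + B + C + \<i> * (P + Q + R + 3 * W)) / 8 = (t - \<i> * h) / 2"
    if "A + B + C = t" "P + Q + R = - h" "W = - h" for A B C P Q R W t h :: complex
  proof -
    have "3 * t + A + B + C = 4 * t" unfolding that(1)[symmetric] by simp
    moreover have "P + Q + R + 3 * W = - 4 * h" unfolding that(2,3) by simp
    ultimately show "(3 * t + A + B + C - \<i> * (P + Q + R + 3 * W)) / 8 = (t + \<i> * h) / 2"
      "(3 * t + A + B + C + \<i> * (P + Q + R + 3 * W)) / 8 = (t - \<i> * h) / 2"
      by (simp_all only:) (simp_all add: field_simps)
  qed
  show "pq_part 2 1 (ext_d \<omega> z) [u, v, x] = (complex_of_real (T z u v x) + \<i> * complex_of_real (H z u v x)) / 2"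
    by (subst pq_part_2_1_triple) (simp_all only: ext_d_\<omega>[OF z] zero[OF z] of_real_0 aux(1)[OF 1 2 3])
  show "pq_part 1 2 (ext_d \<omega> z) [u, v, x] = (complex_of_real (T z u v x) - \<i> * complex_of_real (H z u v x)) / 2"
    by (subst pq_part_1_2_triple) (simp_all only: ext_d_\<omega>[OF z] zero[OF z] of_real_0 aux(2)[OF 1 2 3])
qed

lemma dc_\<omega>: "z \<in> S \<Longrightarrow> dc \<omega> z [u, v, x] = complex_of_real (H z u v x)"
  by (simp add: dc_def del_\<omega> pq_part_ext_d_\<omega> field_simps del: One_nat_def)

text \<open>The torsion enters \<Gamma> as \<open>e / 2\<close> times \<open>H\<close>, and the
  Bismut connection subtracts half of d^c \<omega> from Levi-Civita, hence
  \<open>e = - 1\<close>.\<close>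

lemma bismut_eq:
  assumes z: "z \<in> S"
  shows "bismut g z = conn (- 1) z"
proof (intro ext)
  fix u v
  have *: "\<Gamma> (- 1) z u v x = \<Gamma> 0 z u v x - 1 / 2 * H z u v x" for x by (simp add: \<Gamma>_def field_simps)
  have "bismut g z u v = (THE w. \<forall>x. g z w x = \<Gamma> (- 1) z u v x)"
    unfolding bismut_def levi_civita_eq[OF z] g_conn[OF z] dc_\<omega>[OF z] Re_complex_of_real * ..
  then show "bismut g z u v = conn (- 1) z u v"
    by (simp only: conn_def raise_def)
qed

end

section \<open>The Bismut-Ricci form\<close>

lemma pq_part_2_2_quadruple:
  assumes "\<And>v x t. a [0, v, x, t] = 0" "\<And>u x t. a [u, 0, x, t] = 0"
    "\<And>u v t. a [u, v, 0, t] = 0" "\<And>u v x. a [u, v, x, 0] = 0"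
  shows "pq_part 2 2 a [u, v, x, t] =
    (3 * a [u, v, x, t] + a [\<i> *s u, \<i> *s v, x, t] + a [\<i> *s u, v, \<i> *s x, t] + a [\<i> *s u, v, x, \<i> *s t]
     + a [u, \<i> *s v, \<i> *s x, t] + a [u, \<i> *s v, x, \<i> *s t] + a [u, v, \<i> *s x, \<i> *s t]
     + 3 * a [\<i> *s u, \<i> *s v, \<i> *s x, \<i> *s t]) / 8"
  by (simp add: numeral_2_eq_2 pq_part_Cons pq_part_Nil clin_def assms field_simps)

lemma clinear_expand:
  fixes L :: "complex ^ 'n::finite \<Rightarrow> complex"
  assumes L: "linear L" and J: "\<And>v. L (\<i> *s v) = \<i> * L v"
  shows "L v = (\<Sum>k\<in>UNIV. v $ k * L (axis k 1))"
proof -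
  have sc: "L (c *s w) = c * L w" for c w
  proof -
    have "c *s w = Re c *\<^sub>R w + Im c *\<^sub>R (\<i> *s w)"
      by (simp add: vec_eq_iff complex_eq_iff)
    also have "L \<dots> = Re c *\<^sub>R L w + Im c *\<^sub>R (\<i> * L w)"
      by (simp only: linear_add[OF L] linear_scale[OF L] J)
    also have "\<dots> = c * L w"
      by (simp add: complex_eq_iff)
    finally show ?thesis .
  qed
  have "v = (\<Sum>k\<in>UNIV. v $ k *s axis k 1)"
    by (simp add: vec_eq_iff axis_def if_distrib cong: if_cong)
  then have "L v = L (\<Sum>k\<in>UNIV. v $ k *s axis k 1)" by simp
  then show ?thesis by (simp only: linear_sum[OF L] sc)
qed

lemma sum_Basis_complex_vec:
  "(\<Sum>b\<in>(Basis::(complex ^ 'n::finite) set). f b) = (\<Sum>i\<in>UNIV. f (axis i 1) + f (axis i \<i>))"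
proof -
  have "(\<Sum>b\<in>(Basis::(complex ^ 'n) set). f b) = (\<Sum>i\<in>UNIV. \<Sum>b\<in>{axis i 1, axis i \<i>}. f b)"
  proof -
    have B: "(Basis::(complex ^ 'n) set) = (\<Union>i\<in>UNIV. {axis i 1, axis i \<i>})"
      by (auto simp: Basis_vec_def Basis_complex_def)
    show ?thesis unfolding B by (rule sum.UNION_disjoint) (auto simp: axis_eq_axis)
  qed
  then show ?thesis by (simp add: axis_eq_axis)
qed

lemma axis_i: "axis i \<i> = \<i> *s axis i (1::complex)"
  by (simp add: vec_eq_iff axis_def)

lemma cnj_vec_axis [simp]: "cnj_vec (axis i 1) = axis i 1"
  by (simp add: cnj_vec_def vec_eq_iff axis_def)

context hermitian_chart
begin

text \<open>This is dd^c \<omega> on constant fields, with the signs of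
  \<open>ext_d_4\<close>.\<close>

definition "dH z u v x t = H1 z u v x t - H1 z v u x t + H1 z x u v t - H1 z t u v x"

lemma dH_linear:
  assumes z: "z \<in> S"
  shows "linear (\<lambda>u. dH z u v x t)" "linear (\<lambda>v. dH z u v x t)" "linear (\<lambda>x. dH z u v x t)" "linear
      (\<lambda>t. dH z u v x t)"
  unfolding dH_def H1_def
  by (rule linearI; simp add: z g2_simps i_smult_simps algebra_simps)+

lemma H1_alternating:
  assumes "z \<in> S"
  shows "H1 z w v u x = - H1 z w u v x" "H1 z w u x v = - H1 z w u v x"
  using assms g2_sym[of z] g2_J[of z] unfolding H1_def by (smt (verit))+

lemma dH_alternating:
  assumes z: "z \<in> S"
  shows "dH z v u x t = - dH z u v x t" "dH z u x v t = - dH z u v x t" "dH z u v t x = - dH z u v x t"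
  using H1_alternating[OF z] unfolding dH_def by (smt (verit))+

lemma g2_J_swap: "z \<in> S \<Longrightarrow> g2 z x w (\<i> *s u) v = - g2 z x w (\<i> *s v) u"
  using g2_J[of z x w u v] g2_sym[of z x w u "\<i> *s v"] by simp

definition "T1 z w u v x = g2 z w u (\<i> *s v) x - g2 z w v (\<i> *s u) x + g2 z w x (\<i> *s u) v"

text \<open>\<open>T1\<close> differentiates d\<omega>, so this is dd\<omega> = 0: second
  derivatives cancel in symmetric pairs.\<close>

lemma dT_eq_0:
  assumes z: "z \<in> S"
  shows "T1 z u v x t - T1 z v u x t + T1 z x u v t - T1 z t u v x = 0"
  unfolding T1_def
  by (simp add: z g2_J_swap[of z _ _ v u] g2_comm[of z v u] g2_comm[of z x u] g2_comm[of z t u]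
      g2_comm[of z x v] g2_comm[of z t v] g2_comm[of z t x])

text \<open>The parts of type \<open>(4,0)\<close>, \<open>(3,1)\<close>, \<open>(1,3)\<close> and \<open>(0,4)\<close> of \<open>dd\<^sup>c\<omega>\<close> vanish.\<close>

lemma dH_J:
  assumes z: "z \<in> S"
  shows "dH z (\<i> *s u) (\<i> *s v) x t + dH z (\<i> *s u) v (\<i> *s x) t + dH z u (\<i> *s v) (\<i> *s x) t = dH z u v x t"
  unfolding dH_def H1_def
  by (simp add: z g2_J i_smult_simps g2_simps) (simp add:
    g2_sym[OF z, of _ _ v u] g2_J_swap[OF z, of _ _ v u] g2_sym[OF z, of _ _ x u]
    g2_J_swap[OF z, of _ _ x u] g2_sym[OF z, of _ _ t u] g2_J_swap[OF z, of _ _ t u]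
    g2_sym[OF z, of _ _ x v] g2_J_swap[OF z, of _ _ x v] g2_sym[OF z, of _ _ t v]
    g2_J_swap[OF z, of _ _ t v] g2_sym[OF z, of _ _ t x] g2_J_swap[OF z, of _ _ t x]
    g2_comm[OF z, of v u] g2_comm[OF z, of v "\<i> *s u"] g2_comm[OF z, of "\<i> *s v" u]
    g2_comm[OF z, of "\<i> *s v" "\<i> *s u"] g2_comm[OF z, of x u] g2_comm[OF z, of x "\<i> *s u"]
    g2_comm[OF z, of "\<i> *s x" u] g2_comm[OF z, of "\<i> *s x" "\<i> *s u"] g2_comm[OF z, of t u]
    g2_comm[OF z, of t "\<i> *s u"] g2_comm[OF z, of "\<i> *s t" u]
    g2_comm[OF z, of "\<i> *s t" "\<i> *s u"] g2_comm[OF z, of x v] g2_comm[OF z, of x "\<i> *s v"]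
    g2_comm[OF z, of "\<i> *s x" v] g2_comm[OF z, of "\<i> *s x" "\<i> *s v"] g2_comm[OF z, of t v]
    g2_comm[OF z, of t "\<i> *s v"] g2_comm[OF z, of "\<i> *s t" v]
    g2_comm[OF z, of "\<i> *s t" "\<i> *s v"] g2_comm[OF z, of t x] g2_comm[OF z, of t "\<i> *s x"]
    g2_comm[OF z, of "\<i> *s t" x] g2_comm[OF z, of "\<i> *s t" "\<i> *s x"])

lemma multilinear_ext_d_\<omega>: "z \<in> S \<Longrightarrow> multilinear 3 (ext_d \<omega> z)"
  by (intro multilinear_3I; simp only: ext_d_\<omega>) (intro linear_of_real T_linear; assumption)+

lemma T_has_derivative: "z \<in> S \<Longrightarrow> ((\<lambda>y. T y u v x) has_derivative (\<lambda>w. T1 z w u v x)) (at z)"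
  unfolding T_def T1_def g2_def
  by (intro has_derivative_add has_derivative_diff has_derivative_dir_deriv g1_diff)

lemma dir_deriv_delbar_\<omega>:
  assumes z: "z \<in> S"
  shows "dir_deriv (\<lambda>y. delbar \<omega> y [u, v, x]) z w
    = (complex_of_real (T1 z w u v x) - \<i> * complex_of_real (H1 z w u v x)) * (1 / 2)"
proof -
  have "dir_deriv (\<lambda>y. delbar \<omega> y [u, v, x]) z w
    = dir_deriv (\<lambda>y. (complex_of_real (T y u v x) - \<i> * complex_of_real (H y u v x)) * (1 / 2)) z w"
    by (rule dir_deriv_cong_open[OF S z]) (simp add: del_\<omega> pq_part_ext_d_\<omega> del: One_nat_def)
  also have "\<dots> = (complex_of_real (T1 z w u v x) - \<i> * complex_of_real (H1 z w u v x)) * (1 / 2)"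
    by (rule dir_deriv_eq) (intro has_derivative_mult_left has_derivative_mult_right has_derivative_diff
        has_derivative_of_real' T_has_derivative H_has_derivative z)
  finally show ?thesis .
qed

text \<open>Since dd\<omega> = 0, the derivative of \<open>delbar \<omega>\<close> is -i/2 times
  dd^c \<omega>, and applying \<open>del\<close> keeps its (2,2)-part. So the hypothesis makes that
  part of \<open>dH\<close> vanish, and by \<open>dH_J\<close> there is no other.\<close>

lemma dH_eq_0:
  assumes z: "z \<in> S" and plu: "\<And>vs. length vs = 4 \<Longrightarrow> del (delbar \<omega>) z vs = 0"
  shows "dH z u v x t = 0"
proof -
  have eq: "delbar \<omega> y l = pq_part 1 2 (ext_d \<omega> y) l" if "y \<in> S" "length l = 3" for y l
    using del_\<omega>(2)[OF that(1)] that(2) by simp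
  have pq: "pq_part 1 2 (delbar \<omega> y) l = delbar \<omega> y l" if y: "y \<in> S" and l: "length l = 1 + 2" for y l
  proof -
    have l3: "length l = 3" using l by simp
    have "pq_part 1 2 (delbar \<omega> y) l = pq_part 1 2 (pq_part 1 2 (ext_d \<omega> y)) l"
      by (rule pq_part_cong) (simp only: l3 eq[OF y])
    also have "\<dots> = delbar \<omega> y l"
      using multilinear_ext_d_\<omega>[OF y] by (subst pq_part_pq_part) (simp_all only: l3 eq[OF y] refl simp_thms if_True)
    finally show ?thesis .
  qed
  have m: "multilinear (1 + 2) (delbar \<omega> y)" if y: "y \<in> S" for y
  proof -
    have "multilinear 3 (delbar \<omega> y)"
      by (intro multilinear_3I linearI; simp only: eq[OF y] length_Cons list.size(3) One_nat_def[symmetric] numeral_3_eq_3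
            pq_part_ext_d_\<omega>[OF y] linear_simps[OF T_linear(1)[OF y]] linear_simps[OF T_linear(2)[OF y]]
            linear_simps[OF T_linear(3)[OF y]] linear_simps[OF H_linear(1)[OF y]] linear_simps[OF H_linear(2)[OF y]]
            linear_simps[OF H_linear(3)[OF y]])
        (simp_all add: scaleR_conv_of_real field_simps)
    moreover have "1 + 2 = (3::nat)" by simp
    ultimately show ?thesis by (simp only:)
  qed
  have D: "ext_d (delbar \<omega>) z [u, v, x, t] = - \<i> / 2 * complex_of_real (dH z u v x t)" for u v x t
  proof -
    have "T1 z u v x t - T1 z v u x t + T1 z x u v t - T1 z t u v x = 0"
      by (rule dT_eq_0[OF z])
    then have "T1 z u v x t = T1 z v u x t - T1 z x u v t + T1 z t u v x" by simp
    then have "complex_of_real (T1 z u v x t) = complex_of_real (T1 z v u x t) - complex_of_real (T1 z x u v t)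
       + complex_of_real (T1 z t u v x)"
      by (simp only: of_real_diff of_real_add)
    moreover have "(A - \<i> * P) * (1 / 2) - (B - \<i> * Q) * (1 / 2) + (C - \<i> * R) * (1 / 2) - (E - \<i> * V) * (1 / 2)
      = - \<i> / 2 * (P - Q + R - V)" if "A = B - C + E" for A B C E P Q R V :: complex
      unfolding that by (simp add: field_simps)
    ultimately show ?thesis
      unfolding ext_d_4 dir_deriv_delbar_\<omega>[OF z] dH_def of_real_diff of_real_add by blast
  qed
  note zero = linear_0[OF dH_linear(1)[OF z]] linear_0[OF dH_linear(2)[OF z]]
    linear_0[OF dH_linear(3)[OF z]] linear_0[OF dH_linear(4)[OF z]]
  note neg = linear_neg[OF dH_linear(1)[OF z]] linear_neg[OF dH_linear(2)[OF z]]
    linear_neg[OF dH_linear(3)[OF z]] linear_neg[OF dH_linear(4)[OF z]]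
  have "del (delbar \<omega>) z [u, v, x, t] = pq_part (Suc 1) 2 (ext_d (delbar \<omega>) z) [u, v, x, t]"
    by (rule del_pure[OF S z m pq]) simp_all
  then have "pq_part 2 2 (ext_d (delbar \<omega>) z) [u, v, x, t] = 0"
    using plu[of "[u, v, x, t]"] by (simp add: numeral_2_eq_2)
  then have "complex_of_real (3 * dH z u v x t + dH z (\<i> *s u) (\<i> *s v) x t + dH z (\<i> *s u) v (\<i> *s x) t
     + dH z (\<i> *s u) v x (\<i> *s t) + dH z u (\<i> *s v) (\<i> *s x) t + dH z u (\<i> *s v) x (\<i> *s t)
     + dH z u v (\<i> *s x) (\<i> *s t) + 3 * dH z (\<i> *s u) (\<i> *s v) (\<i> *s x) (\<i> *s t)) = 0"
  proof (subst (asm) pq_part_2_2_quadruple; (simp only: D zero of_real_0 mult_zero_right)?)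
    have fac: "3 * A + B + C + E + F + G + L + 3 * K = 0"
      if "(3 * (- \<i> / 2 * A) + - \<i> / 2 * B + - \<i> / 2 * C + - \<i> / 2 * E + - \<i> / 2 * F + - \<i> / 2 * G
        + - \<i> / 2 * L + 3 * (- \<i> / 2 * K)) / 8 = 0" for A B C E F G L K
    proof -
      have "(3 * (- \<i> / 2 * A) + - \<i> / 2 * B + - \<i> / 2 * C + - \<i> / 2 * E + - \<i> / 2 * F + - \<i> / 2 * G
        + - \<i> / 2 * L + 3 * (- \<i> / 2 * K)) / 8 = - \<i> / 16 * (3 * A + B + C + E + F + G + L + 3 * K)"
        by (simp add: field_simps)
      then have "- \<i> / 16 * (3 * A + B + C + E + F + G + L + 3 * K) = 0" using that by (simp only:)
      then show ?thesis by (simp only: mult_eq_0_iff divide_eq_0_iff neg_equal_0_iff_equal) simp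
    qed
    show ?thesis if "(3 * (- \<i> / 2 * complex_of_real (dH z u v x t)) + - \<i> / 2 * complex_of_real (dH z (\<i> *s u)
        (\<i> *s v) x t)
      + - \<i> / 2 * complex_of_real (dH z (\<i> *s u) v (\<i> *s x) t) + - \<i> / 2 * complex_of_real (dH z
          (\<i> *s u) v x (\<i> *s t))
      + - \<i> / 2 * complex_of_real (dH z u (\<i> *s v) (\<i> *s x) t) + - \<i> / 2 * complex_of_real (dH z u
          (\<i> *s v) x (\<i> *s t))
      + - \<i> / 2 * complex_of_real (dH z u v (\<i> *s x) (\<i> *s t))
      + 3 * (- \<i> / 2 * complex_of_real (dH z (\<i> *s u) (\<i> *s v) (\<i> *s x) (\<i> *s t)))) / 8 = 0"
      using fac[OF that] by simp
  qed
  then have pq22: "3 * dH z u v x t + dH z (\<i> *s u) (\<i> *s v) x t + dH z (\<i> *s u) v (\<i> *s x) t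
     + dH z (\<i> *s u) v x (\<i> *s t) + dH z u (\<i> *s v) (\<i> *s x) t + dH z u (\<i> *s v) x (\<i> *s t)
     + dH z u v (\<i> *s x) (\<i> *s t) + 3 * dH z (\<i> *s u) (\<i> *s v) (\<i> *s x) (\<i> *s t) = 0"
    unfolding of_real_eq_0_iff .
  note J = dH_J[OF z]
  have c2: "dH z a b c e = dH z a e b c" for a b c e
    using dH_alternating[OF z] by (metis minus_minus)
  have c1: "dH z a b c e = - dH z e a b c" for a b c e
    using dH_alternating[OF z] by (metis minus_minus)
  have J4: "dH z (\<i> *s u) (\<i> *s v) x t + dH z (\<i> *s u) v x (\<i> *s t) + dH z u (\<i> *s v) x (\<i> *s t)
      = dH z u v x t" for u v x t
    using J[of u v t x] by (simp add: dH_alternating(3)[OF z, of _ _ _ x])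
  have J2: "dH z (\<i> *s u) v (\<i> *s x) t + dH z (\<i> *s u) v x (\<i> *s t) + dH z u v (\<i> *s x) (\<i> *s t)
      = dH z u v x t" for u v x t
    using J[of u x t v] by (simp add: c2[of _ _ _ v])
  have J1: "dH z u (\<i> *s v) (\<i> *s x) t + dH z u (\<i> *s v) x (\<i> *s t) + dH z u v (\<i> *s x) (\<i> *s t)
      = dH z u v x t" for u v x t
    using J[of v x t u] by (simp add: c1[of _ _ _ u])
  \<comment> \<open>In the four identities at \<open>u v x t\<close> every pair of slots occurs
    twice, so the six terms with two J's add up to twice \<open>dH\<close>. The other four instances
    each express the term with four J's by three of these, so it equals \<open>dH\<close>.
    Altogether \<open>pq22\<close> reads (3 + 2 + 3) \<open>dH\<close> = 0.\<close>
  show ?thesis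
    using pq22 J[of u v x t] J4[of u v x t] J2[of u v x t] J1[of u v x t]
      J[of u v "\<i> *s x" "\<i> *s t"] J4[of u v "\<i> *s x" "\<i> *s t"]
      J2[of u "\<i> *s v" x "\<i> *s t"] J1[of "\<i> *s u" v x "\<i> *s t"]
    by (simp add: neg)
qed

section \<open>Curvature with lowered index and its pair symmetry\<close>

definition "Rm e z X Y Z W = \<Gamma>1 e z X Y Z W - \<Gamma>1 e z Y X Z W
  + g z (conn e z X Z) (conn e z Y W) - g z (conn e z Y Z) (conn e z X W)"

text \<open>Differentiating \<open>g (conn Y Z) W = \<Gamma> Y Z W\<close> and using metric
  compatibility replaces the derivative of the raised connection by \<open>\<Gamma>1\<close> and
  quadratic terms; the iterated ones cancel against those of the curvature.\<close>

lemma g_curv: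
  assumes z: "z \<in> S"
  shows "g z (curv (conn e) z X Y Z) W = Rm e z X Y Z W"
proof -
  have der: "g z (dir_deriv (\<lambda>y. conn e y v Z) z u) W = \<Gamma>1 e z u v Z W
     - g z (conn e z u (conn e z v Z)) W - g z (conn e z v Z) (conn e z u W)" for u v
  proof -
    have "dir_deriv (\<lambda>y. g y (conn e y v Z) W) z u = dir_deriv (\<lambda>y. \<Gamma> e y v Z W) z u"
      by (rule dir_deriv_cong_open[OF S z]) (rule g_conn)
    also have "\<dots> = \<Gamma>1 e z u v Z W" by (rule dir_deriv_eq[OF \<Gamma>_has_derivative[OF z]])
    finally show ?thesis
      using dir_deriv_g[OF z conn_diff[OF z, of e v Z], of "\<lambda>_. W" u]
      by (simp add: z g_simps conn_metric[OF z, of u "conn e z v Z" W e])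
  qed
  show ?thesis
    unfolding curv_eq[of "conn e", OF bilinear_conn[OF z]]
    by (simp add: z g_simps der Rm_def)
qed

text \<open>The quadratic terms correspond because reversing the torsion swaps the arguments of
  \<open>conn\<close>. The pure second derivatives of \<open>g\<close> match by their symmetries,
  and the torsion terms differ by half of \<open>dH\<close>.\<close>

lemma Rm_pair:
  assumes z: "z \<in> S" and closed: "dH z X Y Z W = 0"
  shows "Rm 1 z X Y Z W = Rm (- 1) z Z W X Y"
proof -
  have q: "g z (conn 1 z X Z) (conn 1 z Y W) - g z (conn 1 z Y Z) (conn 1 z X W) =
    g z (conn (- 1) z Z X) (conn (- 1) z W Y) - g z (conn (- 1) z W X) (conn (- 1) z Z Y)"
    using conn_torsion[OF z, of 1] sym[OF z] by simp
  have "\<Gamma>1 1 z X Y Z W - \<Gamma>1 1 z Y X Z W = \<Gamma>1 (- 1) z Z W X Y - \<Gamma>1 (- 1) z W Z X Y"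
    using closed H1_alternating(1)[OF z, of Z X W Y] H1_alternating(2)[OF z, of Z X Y W]
      H1_alternating(1)[OF z, of W X Z Y] H1_alternating(2)[OF z, of W X Y Z]
    unfolding \<Gamma>1_def dH_def
    by (simp add: g2_comm[OF z, of Y X] g2_comm[OF z, of Z X] g2_comm[OF z, of W X]
        g2_comm[OF z, of Z Y] g2_comm[OF z, of W Y] g2_comm[OF z, of W Z]
        g2_sym[OF z, of _ _ Y X] g2_sym[OF z, of _ _ Z X] g2_sym[OF z, of _ _ W X]
        g2_sym[OF z, of _ _ Z Y] g2_sym[OF z, of _ _ W Y] g2_sym[OF z, of _ _ W Z] field_simps)
  then show ?thesis unfolding Rm_def using q by linarith
qed

lemma Rm_skew:
  assumes z: "z \<in> S"
  shows "Rm e z X Y W Z = - Rm e z X Y Z W"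
proof -
  have a1: "\<Gamma>1 e z X Y Z W + \<Gamma>1 e z X Y W Z = g2 z X Y Z W" for X Y
    unfolding \<Gamma>1_def using H1_alternating(2)[OF z, of X Y W Z]
    by (simp add: g2_sym[OF z, of _ _ W Z] g2_sym[OF z, of _ _ W Y] g2_sym[OF z, of _ _ Z Y] field_simps)
  show ?thesis
    unfolding Rm_def
    using a1[of X Y] a1[of Y X] g2_comm[OF z, of X Y Z W]
      sym[OF z, of "conn e z X W" "conn e z Y Z"] sym[OF z, of "conn e z Y W" "conn e z X Z"] by linarith
qed

text \<open>J has constant coefficients in the chart and commutes with the Bismut connection form,
  hence with its curvature.\<close>

lemma curv_J:
  assumes z: "z \<in> S"
  shows "curv (conn (- 1)) z X Y (\<i> *s Z) = \<i> *s curv (conn (- 1)) z X Y Z"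
proof -
  have "dir_deriv (\<lambda>y. conn (- 1) y v (\<i> *s Z)) z u = \<i> *s dir_deriv (\<lambda>y. conn (- 1) y v Z) z u" for u v
  proof -
    have "dir_deriv (\<lambda>y. conn (- 1) y v (\<i> *s Z)) z u = dir_deriv (\<lambda>y. \<i> *s conn (- 1) y v Z) z u"
      by (rule dir_deriv_cong_open[OF S z]) (rule conn_J_right)
    also have "\<dots> = \<i> *s dir_deriv (\<lambda>y. conn (- 1) y v Z) z u"
      by (rule dir_deriv_bounded_linear[OF bounded_linear_i_smult conn_diff[OF z]])
    finally show ?thesis .
  qed
  then show ?thesis
    unfolding curv_eq[of "conn (- 1)", OF bilinear_conn[OF z]]
    by (simp add: conn_J_right[OF z] i_smult_simps)
qed

lemma curv_bismut:
  assumes z: "z \<in> S"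
  shows "curv (bismut g) z = curv (conn (- 1)) z"
proof (intro ext)
  fix X Y Z
  have "dir_deriv (\<lambda>y. bismut g y v Z) z u = dir_deriv (\<lambda>y. conn (- 1) y v Z) z u" for u v
    by (rule dir_deriv_cong_open[OF S z]) (simp add: bismut_eq)
  then show "curv (bismut g) z X Y Z = curv (conn (- 1)) z X Y Z"
    using bilinear_conn[OF z, of "- 1"] by (simp add: curv_eq bismut_eq[OF z])
qed

lemma curv_linear:
  assumes z: "z \<in> S" shows "linear (curv (conn e) z X Y)"
proof -
  have l: "linear (conn e y u)" if "y \<in> S" for y u using bilinear_conn[OF that] by (simp add: bilinear_def)
  have "curv (conn e) z X Y = (\<lambda>f. dir_deriv (\<lambda>y. conn e y Y f) z X - dir_deriv (\<lambda>y. conn e y X f) z Y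
    + conn e z X (conn e z Y f) - conn e z Y (conn e z X f))"
    by (intro ext curv_eq bilinear_conn z)
  moreover have "linear \<dots>"
    by (intro linear_compose_add linear_compose_sub
      linear_dir_deriv_family[OF S z] conn_diff l z linear_compose[OF l[OF z] l[OF z], unfolded o_def])
  ultimately show ?thesis by simp
qed

section \<open>Orthonormal bases, traces and the Bismut-Ricci form\<close>

lemma orthonormal_independent:
  assumes z: "z \<in> S" and C: "finite C" "\<And>e f. e \<in> C \<Longrightarrow> f \<in> C \<Longrightarrow> g z e f =
      (if e = f then 1 else 0)"
  shows "independent C"
proof (rule independent_if_scalars_zero[OF C(1)])
  fix c e assume c: "(\<Sum>x\<in>C. c x *\<^sub>R x) = 0" and e: "e \<in> C"
  have "g z (\<Sum>x\<in>C. c x *\<^sub>R x) e = (\<Sum>x\<in>C. c x *\<^sub>R g z x e)"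
    by (simp only: linear_sum[OF g_linear(1)[OF z]] linear_scale[OF g_linear(1)[OF z]])
  also have "\<dots> = (\<Sum>x\<in>C. if x = e then c x else 0)"
    using C e by (intro sum.cong) auto
  finally show "c e = 0" using c e C(1) by (simp add: linear_0[OF g_linear(1)[OF z]])
qed

text \<open>\<open>bismut_ricci\<close> chooses its basis by \<open>SOME\<close>. Orthonormal
  families have bounded size; one of maximal size spans, since otherwise a Gram-Schmidt step would
  enlarge it.\<close>

lemma orthonormal_basis_exists:
  assumes z: "z \<in> S" shows "\<exists>B. orthonormal_basis (g z) B"
proof -
  define P where "P B \<longleftrightarrow> (\<forall>e\<in>B. \<forall>f\<in>B. g z e f = (if e = f then 1 else 0))" for B
  have ind: "independent B" if "finite B" "P B" for B
    using orthonormal_independent[OF z] that by (simp add: P_def)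
  define N where "N = {n. \<exists>B. finite B \<and> P B \<and> card B = n}"
  have "card B \<le> DIM(complex ^ 'n)" if "finite B" "P B" for B
    by (rule independent_card_le[OF ind[OF that]])
  then have "N \<subseteq> {..DIM(complex ^ 'n)}" by (auto simp: N_def simp del: DIM_cart)
  then have fin: "finite N" using finite_subset by blast
  have "0 \<in> N" unfolding N_def P_def by (intro CollectI exI[of _ "{}"]) simp
  then have "Max N \<in> N" using fin by (intro Max_in) auto
  then obtain B where B: "finite B" "P B" "card B = Max N" by (auto simp: N_def)
  have "x \<in> span B" for x
  proof (rule ccontr)
    assume x: "x \<notin> span B"
    define y where "y = x - (\<Sum>e\<in>B. g z x e *\<^sub>R e)"
    have y: "y \<noteq> 0" using x span_sum[of B "\<lambda>e. g z x e *\<^sub>R e" B] span_base span_scale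
      unfolding y_def by (metis (no_types, lifting) eq_iff_diff_eq_0)
    have orth: "g z y e = 0" if e: "e \<in> B" for e
    proof -
      have "g z (\<Sum>f\<in>B. g z x f *\<^sub>R f) e = (\<Sum>f\<in>B. g z x f *\<^sub>R g z f e)"
        by (simp only: linear_sum[OF g_linear(1)[OF z]] linear_scale[OF g_linear(1)[OF z]])
      also have "\<dots> = (\<Sum>f\<in>B. if f = e then g z x f else 0)"
        using B e by (intro sum.cong) (auto simp: P_def)
      finally show ?thesis using e B(1) by (simp add: y_def z g_simps)
    qed
    define w where "w = (1 / sqrt (g z y y)) *\<^sub>R y"
    have p: "g z y y > 0" by (rule pos[OF z y])
    have ww: "g z w w = 1" using p by (simp add: w_def z g_simps)
    have we: "g z w e = 0" "g z e w = 0" if "e \<in> B" for e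
      using orth[OF that] sym[OF z, of e w] by (simp_all add: w_def z g_simps)
    have wB: "w \<notin> B" using we ww by fastforce
    have "P (insert w B)" using B(2) ww we wB by (auto simp: P_def)
    then have "card (insert w B) \<in> N" using B(1) by (auto simp: N_def)
    then have "card (insert w B) \<le> Max N" using fin by simp
    then show False using B wB by simp
  qed
  then have "span B = UNIV" by blast
  then show ?thesis using B(2) unfolding orthonormal_basis_def P_def by blast
qed

text \<open>Both sides are the trace of \<open>L\<close>. This removes the dependence on the chosen
  basis.\<close>

lemma trace_orthonormal_basis:
  assumes z: "z \<in> S" and B: "orthonormal_basis (g z) B" and L: "linear L"
  shows "(\<Sum>e\<in>B. g z (L e) e) = (\<Sum>b\<in>Basis. L b \<bullet> b)"
proof -
  have orth: "g z e f = (if e = f then 1 else 0)" if "e \<in> B" "f \<in> B" for e f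
    using B that by (simp add: orthonormal_basis_def)
  \<comment> \<open>\<open>orthonormal_basis\<close> does not mention finiteness, and a sum over an
    infinite set would be 0.\<close>
  have fin: "finite B"
  proof (rule ccontr)
    assume "infinite B"
    then obtain C where C: "C \<subseteq> B" "finite C" "card C = Suc DIM(complex ^ 'n)"
      using infinite_arbitrarily_large by blast
    have "independent C"
      using C by (intro orthonormal_independent[OF z]) (auto simp: orth subsetD)
    then show False using independent_card_le[of C] C(3) by simp
  qed
  have expand: "x = (\<Sum>e\<in>B. g z x e *\<^sub>R e)" for x
  proof -
    have "x \<in> span B" using B by (simp add: orthonormal_basis_def)
    then obtain c where c: "x = (\<Sum>e\<in>B. c e *\<^sub>R e)" using span_finite[OF fin] by auto
    have "g z x e = c e" if e: "e \<in> B" for e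
    proof -
      have "g z x e = (\<Sum>f\<in>B. c f *\<^sub>R g z f e)"
        unfolding c by (simp only: linear_sum[OF g_linear(1)[OF z]] linear_scale[OF g_linear(1)[OF z]])
      also have "\<dots> = (\<Sum>f\<in>B. if f = e then c f else 0)"
        using e by (intro sum.cong) (auto simp: orth)
      finally show ?thesis using e fin by simp
    qed
    then show ?thesis using c by simp
  qed
  have "(\<Sum>b\<in>Basis. L b \<bullet> b) = (\<Sum>b\<in>Basis. \<Sum>e\<in>B. g z (L b) e * (e \<bullet> b))"
  proof (intro sum.cong refl)
    fix b :: "complex ^ 'n"
    have "L b \<bullet> b = (\<Sum>e\<in>B. g z (L b) e *\<^sub>R e) \<bullet> b" using expand[of "L b"] by simp
    then show "L b \<bullet> b = (\<Sum>e\<in>B. g z (L b) e * (e \<bullet> b))" by (simp add: inner_sum_left)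
  qed
  also have "\<dots> = (\<Sum>e\<in>B. \<Sum>b\<in>Basis. g z (L b) e * (e \<bullet> b))" by (rule sum.swap)
  also have "\<dots> = (\<Sum>e\<in>B. g z (L e) e)"
  proof (intro sum.cong refl)
    fix e
    have "g z (L e) e = g z (L (\<Sum>b\<in>Basis. (e \<bullet> b) *\<^sub>R b)) e" by (simp add: euclidean_representation)
    also have "\<dots> = (\<Sum>b\<in>Basis. (e \<bullet> b) *\<^sub>R g z (L b) e)"
      by (simp only: linear_sum[OF L] linear_scale[OF L] linear_sum[OF g_linear(1)[OF z]] linear_scale[OF g_linear(1)[OF z]])
    finally show "(\<Sum>b\<in>Basis. g z (L b) e * (e \<bullet> b)) = g z (L e) e" by (simp add: mult.commute)
  qed
  finally show ?thesis by simp
qed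

text \<open>The curvature endomorphism is complex linear and skew for \<open>g\<close>. Skewness
  makes its real trace, twice the real part of the complex trace, vanish; composing with J first
  yields minus twice the imaginary part, and the 1/2 in the Ricci form removes the factor 2.\<close>

lemma bismut_ricci_eq:
  assumes z: "z \<in> S"
  shows "- \<i> * bismut_ricci g z [r, x] = (\<Sum>i\<in>UNIV. curv (conn (- 1)) z r x (axis i 1) $ i)"
proof -
  define L where "L = curv (conn (- 1)) z r x"
  define B where "B = (SOME B. orthonormal_basis (g z) B)"
  have B: "orthonormal_basis (g z) B"
    unfolding B_def by (rule someI_ex[OF orthonormal_basis_exists[OF z]])
  have L: "linear L" unfolding L_def by (rule curv_linear[OF z])
  have LJ: "L (\<i> *s v) = \<i> *s L v" for v unfolding L_def by (rule curv_J[OF z])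
  have Li: "L (axis i \<i>) = \<i> *s L (axis i 1)" for i by (simp only: axis_i LJ)
  have inner1: "v \<bullet> axis i 1 = Re (v $ i)" for v :: "complex ^ 'n" and i by (simp add: inner_axis)
  have inneri: "v \<bullet> axis i \<i> = Im (v $ i)" for v :: "complex ^ 'n" and i by (simp add: inner_axis)
  have "g z (L e) e = - g z (L e) e" for e
    unfolding L_def g_curv[OF z] using Rm_skew[OF z] .
  then have "g z (L e) e = 0" for e by (simp add: eq_neg_iff_add_eq_0)
  then have "0 = (\<Sum>e\<in>B. g z (L e) e)" by simp
  also have "\<dots> = (\<Sum>b\<in>Basis. L b \<bullet> b)" by (rule trace_orthonormal_basis[OF z B L])
  also have "\<dots> = 2 * (\<Sum>i\<in>UNIV. Re (L (axis i 1) $ i))"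
    by (simp add: sum_Basis_complex_vec inner1 inneri Li sum_distrib_left flip: mult_2)
  finally have re: "(\<Sum>i\<in>UNIV. Re (L (axis i 1) $ i)) = 0" by simp
  have "(\<Sum>e\<in>B. g z (L (\<i> *s e)) e) = (\<Sum>b\<in>Basis. L (\<i> *s b) \<bullet> b)"
    by (rule trace_orthonormal_basis[OF z B linear_compose[OF linear_i_smult L, unfolded o_def]])
  also have "\<dots> = - 2 * (\<Sum>i\<in>UNIV. Im (L (axis i 1) $ i))"
    by (simp add: sum_Basis_complex_vec inner1 inneri Li LJ sum_distrib_left sum_negf[symmetric])
  finally have im: "(\<Sum>e\<in>B. g z (L (\<i> *s e)) e) = - 2 * (\<Sum>i\<in>UNIV. Im (L (axis i 1) $ i))" .
  have "bismut_ricci g z [r, x] = complex_of_real (- (\<Sum>i\<in>UNIV. Im (L (axis i 1) $ i)))"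
    using im by (simp add: bismut_ricci_def curv_bismut[OF z] L_def B_def)
  then show ?thesis
    using re by (simp add: complex_eq_iff L_def)
qed

text \<open>This is the bilinear extension of \<open>g\<close> at the (1,0)-part of \<open>u\<close>
  and the conjugate (0,1)-part of \<open>v\<close>, linear in \<open>u\<close> and antilinear in
  \<open>v\<close>. By \<open>metric_c_eq\<close> every value of the complexified metric reduces to
  it, with vectors of the chart as arguments.\<close>

definition "hg z u v = (complex_of_real (g z u v) + \<i> * complex_of_real (g z u (\<i> *s v))) / 2"

lemma hg_J_left: "z \<in> S \<Longrightarrow> hg z (\<i> *s u) v = \<i> * hg z u v"
  by (simp add: hg_def g_J i_smult_simps g_simps algebra_simps)

lemma hg_J_right: "z \<in> S \<Longrightarrow> hg z u (\<i> *s v) = - \<i> * hg z u v"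
  by (simp add: hg_def g_simps algebra_simps)

lemma hg_linear:
  assumes z: "z \<in> S" shows "linear (\<lambda>u. hg z u v)" "linear (\<lambda>v. hg z u v)"
  unfolding hg_def
  by (rule linearI; simp add: z g_simps i_smult_simps scaleR_conv_of_real[where 'a = complex] field_simps)+

lemma Re_hg: "Re (hg z u v) = g z u v / 2"
  by (simp add: hg_def)

lemma metric_c_eq:
  assumes z: "z \<in> S"
  shows "metric_c g z (p, q) (p', q') = hg z p (cnj_vec q') + hg z p' (cnj_vec q)"
  unfolding metric_c_def
  by (simp add: clin_def hg_def z g_simps i_smult_simps J_inv g_J sym[OF z, of p'] sym[OF z, of "\<i> *s p'"] field_simps)

lemma hg_nondegenerate:
  assumes z: "z \<in> S" shows "(\<And>x. hg z w x = hg z w' x) \<Longrightarrow> w = w'" "(\<And>x. hg z x w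
      = hg z x w') \<Longrightarrow> w = w'"
proof -
  show "w = w'" if "\<And>x. hg z w x = hg z w' x"
    by (rule nondegenerate[OF z])
        (use Re_hg that in \<open>metis mult_cancel_right nonzero_eq_divide_eq divide_cancel_right zero_neq_numeral\<close>)
  show "w = w'" if "\<And>x. hg z x w = hg z x w'"
  proof (rule nondegenerate[OF z])
    fix x
    show "g z w x = g z w' x" using Re_hg[of z x w] Re_hg[of z x w'] that[of x] sym[OF z] by simp
  qed
qed

end

section \<open>The bundle\<close>

lemma qscale_add: "qscale c (s + t) = qscale c s + qscale c t"
  by (simp add: qscale_def prod_eq_iff vec_eq_iff algebra_simps)

lemma qscale_diff: "qscale c (s - t) = qscale c s - qscale c t"
  by (simp add: qscale_def prod_eq_iff vec_eq_iff algebra_simps)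

lemma qscale_qscale [simp]: "qscale c (qscale d s) = qscale (c * d) s"
  by (simp add: qscale_def prod_eq_iff vec_eq_iff algebra_simps)

lemma qscale_simps [simp]: "qscale 0 s = 0" "qscale 1 s = s" "qscale c 0 = 0"
  by (simp_all add: qscale_def prod_eq_iff vec_eq_iff)

lemma qscale_scaleR: "qscale c (r *\<^sub>R s) = r *\<^sub>R qscale c s"
  by (simp add: qscale_def prod_eq_iff vec_eq_iff)

lemma linear_qscale: "linear (qscale c)"
  by (rule linearI) (simp_all add: qscale_add qscale_scaleR)

lemma qclin_01: "qclin L (0, b) = qscale (1 / 2) (L (cnj_vec b) + qscale \<i> (L (\<i> *s cnj_vec b)))" if "L 0 = 0"
  using that by (simp add: qclin_def)

lemma matrix_mult_component: "(A ** B) $ i $ j = (\<Sum>k\<in>UNIV. A $ i $ k * B $ k $ j)"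
  by (simp add: matrix_matrix_mult_def)

lemma cext_form10: "cext (form10 \<xi>) [t] = (\<Sum>k\<in>UNIV. \<xi> $ k * fst t $ k)"
proof -
  define L where "L v = (\<Sum>k\<in>UNIV. \<xi> $ k * v $ k)" for v :: "complex ^ 'a"
  have "L (\<i> *s v) = \<i> * L v" for v by (simp add: L_def sum_distrib_left algebra_simps)
  moreover have "cext (form10 \<xi>) [t] = clin L t" by (simp add: form10_def L_def[abs_def])
  ultimately show ?thesis by (simp add: clin_def) (simp add: L_def)
qed

context hermitian_chart
begin

lemma hg_simps:
  assumes "z \<in> S"
  shows "hg z (u + u') v = hg z u v + hg z u' v" "hg z u (v + v') = hg z u v + hg z u v'"
    "hg z (u - u') v = hg z u v - hg z u' v" "hg z u (v - v') = hg z u v - hg z u v'"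
    "hg z (- u) v = - hg z u v" "hg z u (- v) = - hg z u v" "hg z 0 v = 0" "hg z u 0 = 0"
    "hg z (r *\<^sub>R u) v = r *\<^sub>R hg z u v" "hg z u (r *\<^sub>R v) = r *\<^sub>R hg z u v"
  using linear_simps[OF hg_linear(1)[OF assms]] linear_simps[OF hg_linear(2)[OF assms]] by auto

lemma hg_expand:
  assumes z: "z \<in> S" shows "(\<Sum>k\<in>UNIV. v $ k * hg z (axis k 1) w) = hg z v w"
  by (rule clinear_expand[symmetric]) (rule hg_linear[OF z] hg_J_left[OF z])+

lemma cnj_hg: "z \<in> S \<Longrightarrow> cnj (hg z u v) = hg z v u"
  by (simp add: hg_def sym[of z u v] g_J sym[of z v "\<i> *s u"] sym[of z "\<i> *s u" v])

lemma herm_matrix_component: "z \<in> S \<Longrightarrow> herm_matrix g z $ i $ j = hg z (axis i 1) (axis j 1)"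
  by (simp add: herm_matrix_def metric_c_eq hg_simps)

lemma invertible_herm_matrix:
  assumes z: "z \<in> S" shows "invertible (herm_matrix g z)"
proof -
  have "x = 0" if "herm_matrix g z *v x = 0" for x
  proof -
    have hx: "hg z (axis i 1) (cnj_vec x) = (herm_matrix g z *v x) $ i" for i
    proof -
      have "hg z (axis i 1) (cnj_vec x) = cnj (hg z (cnj_vec x) (axis i 1))" by (simp add: cnj_hg[OF z])
      also have "\<dots> = (\<Sum>k\<in>UNIV. x $ k * cnj (hg z (axis k 1) (axis i 1)))"
        by (subst hg_expand[OF z, of "cnj_vec x", symmetric]) (simp add: cnj_vec_def)
      finally show ?thesis
        by (simp add: matrix_vector_mult_def herm_matrix_component[OF z] cnj_hg[OF z] mult.commute)
    qed
    have "hg z c (cnj_vec x) = 0" for c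
      by (simp only: hg_expand[OF z, of c, symmetric] hx that zero_index mult_zero_right sum.neutral_const)
    then have "hg z c (cnj_vec x) = hg z c 0" for c by (simp add: hg_simps z)
    then have "cnj_vec x = 0" by (rule hg_nondegenerate(2)[OF z])
    then show "x = 0" by (metis cnj_vec_0 cnj_vec_cnj_vec)
  qed
  then obtain B where "B ** herm_matrix g z = mat 1"
    using matrix_left_invertible_ker[of "herm_matrix g z"] by blast
  then show ?thesis unfolding invertible_def using matrix_left_right_inverse by blast
qed

text \<open>Complex linearity of \<open>L\<close> turns the two extensions into
  \<open>hg z (L (axis i 1)) (axis j 1)\<close>. As a matrix this is
  \<open>M ** herm_matrix g z\<close>, with \<open>M\<close> the transposed matrix of
  \<open>L\<close>, and the contraction with the inverse leaves the trace of
  \<open>M\<close>.\<close>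

lemma trace_herm_matrix:
  assumes z: "z \<in> S" and L: "linear L" "\<And>v. L (\<i> *s v) = \<i> *s L v"
  shows "(\<Sum>i\<in>UNIV. \<Sum>j\<in>UNIV. matrix_inv (herm_matrix g z) $ j $ i *
      clin (\<lambda>u. clin (\<lambda>v. complex_of_real (g z (L u) v)) (0, axis j 1)) (axis i 1, 0))
    = (\<Sum>i\<in>UNIV. L (axis i 1) $ i)"
proof -
  let ?H = "herm_matrix g z"
  have c1: "clin (\<lambda>v. complex_of_real (g z w v)) (0, axis j 1) = hg z w (axis j 1)" for w j
    by (subst clin_01) (simp_all add: hg_def z g_simps)
  have c2: "clin (\<lambda>u. hg z (L u) w) (axis i 1, 0) = hg z (L (axis i 1)) w" for w i
    by (subst clin_10) (simp_all add: L(2) linear_0[OF L(1)] hg_simps z hg_J_left)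
  define M :: "complex ^ 'n ^ 'n" where "M = (\<chi> i l. L (axis i 1) $ l)"
  have M: "hg z (L (axis i 1)) (axis j 1) = (M ** ?H) $ i $ j" for i j
    by (simp add: matrix_mult_component M_def herm_matrix_component[OF z] hg_expand[OF z])
  have inv: "?H ** matrix_inv ?H = mat 1"
    using invertible_herm_matrix[OF z] unfolding invertible_def matrix_inv_def by (rule someI2_ex) simp
  have "(\<Sum>i\<in>UNIV. \<Sum>j\<in>UNIV. matrix_inv ?H $ j $ i *
      clin (\<lambda>u. clin (\<lambda>v. complex_of_real (g z (L u) v)) (0, axis j 1)) (axis i 1, 0))
    = (\<Sum>i\<in>UNIV. ((M ** ?H) ** matrix_inv ?H) $ i $ i)"
    by (simp only: c1 c2 M matrix_mult_component[of "M ** ?H"] mult.commute)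
  also have "(M ** ?H) ** matrix_inv ?H = M"
    by (simp only: matrix_mul_assoc[symmetric] inv matrix_mul_rid)
  finally show ?thesis by (simp add: M_def)
qed

lemma metric_inv_eqI:
  assumes z: "z \<in> S" and w: "\<And>p q. metric_c g z w (p, q) = \<theta> (p, q)"
  shows "metric_inv g z \<theta> = w"
  unfolding metric_inv_def
proof (rule the_equality)
  show "\<forall>v. metric_c g z w v = \<theta> v" using w by auto
  fix w' assume w': "\<forall>v. metric_c g z w' v = \<theta> v"
  obtain a b where ab: "w = (a, b)" by fastforce
  obtain a' b' where ab': "w' = (a', b')" by fastforce
  have eq: "hg z a' (cnj_vec q) + hg z p (cnj_vec b') = hg z a (cnj_vec q) + hg z p (cnj_vec b)" for p q
    using w[of p q] w' by (simp add: ab ab' metric_c_eq[OF z])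
  have "hg z a' x = hg z a x" for x using eq[of "cnj_vec x" 0] by (simp add: hg_simps z)
  then have "a' = a" by (rule hg_nondegenerate(1)[OF z])
  moreover have "hg z x (cnj_vec b') = hg z x (cnj_vec b)" for x using eq[of 0 x] by (simp add: hg_simps z)
  then have "cnj_vec b' = cnj_vec b" by (rule hg_nondegenerate(2)[OF z])
  then have "b' = b" by (metis cnj_vec_cnj_vec)
  ultimately show "w' = w" by (simp add: ab ab')
qed

definition "hg1 z w u v = (complex_of_real (g1 z w u v) + \<i> * complex_of_real (g1 z w u (\<i> *s v))) / 2"

lemma hg_alt: "hg z u v = 1 / 2 * complex_of_real (g z u v) + \<i> / 2 * complex_of_real (g z u (\<i> *s v))"
  by (simp add: hg_def add_divide_distrib)

lemma C2_hg: "C2_on S (\<lambda>y. hg y u v)"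
  unfolding hg_alt by (intro C2_on_add S C2_on_bounded_linear[OF S C2 bounded_linear_mult_of_real])

lemma hg_has_derivative: "z \<in> S \<Longrightarrow> ((\<lambda>y. hg y u v) has_derivative (\<lambda>w. hg1 z w u v)) (at z)"
proof -
  assume z: "z \<in> S"
  have "((\<lambda>y. hg y u v) has_derivative (\<lambda>w. 1 / 2 * complex_of_real (g1 z w u v)
      + \<i> / 2 * complex_of_real (g1 z w u (\<i> *s v)))) (at z)"
    unfolding hg_alt g1_def by (intro has_derivative_add has_derivative_mult_right has_derivative_of_real'
        has_derivative_dir_deriv g_diff z)
  then show ?thesis by (simp add: hg1_def add_divide_distrib)
qed

end

text \<open>The pair \<open>(r\<^sub>1, r\<^sub>2)\<close> stands for the complexified tangent vector \<open>r\<^sub>1 + \<i> r\<^sub>2\<close>;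
  its \<open>(1,0)\<close>-part is \<open>p10\<close>, and \<open>q01\<close> is the conjugate of its \<open>(0,1)\<close>-part.\<close>

definition p10 :: "(complex ^ 'n::finite) \<times> (complex ^ 'n) \<Rightarrow> complex ^ 'n" where
  "p10 w = fst w + \<i> *s snd w"
definition q01 :: "(complex ^ 'n) \<times> (complex ^ 'n) \<Rightarrow> complex ^ 'n" where
  "q01 w = fst w - \<i> *s snd w"

lemma pq_add: "p10 (v + w) = p10 v + p10 w" "q01 (v + w) = q01 v + q01 w"
  by (simp_all add: p10_def q01_def i_smult_simps)

lemma pq_scaleR: "p10 (r *\<^sub>R w) = r *\<^sub>R p10 w" "q01 (r *\<^sub>R w) = r *\<^sub>R q01 w"
  by (simp_all add: p10_def q01_def i_smult_simps scaleR_add_right scaleR_diff_right)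

text \<open>Scalar multiplication on the complexification: it mixes the two components of the pair
  and does not use J.\<close>

definition cmul :: "complex \<Rightarrow> (complex ^ 'n::finite) \<times> (complex ^ 'n) \<Rightarrow>
    (complex ^ 'n) \<times> (complex ^ 'n)" where
  "cmul c w = (Re c *\<^sub>R fst w - Im c *\<^sub>R snd w, Re c *\<^sub>R snd w + Im c *\<^sub>R fst w)"

lemma smult_eq: "c *s v = Re c *\<^sub>R v + Im c *\<^sub>R (\<i> *s (v :: complex ^ 'n))"
  by (simp add: vec_eq_iff complex_eq_iff)

lemma p10_cmul: "p10 (cmul c w) = c *s p10 w"
  by (simp add: p10_def cmul_def vec_eq_iff complex_eq_iff algebra_simps)

lemma q01_cmul: "q01 (cmul c w) = cnj c *s q01 w"
  by (simp add: q01_def cmul_def vec_eq_iff complex_eq_iff algebra_simps)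

section \<open>The bundle map from the complexified tangent space\<close>

locale generalized_chart = hermitian_chart S g
  for S :: "(complex ^ 'n::finite) set" and g :: "'n metric" +
  fixes \<beta> \<omega>0 :: "'n form_field"
  assumes closed: "\<And>z vs. z \<in> S \<Longrightarrow> length vs = 4 \<Longrightarrow> del (delbar (kahler_form g)) z vs = 0"
    and \<beta>_smooth: "\<And>vs. length vs = 2 \<Longrightarrow> smooth_on S (\<lambda>z. \<beta> z vs)"
    and \<beta>_alternating: "\<And>z. z \<in> S \<Longrightarrow> alternating_form 2 (\<beta> z)"
    and \<beta>_2_0: "\<And>z vs. z \<in> S \<Longrightarrow> length vs = 2 \<Longrightarrow> pq_part 2 0 (\<beta> z) vs
        = \<beta> z vs"
    and delbar_\<beta>_eq: "\<And>z vs. z \<in> S \<Longrightarrow> length vs = 3 \<Longrightarrow> delbar \<beta> z vs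
        = del \<omega>0 z vs - del (kahler_form g) z vs"
begin

lemma \<beta>_linear:
  assumes z: "z \<in> S" shows "linear (\<lambda>u. \<beta> z [u, v])" "linear (\<lambda>v. \<beta> z [u, v])"
proof -
  have "linear (\<lambda>x. \<beta> z ([u, v][i := x]))" if "i < 2" for i u v
    by (rule \<beta>_alternating[OF z, unfolded alternating_form_def, THEN conjunct1, rule_format]) (simp_all add: that)
  from this[of 0] this[of 1] show "linear (\<lambda>u. \<beta> z [u, v])" "linear (\<lambda>v. \<beta> z [u, v])"
    by simp_all
qed

lemmas \<beta>_simps = linear_simps[OF \<beta>_linear(1)] linear_simps[OF \<beta>_linear(2)]

text \<open>The expansion of the (2,0)-projection relates the four values with J inserted or not; at
  three choices of arguments these relations determine the values.\<close>

lemma \<beta>_J: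
  assumes z: "z \<in> S" shows "\<beta> z [\<i> *s u, v] = \<i> * \<beta> z [u, v]" "\<beta> z [u, \<i> *s v]
      = \<i> * \<beta> z [u, v]"
proof -
  have "\<beta> z [u, v] = (\<beta> z [u, v] - \<i> * \<beta> z [\<i> *s u, v] - \<i> * \<beta> z [u, \<i> *s v]
      - \<beta> z [\<i> *s u, \<i> *s v]) / 4" for u v
    by (subst \<beta>_2_0[OF z, symmetric])
      (simp_all add: numeral_2_eq_2 pq_part_Cons pq_part_Nil clin_def \<beta>_simps z field_simps)
  note eq = this[of u v] this[of "\<i> *s u" v] this[of u "\<i> *s v"]
  have "A1 = \<i> * B \<and> A2 = \<i> * B"
    if "B = (B - \<i> * A1 - \<i> * A2 - A3) / 4" "A1 = (A1 + \<i> * B - \<i> * A3 + A2) / 4"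
      "A2 = (A2 - \<i> * A3 + \<i> * B + A1) / 4" for A1 A2 A3 B
    using that by (simp add: complex_eq_iff)
  from this[of "\<beta> z [u, v]" "\<beta> z [\<i> *s u, v]" "\<beta> z [u, \<i> *s v]" "\<beta> z [\<i> *s u, \<i> *s v]"] eq
  show "\<beta> z [\<i> *s u, v] = \<i> * \<beta> z [u, v]" "\<beta> z [u, \<i> *s v] = \<i> * \<beta> z [u, v]"
    by (simp_all add: \<beta>_simps z)
qed

definition "\<beta>1 z w u v = dir_deriv (\<lambda>y. \<beta> y [u, v]) z w"

lemma C2_\<beta>: "C2_on S (\<lambda>y. \<beta> y [u, v])"
  by (rule smooth_on_imp_C2_on[OF \<beta>_smooth]) simp

lemma \<beta>_diff: "z \<in> S \<Longrightarrow> (\<lambda>y. \<beta> y [u, v]) differentiable (at z)"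
  by (rule C2_onD(1)[OF C2_\<beta>])

lemma \<beta>1_linear:
  assumes z: "z \<in> S"
  shows "linear (\<lambda>w. \<beta>1 z w u v)" "linear (\<lambda>u. \<beta>1 z w u v)" "linear (\<lambda>v. \<beta>1 z w u v)"
  unfolding \<beta>1_def
  by (rule linear_dir_deriv[OF \<beta>_diff[OF z]])
    (rule linear_dir_deriv_family[OF S z] \<beta>_linear \<beta>_diff z | assumption)+

lemmas \<beta>1_simps = linear_simps[OF \<beta>1_linear(1)] linear_simps[OF \<beta>1_linear(2)]
    linear_simps[OF \<beta>1_linear(3)]

lemma \<beta>1_J:
  assumes z: "z \<in> S" shows "\<beta>1 z w (\<i> *s u) v = \<i> * \<beta>1 z w u v" "\<beta>1 z w u (\<i> *s v)
      = \<i> * \<beta>1 z w u v"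
proof -
  have "dir_deriv (\<lambda>y. \<i> * \<beta> y [u, v]) z w = \<i> * dir_deriv (\<lambda>y. \<beta> y [u, v]) z w"
    by (rule dir_deriv_bounded_linear[OF bounded_linear_mult_right \<beta>_diff[OF z]])
  note D = this
  show "\<beta>1 z w (\<i> *s u) v = \<i> * \<beta>1 z w u v"
    unfolding \<beta>1_def D[symmetric] by (rule dir_deriv_cong_open[OF S z \<beta>_J(1)])
  show "\<beta>1 z w u (\<i> *s v) = \<i> * \<beta>1 z w u v"
    unfolding \<beta>1_def D[symmetric] by (rule dir_deriv_cong_open[OF S z \<beta>_J(2)])
qed

text \<open>The map \<open>\<Phi>\<close> is inverse to \<open>X + \<xi> \<mapsto> X - g\<^sup>-\<^sup>1(\<xi> + \<i> \<beta>(X))\<close>. The minus sign makes the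
  Dolbeault operator correspond to the \<open>(0,1)\<close>-part of the metric connection with torsion \<open>+ d\<^sup>c\<omega>\<close>.\<close>

definition \<Phi> :: "complex ^ 'n \<Rightarrow> (complex ^ 'n) \<times> (complex ^ 'n) \<Rightarrow> 'n qvec" where
  "\<Phi> z w = (p10 w, \<chi> k. - hg z (axis k 1) (q01 w) - \<i> * \<beta> z [p10 w, axis k 1])"

lemma linear_\<Phi>: "z \<in> S \<Longrightarrow> linear (\<Phi> z)"
  by (rule linearI)
    (simp_all add: \<Phi>_def pq_add pq_scaleR hg_simps \<beta>_simps vec_eq_iff algebra_simps)

lemma inj_\<Phi>:
  assumes z: "z \<in> S" shows "inj (\<Phi> z)"
proof (rule linear_injective_0[OF linear_\<Phi>[OF z], THEN iffD2], intro allI impI)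
  fix w assume w: "\<Phi> z w = 0"
  then have p: "p10 w = 0" by (simp add: \<Phi>_def prod_eq_iff)
  have "hg z (axis k 1) (q01 w) = 0" for k
    using w p by (simp add: \<Phi>_def prod_eq_iff vec_eq_iff \<beta>_simps z)
  then have "hg z c (q01 w) = hg z c 0" for c
    unfolding hg_expand[OF z, of c, symmetric] by (simp add: hg_simps z)
  then have q: "q01 w = 0" by (rule hg_nondegenerate(2)[OF z])
  have "2 *\<^sub>R fst w = p10 w + q01 w" "2 *\<^sub>R (\<i> *s snd w) = p10 w - q01 w"
    by (simp_all add: p10_def q01_def scaleR_2)
  then have "fst w = 0" "\<i> *s snd w = 0" using p q by simp_all
  then show "w = 0" by (simp add: prod_eq_iff vec_eq_iff)
qed

lemma surj_\<Phi>: "z \<in> S \<Longrightarrow> surj (\<Phi> z)"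
  using linear_injective_imp_surjective[OF linear_\<Phi> inj_\<Phi>] by auto

text \<open>The \<beta>-term of \<open>\<Phi>\<close> is undone by \<open>exp_b\<close>, so no
  \<beta> remains in the metric below.\<close>

lemma exp_b_\<Phi>: "z \<in> S \<Longrightarrow> exp_b (\<beta> z) (\<Phi> z w) = (p10 w, \<chi> k. - hg z (axis k 1) (q01 w))"
  by (simp add: exp_b_def \<Phi>_def comp10_def vec_eq_iff clin_def \<beta>_simps \<beta>_J field_simps)

lemma gen_metric_\<Phi>:
  assumes z: "z \<in> S"
  shows "gen_metric g \<beta> z (\<Phi> z v) (\<Phi> z w) = hg z (p10 v) (p10 w) + hg z (q01 w) (q01 v)"
proof -
  have \<theta>: "cext (form10 (snd (exp_b (\<beta> z) (\<Phi> z w)))) [t] = - hg z (fst t) (q01 w)" for w t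
    unfolding cext_form10 exp_b_\<Phi>[OF z] by (simp add: sum_negf mult.commute flip: hg_expand[OF z, of "fst t"])
  have neg: "cnj_vec (- v) = - cnj_vec v" for v :: "complex ^ 'n" by (simp add: cnj_vec_def vec_eq_iff)
  have 1: "metric_inv g z (\<lambda>t. cext (form10 (snd (exp_b (\<beta> z) (\<Phi> z v)))) [t]) = (0, - cnj_vec (q01 v))"
    by (rule metric_inv_eqI[OF z]) (simp add: \<theta> metric_c_eq[OF z] hg_simps z neg del: cext.simps)
  have 2: "metric_inv g z (cnj_cov (\<lambda>t. cext (form10 (snd (exp_b (\<beta> z) (\<Phi> z w)))) [t])) = (- q01 w, 0)"
    by (rule metric_inv_eqI[OF z])
        (simp add: \<theta> cnj_cov_def cnj_tan_def metric_c_eq[OF z] hg_simps z cnj_hg del: cext.simps)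
  have "fst (\<Phi> z v) = p10 v" for v by (simp add: \<Phi>_def)
  then show ?thesis
    unfolding gen_metric_def cometric_c_def 1 2
    by (simp add: metric_c_eq[OF z] cnj_tan_def hg_simps z neg)
qed

text \<open>The right-hand side is g(v, conj w) for \<open>v = r\<^sub>1 + \<i> r\<^sub>2\<close>
  and \<open>w\<close> likewise: \<open>\<Phi>\<close> is an isometry onto the bundle with the
  metric \<open>G\<close>.\<close>

lemma gen_metric_\<Phi>':
  assumes z: "z \<in> S"
  shows "gen_metric g \<beta> z (\<Phi> z v) (\<Phi> z w) =
    complex_of_real (g z (fst v) (fst w) + g z (snd v) (snd w))
    + \<i> * complex_of_real (g z (snd v) (fst w) - g z (fst v) (snd w))"
  unfolding gen_metric_\<Phi>[OF z]
  by (simp add: p10_def q01_def hg_simps z hg_J_left hg_J_right algebra_simps)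
    (simp add: hg_def z g_J sym[OF z, of "fst w"] sym[OF z, of "snd w"] field_simps)

lemma \<Phi>_cmul:
  assumes z: "z \<in> S" shows "\<Phi> z (cmul c w) = qscale c (\<Phi> z w)"
proof -
  have "hg z v (cnj c *s q) = c * hg z v q" for v q
    unfolding smult_eq[of "cnj c"] by (simp add: hg_simps z hg_J_right complex_eq_iff)
  moreover have "\<beta> z [c *s p, v] = c * \<beta> z [p, v]" for p v
    unfolding smult_eq[of c] by (simp add: \<beta>_simps z \<beta>_J complex_eq_iff)
  ultimately show ?thesis
    by (simp add: \<Phi>_def p10_cmul q01_cmul qscale_def vec_eq_iff algebra_simps)
qed

end

section \<open>The Chern connection\<close>

lemma bounded_linear_snd_axis: "bounded_linear (\<lambda>x::complex. (0 :: complex ^ 'n::finite, axis k x :: complex ^ 'n))"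
proof -
  have "linear (\<lambda>x::complex. (0 :: complex ^ 'n, axis k x :: complex ^ 'n))"
    by (rule linearI) (simp_all add: axis_def vec_eq_iff)
  then show ?thesis by (simp add: linear_conv_bounded_linear)
qed

lemma clin_pure_01: "L 0 = 0 \<Longrightarrow> clin L (0, cnj_vec u) = (L u + \<i> * L (\<i> *s u)) / 2"
  by (simp add: clin_01)

context generalized_chart
begin

lemma C2_\<Phi>: "C2_on S (\<lambda>y. \<Phi> y w)"
proof -
  define \<zeta> where "\<zeta> k y = - 1 * hg y (axis k 1) (q01 w) + - \<i> * \<beta> y [p10 w, axis k 1]" for k y
  have "C2_on S (\<zeta> k)" for k
    unfolding \<zeta>_def by (intro C2_on_add S C2_on_bounded_linear[OF S C2_hg bounded_linear_mult_right]
        C2_on_bounded_linear[OF S C2_\<beta> bounded_linear_mult_right])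
  then have "C2_on S (\<lambda>y. (p10 w, 0) + (\<Sum>k\<in>UNIV. (0, axis k (\<zeta> k y))))"
    by (intro C2_on_add C2_on_sum C2_on_const S C2_on_bounded_linear[OF S _ bounded_linear_snd_axis])
  moreover have "\<Phi> y w = (p10 w, 0) + (\<Sum>k\<in>UNIV. (0, axis k (\<zeta> k y)))" for y
    by (simp add: \<Phi>_def \<zeta>_def prod_eq_iff fst_sum snd_sum vec_eq_iff axis_def if_distrib cong: if_cong)
  ultimately show ?thesis by simp
qed

lemma \<Phi>_diff: "z \<in> S \<Longrightarrow> (\<lambda>y. \<Phi> y w) differentiable (at z)"
  by (rule C2_onD(1)[OF C2_\<Phi>])

lemma dir_deriv_\<Phi>:
  assumes z: "z \<in> S"
  shows "dir_deriv (\<lambda>y. \<Phi> y w) z u = (0, \<chi> k. - hg1 z u (axis k 1) (q01 w) - \<i> * \<beta>1 z u (p10 w)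
      (axis k 1))"
proof (rule prod_eqI)
  note T = dir_deriv_bounded_linear[OF _ \<Phi>_diff[OF z, of w], of _ u]
  show "fst (dir_deriv (\<lambda>y. \<Phi> y w) z u) = fst (0, \<chi> k. - hg1 z u (axis k 1) (q01 w) - \<i> * \<beta>1 z u
      (p10 w) (axis k 1))"
    using T[OF bounded_linear_fst] by (simp add: \<Phi>_def)
  have "snd (dir_deriv (\<lambda>y. \<Phi> y w) z u) $ k = - hg1 z u (axis k 1) (q01 w) - \<i> * \<beta>1 z u (p10 w)
      (axis k 1)" for k
  proof -
    have "snd (dir_deriv (\<lambda>y. \<Phi> y w) z u) $ k = dir_deriv (\<lambda>y. snd (\<Phi> y w) $ k) z u"
      using T[OF bounded_linear_compose[OF bounded_linear_vec_nth bounded_linear_snd], of k] by simp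
    also have "\<dots> = dir_deriv (\<lambda>y. - hg y (axis k 1) (q01 w) - \<i> * \<beta> y [p10 w, axis k 1]) z u"
      by (simp add: \<Phi>_def)
    also have "\<dots> = - hg1 z u (axis k 1) (q01 w) - \<i> * \<beta>1 z u (p10 w) (axis k 1)"
      unfolding \<beta>1_def
      by (rule dir_deriv_eq) (intro has_derivative_diff has_derivative_minus has_derivative_mult_right
          hg_has_derivative has_derivative_dir_deriv \<beta>_diff z)
    finally show ?thesis .
  qed
  then show "snd (dir_deriv (\<lambda>y. \<Phi> y w) z u) = snd (0, \<chi> k. - hg1 z u (axis k 1) (q01 w)
      - \<i> * \<beta>1 z u (p10 w) (axis k 1))"
    by (simp add: vec_eq_iff)
qed

lemma fst_\<Phi>: "fst (\<Phi> z w) = p10 w"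
  and snd_\<Phi>: "snd (\<Phi> z w) $ k = - hg z (axis k 1) (q01 w) - \<i> * \<beta> z [p10 w, axis k 1]"
  by (simp_all add: \<Phi>_def)

definition "\<Psi> z = inv (\<Phi> z)"

lemma \<Phi>_\<Psi> [simp]: "z \<in> S \<Longrightarrow> \<Phi> z (\<Psi> z s) = s"
  unfolding \<Psi>_def by (rule surj_f_inv_f[OF surj_\<Phi>])

lemma \<Psi>_\<Phi> [simp]: "z \<in> S \<Longrightarrow> \<Psi> z (\<Phi> z w) = w"
  unfolding \<Psi>_def by (rule inv_f_f[OF inj_\<Phi>])

lemma \<Phi>_inject: "z \<in> S \<Longrightarrow> \<Phi> z v = \<Phi> z w \<longleftrightarrow> v = w"
  using inj_\<Phi> by (auto dest: injD)

lemma linear_\<Psi>: assumes z: "z \<in> S" shows "linear (\<Psi> z)"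
  by (rule linearI; rule \<Phi>_inject[OF z, THEN iffD1])
    (simp_all add: z linear_add[OF linear_\<Phi>] linear_scale[OF linear_\<Phi>])

lemma \<Psi>_qscale: assumes z: "z \<in> S" shows "\<Psi> z (qscale c s) = cmul c (\<Psi> z s)"
  by (rule \<Phi>_inject[OF z, THEN iffD1]) (simp add: z \<Phi>_cmul)

definition A2 :: "complex ^ 'n \<Rightarrow> complex ^ 'n \<Rightarrow> (complex ^ 'n) \<times>
    (complex ^ 'n) \<Rightarrow> (complex ^ 'n) \<times> (complex ^ 'n)" where
  "A2 z u w = (conn 1 z u (fst w), conn 1 z u (snd w))"

text \<open>The connection \<open>d + A2\<close> transported by \<open>\<Phi>\<close>:
  differentiating \<open>\<Psi> s\<close> inside \<open>\<Phi>\<close> gives the derivative of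
  \<open>s\<close> minus the derivative of \<open>\<Phi>\<close> applied to \<open>\<Psi> s\<close>,
  the correction seen here.\<close>

definition Ac :: "complex ^ 'n \<Rightarrow> complex ^ 'n \<Rightarrow> 'n qvec \<Rightarrow> 'n qvec" where
  "Ac z u s = \<Phi> z (A2 z u (\<Psi> z s)) - dir_deriv (\<lambda>y. \<Phi> y (\<Psi> z s)) z u"

lemma Ac_\<Phi>: "z \<in> S \<Longrightarrow> Ac z u (\<Phi> z w) = \<Phi> z (A2 z u w) - dir_deriv (\<lambda>y. \<Phi> y w) z u"
  by (simp add: Ac_def)

lemma conn_simps:
  assumes "z \<in> S"
  shows "conn e z (u + u') v = conn e z u v + conn e z u' v" "conn e z u (v + v') = conn e z u v + conn e z u v'"
    "conn e z (u - u') v = conn e z u v - conn e z u' v" "conn e z u (v - v') = conn e z u v - conn e z u v'"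
    "conn e z (r *\<^sub>R u) v = r *\<^sub>R conn e z u v" "conn e z u (r *\<^sub>R v) = r *\<^sub>R conn e z u v"
  using bilinear_conn[OF assms, of e]
  by (simp_all add: bilinear_ladd bilinear_radd bilinear_lsub bilinear_rsub bilinear_lmul bilinear_rmul)

lemma bilinear_A2: "z \<in> S \<Longrightarrow> bilinear (A2 z)"
  unfolding bilinear_def A2_def by (intro conjI allI linearI) (simp_all add: conn_simps)

lemma A2_diff: "z \<in> S \<Longrightarrow> (\<lambda>y. A2 y u w) differentiable (at z)"
  unfolding A2_def by (intro differentiable_Pair conn_diff)

lemma linear_dir_deriv_\<Phi>: "z \<in> S \<Longrightarrow> linear (\<lambda>w. dir_deriv (\<lambda>y. \<Phi> y w) z u)"
  by (rule linear_dir_deriv_family[OF S _ linear_\<Phi> \<Phi>_diff])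

lemma bilinear_Ac:
  assumes z: "z \<in> S" shows "bilinear (Ac z)"
proof -
  have l1: "linear (\<lambda>u. A2 z u w)" and l2: "linear (\<lambda>w. A2 z u w)" for u w
    using bilinear_A2[OF z] unfolding bilinear_def by blast+
  show ?thesis
    unfolding bilinear_def Ac_def
    by (intro conjI allI linear_compose_sub linear_compose[OF l1 linear_\<Phi>[OF z], unfolded o_def]
        linear_compose[OF linear_compose[OF linear_\<Psi>[OF z] l2] linear_\<Phi>[OF z], unfolded o_def]
        linear_compose[OF linear_\<Psi>[OF z] linear_dir_deriv_\<Phi>[OF z], unfolded o_def]
        linear_dir_deriv[OF \<Phi>_diff[OF z]])
qed

text \<open>\<open>\<Phi>\<close> carries this family to the differentiable \<open>s\<close>, so the
  lemma on inverse families applies.\<close>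

lemma \<Psi>_diff:
  assumes z: "z \<in> S" and s: "s differentiable (at z)"
  shows "(\<lambda>y. \<Psi> y (s y)) differentiable (at z)"
proof (rule linear_family_inverse_differentiable[OF S z linear_\<Phi> inj_\<Phi>[OF z] \<Phi>_diff[OF z]])
  show "(\<lambda>y. \<Phi> y (\<Psi> y (s y))) differentiable (at z)"
    by (rule differentiable_cong_open[OF S z, THEN iffD2, OF _ s]) simp
qed

lemma Ac_diff:
  assumes z: "z \<in> S" shows "(\<lambda>y. Ac y u s) differentiable (at z)"
proof -
  have \<sigma>: "(\<lambda>y. \<Psi> y s) differentiable (at z)" by (rule \<Psi>_diff[OF z differentiable_const])
  have l2: "linear (\<lambda>w. A2 y u w)" if "y \<in> S" for y
    using bilinear_A2[OF that] unfolding bilinear_def by blast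
  have "(\<lambda>y. A2 y u (\<Psi> y s)) differentiable (at z)"
    by (rule linear_family_differentiable[OF S z l2 A2_diff[OF z] \<sigma>])
  from linear_family_differentiable[OF S z linear_\<Phi> \<Phi>_diff[OF z] this]
  have "(\<lambda>y. \<Phi> y (A2 y u (\<Psi> y s))) differentiable (at z)" .
  moreover have "(\<lambda>y. dir_deriv (\<lambda>x. \<Phi> x (\<Psi> y s)) y u) differentiable (at z)"
    by (rule linear_family_differentiable[OF S z linear_dir_deriv_\<Phi> C2_onD(2)[OF C2_\<Phi> z] \<sigma>])
  ultimately show ?thesis unfolding Ac_def by (rule differentiable_diff)
qed

lemma A2_cmul: "z \<in> S \<Longrightarrow> A2 z u (cmul c w) = cmul c (A2 z u w)"
  by (simp add: A2_def cmul_def conn_simps)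

lemma dir_deriv_\<Phi>_cmul:
  assumes z: "z \<in> S"
  shows "dir_deriv (\<lambda>y. \<Phi> y (cmul c w)) z u = qscale c (dir_deriv (\<lambda>y. \<Phi> y w) z u)"
proof -
  have "dir_deriv (\<lambda>y. \<Phi> y (cmul c w)) z u = dir_deriv (\<lambda>y. qscale c (\<Phi> y w)) z u"
    by (rule dir_deriv_cong_open[OF S z]) (rule \<Phi>_cmul)
  also have "\<dots> = qscale c (dir_deriv (\<lambda>y. \<Phi> y w) z u)"
    by (rule dir_deriv_bounded_linear[OF _ \<Phi>_diff[OF z]])
      (use linear_qscale in \<open>simp add: linear_conv_bounded_linear\<close>)
  finally show ?thesis .
qed

lemma Ac_qscale: "z \<in> S \<Longrightarrow> Ac z u (qscale c s) = qscale c (Ac z u s)"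
  by (simp add: Ac_def \<Psi>_qscale A2_cmul \<Phi>_cmul dir_deriv_\<Phi>_cmul qscale_diff)

section \<open>The (0,1)-part of the transported connection\<close>

lemma ext_d_\<beta>: "ext_d \<beta> z [u, v, x] = \<beta>1 z u v x - \<beta>1 z v u x + \<beta>1 z x u v"
  by (simp add: ext_d_3 \<beta>1_def)

lemma multilinear_ext_d_\<beta>:
  assumes z: "z \<in> S" shows "multilinear 3 (ext_d \<beta> z)"
  unfolding ext_d_\<beta>[abs_def]
  by (intro multilinear_3I linearI; unfold ext_d_\<beta>; simp add: \<beta>1_simps z scaleR_conv_of_real[where 'a
      = complex] algebra_simps)

text \<open>As \<beta> vanishes on (0,1)-vectors, only the derivative along the (0,1)-vector
  survives. That vector stands in the second slot, hence the minus sign.\<close>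

lemma cext_delbar_\<beta>:
  assumes z: "z \<in> S"
  shows "cext (delbar \<beta> z) [(p, 0), (0, cnj_vec u), (c, 0)] = - (\<beta>1 z u p c + \<i> * \<beta>1 z (\<i> *s u) p c) / 2"
proof -
  have "delbar \<beta> z l = pq_part 2 1 (ext_d \<beta> z) l" if "length l = 3" for l
  proof -
    have "multilinear (2 + 0) (\<beta> y)" if "y \<in> S" for y
      using multilinear_2I[of "\<beta> y"] \<beta>_linear[OF that] by simp
    from delbar_pure[of S z 2 0 \<beta> l, OF S z this] show ?thesis
      using \<beta>_2_0 that by simp
  qed
  then have "cext (delbar \<beta> z) [(p, 0), (0, cnj_vec u), (c, 0)] = cext (pq_part 2 1 (ext_d \<beta> z)) [(p, 0),
      (0, cnj_vec u), (c, 0)]"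
    by (intro cext_cong) simp
  also have "\<dots> = cext (ext_d \<beta> z) [(p, 0), (0, cnj_vec u), (c, 0)]"
    by (rule cext_pq_2_1[OF multilinear_ext_d_\<beta>[OF z]])
  also have "\<dots> = - (\<beta>1 z u p c + \<i> * \<beta>1 z (\<i> *s u) p c) / 2"
    by (simp add: clin_def ext_d_\<beta> \<beta>1_simps z \<beta>1_J i_smult_simps field_simps)
  finally show ?thesis .
qed

text \<open>On arguments of these types d\<omega> agrees with \<open>del \<omega>\<close>, so this
  is the contribution of \<open>g\<close> to the extension class of the Dolbeault operator.\<close>

definition "TC z r u c = cext (ext_d \<omega> z) [(r, 0), (0, cnj_vec u), (c, 0)]"

lemma TC_eq:
  assumes z: "z \<in> S"
  shows "TC z r u c = (complex_of_real (T z r u c + T z r (\<i> *s u) (\<i> *s c) - T z (\<i> *s r) u (\<i> *s c) + T z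
      (\<i> *s r) (\<i> *s u) c)
    + \<i> * complex_of_real (T z r (\<i> *s u) c - T z r u (\<i> *s c) - T z (\<i> *s r) u c - T z (\<i> *s r) (\<i> *s u)
        (\<i> *s c))) / 8"
  by (simp add: TC_def clin_def ext_d_\<omega>[OF z] linear_0[OF T_linear(1)[OF z]] linear_0[OF T_linear(2)[OF z]]
      linear_0[OF T_linear(3)[OF z]] field_simps)

lemma TC_linear:
  assumes z: "z \<in> S"
  shows "TC z (r + r') u c = TC z r u c + TC z r' u c" "TC z (\<i> *s r) u c = \<i> * TC z r u c"
  unfolding TC_eq[OF z]
  by (simp_all add: linear_add[OF T_linear(1)[OF z]] linear_neg[OF T_linear(1)[OF z]] complex_eq_iff field_simps)

text \<open>Here the equation for \<open>delbar \<beta>\<close> enters: it exchanges the reference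
  form for data of \<open>g\<close> and \<beta>.\<close>

lemma cext_del_\<omega>0:
  assumes z: "z \<in> S"
  shows "cext (del \<omega>0 z) [(p, 0), (0, cnj_vec u), (c, 0)]
    = TC z p u c - (\<beta>1 z u p c + \<i> * \<beta>1 z (\<i> *s u) p c) / 2"
proof -
  have "cext (del \<omega>0 z) [(p, 0), (0, cnj_vec u), (c, 0)]
    = cext (\<lambda>l. pq_part 2 1 (ext_d \<omega> z) l + delbar \<beta> z l) [(p, 0), (0, cnj_vec u), (c, 0)]"
    by (rule cext_cong) (simp add: delbar_\<beta>_eq[OF z] del_\<omega>[OF z])
  also have "\<dots> = TC z p u c - (\<beta>1 z u p c + \<i> * \<beta>1 z (\<i> *s u) p c) / 2"
    unfolding cext_add cext_pq_2_1[OF multilinear_ext_d_\<omega>[OF z]] cext_delbar_\<beta>[OF z] TC_def by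
        (simp add: field_simps)
  finally show ?thesis .
qed

text \<open>The covector part of the transported connection along \<open>u + \<i> J u\<close>,
  without \<beta>: connection form and derivative of the metric combine to the (2,1)-part of
  d\<omega>. After lowering indices both sides are combinations of first derivatives of
  \<open>g\<close>.\<close>

lemma torsion_identity:
  assumes z: "z \<in> S"
  shows "- hg z c (conn 1 z u r) - \<i> * hg z c (conn 1 z (\<i> *s u) r) + hg1 z u c r + \<i> * hg1 z (\<i> *s u) c r
    = - 2 * \<i> * TC z r u c"
proof -
  have gc: "g z c (conn 1 z u r) = \<Gamma> 1 z u r c" for c u using sym[OF z] g_conn[OF z] by simp
  have gcJ: "g z c (\<i> *s conn 1 z u r) = - \<Gamma> 1 z u r (\<i> *s c)" for c u using gc[of "\<i> *s c" u] g_J[OF z] by simp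
  show ?thesis
    unfolding hg_def hg1_def TC_eq[OF z] gc gcJ
    by (simp add: \<Gamma>_def H_def T_def g1_J z i_smult_simps g1_simps complex_eq_iff
        g1_sym[OF z, of _ r u] g1_sym[OF z, of _ c u] g1_sym[OF z, of _ c r]
        g1_sym[OF z, of _ "\<i> *s c" r] g1_sym[OF z, of _ "\<i> *s c" u] g1_sym[OF z, of _ "\<i> *s r" u] field_simps)
qed

lemma hg1_right:
  assumes z: "z \<in> S"
  shows "hg1 z w u (v - v') = hg1 z w u v - hg1 z w u v'" "hg1 z w u (\<i> *s v) = - \<i> * hg1 z w u v"
  by (simp_all add: hg1_def z g1_simps i_smult_simps field_simps)

text \<open>The vector part is 0 because \<open>conn 1\<close> is complex linear in the direction.
  In the covector part the terms with undifferentiated \<beta> cancel for the same reason, the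
  derivatives of \<beta> form the correction in \<open>cext_del_\<omega>0\<close>, and the rest is
  \<open>torsion_identity\<close>.\<close>

lemma Ac_01:
  assumes z: "z \<in> S"
  shows "Ac z u f + qscale \<i> (Ac z (\<i> *s u) f)
    = (0, \<chi> k. - 2 * \<i> * cext (del \<omega>0 z) [(fst f, 0), (0, cnj_vec u), (axis k 1, 0)])"
proof -
  obtain w where f: "f = \<Phi> z w" using \<Phi>_\<Psi>[OF z] by metis
  have J: "A2 z (\<i> *s u) w = (\<i> *s fst (A2 z u w), \<i> *s snd (A2 z u w))"
    by (simp add: A2_def conn_J_left[OF z])
  have pJ: "p10 (A2 z (\<i> *s u) w) = \<i> *s p10 (A2 z u w)"
    by (simp add: J p10_def i_smult_simps)
  have fst: "fst (Ac z u f + qscale \<i> (Ac z (\<i> *s u) f)) = 0"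
    by (simp add: f Ac_\<Phi>[OF z] dir_deriv_\<Phi>[OF z] fst_\<Phi> pJ qscale_def)
  have snd: "snd (Ac z u f + qscale \<i> (Ac z (\<i> *s u) f)) $ k
    = - 2 * \<i> * cext (del \<omega>0 z) [(fst f, 0), (0, cnj_vec u), (axis k 1, 0)]" for k
  proof -
    let ?c = "axis k 1 :: complex ^ 'n"
    have q: "- hg z ?c (q01 (A2 z u w)) - \<i> * hg z ?c (q01 (A2 z (\<i> *s u) w))
        + hg1 z u ?c (q01 w) + \<i> * hg1 z (\<i> *s u) ?c (q01 w) = - 2 * \<i> * TC z (p10 w) u ?c"
    proof -
      have h: "hg z ?c (q01 (A2 z u w)) = hg z ?c (conn 1 z u (fst w)) + \<i> * hg z ?c (conn 1 z u (snd w))" for u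
        by (simp add: q01_def A2_def hg_simps z hg_J_right)
      have h1: "hg1 z u ?c (q01 w) = hg1 z u ?c (fst w) + \<i> * hg1 z u ?c (snd w)" for u
        by (simp add: q01_def hg1_right z)
      have t: "TC z (p10 w) u ?c = TC z (fst w) u ?c + \<i> * TC z (snd w) u ?c"
        by (simp add: p10_def TC_linear z)
      \<comment> \<open>\<open>torsion_identity\<close> holds for a single tangent vector; it is
        used for both components of \<open>w\<close> and recombined with the scalar i.\<close>
      have comb: "- (a1 + \<i> * a2) - \<i> * (b1 + \<i> * b2) + (c1 + \<i> * c2) + \<i> * (d1 + \<i> * d2) = - 2 * \<i> *
          (t1 + \<i> * t2)"
        if "- a1 - \<i> * b1 + c1 + \<i> * d1 = - 2 * \<i> * t1" "- a2 - \<i> * b2 + c2 + \<i> * d2 = - 2 * \<i> * t2"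
        for a1 a2 b1 b2 c1 c2 d1 d2 t1 t2
        using that by algebra
      show ?thesis
        unfolding h h1 t by (rule comb[OF torsion_identity[OF z] torsion_identity[OF z]])
    qed
    have b: "\<beta> z [p10 (A2 z (\<i> *s u) w), ?c] = \<i> * \<beta> z [p10 (A2 z u w), ?c]"
      by (simp add: pJ \<beta>_J z)
    have comb: "- qa - \<i> * b - (- ha - \<i> * be) + \<i> * (- qb - \<i> * (\<i> * b) - (- hb - \<i> * be'))
        = - 2 * \<i> * (t - (be + \<i> * be') / 2)"
      if "- qa - \<i> * qb + ha + \<i> * hb = - 2 * \<i> * t" for qa qb ha hb t b be be'
      using that by (simp add: field_simps) algebra
    have "snd (Ac z u f + qscale \<i> (Ac z (\<i> *s u) f)) $ k =
      - hg z ?c (q01 (A2 z u w)) - \<i> * \<beta> z [p10 (A2 z u w), ?c] - (- hg1 z u ?c (q01 w) - \<i> * \<beta>1 z u (p10 w) ?c)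
      + \<i> * (- hg z ?c (q01 (A2 z (\<i> *s u) w)) - \<i> * (\<i> * \<beta> z [p10 (A2 z u w), ?c])
        - (- hg1 z (\<i> *s u) ?c (q01 w) - \<i> * \<beta>1 z (\<i> *s u) (p10 w) ?c))"
      by (simp add: f Ac_\<Phi>[OF z] dir_deriv_\<Phi>[OF z] snd_\<Phi> qscale_def b algebra_simps)
    also have "\<dots> = - 2 * \<i> * (TC z (p10 w) u ?c - (\<beta>1 z u (p10 w) ?c + \<i> * \<beta>1 z (\<i> *s u)
        (p10 w) ?c) / 2)"
      by (rule comb[OF q])
    also have "\<dots> = - 2 * \<i> * cext (del \<omega>0 z) [(fst f, 0), (0, cnj_vec u), (?c, 0)]"
      unfolding cext_del_\<omega>0[OF z] by (simp add: f fst_\<Phi>)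
    finally show ?thesis .
  qed
  show ?thesis by (rule prod_eqI) (use fst snd in \<open>simp_all add: vec_eq_iff\<close>)
qed

lemma qclin_Ac_01:
  assumes z: "z \<in> S"
  shows "qclin (\<lambda>u. Ac z u f) (0, b) = (0, \<chi> k. - \<i> * cext (del \<omega>0 z) [(fst f, 0), (0, b), (axis k 1, 0)])"
  unfolding qclin_01[where L = "\<lambda>u. Ac z u f", OF bilinear_lzero[OF bilinear_Ac[OF z]]] Ac_01[OF z] cnj_vec_cnj_vec
  by (simp add: qscale_def vec_eq_iff del: cext.simps)

section \<open>The metric and the Dolbeault operator characterise the connection\<close>

lemma gen_metric_eq:
  assumes z: "z \<in> S"
  shows "gen_metric g \<beta> z s t =
    complex_of_real (g z (fst (\<Psi> z s)) (fst (\<Psi> z t)) + g z (snd (\<Psi> z s)) (snd (\<Psi> z t)))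
    + \<i> * complex_of_real (g z (snd (\<Psi> z s)) (fst (\<Psi> z t)) - g z (fst (\<Psi> z s)) (snd (\<Psi> z t)))"
  using gen_metric_\<Phi>'[OF z, of "\<Psi> z s" "\<Psi> z t"] by (simp add: z)

lemma gen_metric_simps:
  assumes z: "z \<in> S"
  shows "gen_metric g \<beta> z (s + s') t = gen_metric g \<beta> z s t + gen_metric g \<beta> z s' t"
    "gen_metric g \<beta> z (s - s') t = gen_metric g \<beta> z s t - gen_metric g \<beta> z s' t"
    "gen_metric g \<beta> z s (t - t') = gen_metric g \<beta> z s t - gen_metric g \<beta> z s t'"
    "gen_metric g \<beta> z (qscale c s) t = c * gen_metric g \<beta> z s t"
    "gen_metric g \<beta> z s (qscale c t) = cnj c * gen_metric g \<beta> z s t"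
    "gen_metric g \<beta> z 0 t = 0"
  unfolding gen_metric_eq[OF z]
  by (simp_all add: z linear_simps[OF linear_\<Psi>[OF z]] \<Psi>_qscale cmul_def g_simps complex_eq_iff algebra_simps)

lemma gen_metric_definite:
  assumes z: "z \<in> S" and s: "gen_metric g \<beta> z s s = 0"
  shows "s = 0"
proof -
  have nn: "g z v v \<ge> 0" for v using pos[OF z, of v] by (cases "v = 0") (auto simp: g_simps z)
  have "g z (fst (\<Psi> z s)) (fst (\<Psi> z s)) + g z (snd (\<Psi> z s)) (snd (\<Psi> z s)) = 0"
    using s by (simp add: gen_metric_eq[OF z] complex_eq_iff)
  then have "g z (fst (\<Psi> z s)) (fst (\<Psi> z s)) = 0" "g z (snd (\<Psi> z s)) (snd (\<Psi> z s)) = 0"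
    using nn by (simp_all add: add_nonneg_eq_0_iff)
  then have "fst (\<Psi> z s) = 0" "snd (\<Psi> z s) = 0" using pos[OF z] by (metis less_irrefl)+
  then have "\<Psi> z s = 0" by (simp add: prod_eq_iff)
  then have "\<Phi> z (\<Psi> z s) = 0" by (simp add: linear_0[OF linear_\<Phi>[OF z]])
  then show ?thesis by (simp add: z)
qed

lemma gen_metric_sum: "z \<in> S \<Longrightarrow> gen_metric g \<beta> z (\<Sum>i\<in>I. s i) t =
    (\<Sum>i\<in>I. gen_metric g \<beta> z (s i) t)"
  by (induction I rule: infinite_finite_induct) (simp_all add: gen_metric_simps)

lemma gen_metric_qclin: "z \<in> S \<Longrightarrow> gen_metric g \<beta> z (qclin L w) t = clin
    (\<lambda>u. gen_metric g \<beta> z (L u) t) w"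
  by (simp add: qclin_def clin_def gen_metric_simps del: qscale_qscale)

end

lemma qclin_add: "qclin (\<lambda>u. L u + K u) w = qclin L w + qclin K w"
  by (simp add: qclin_def qscale_add qscale_diff algebra_simps)

lemma form10_1: "form10 \<xi> [v] = (\<Sum>k\<in>UNIV. \<xi> $ k * v $ k)"
  by (simp add: form10_def)

lemma cext_delbar_form10:
  fixes \<xi> :: "complex ^ 'n::finite \<Rightarrow> complex ^ 'n"
  assumes \<xi>: "\<xi> differentiable (at z)"
  shows "cext (delbar (\<lambda>y. form10 (\<xi> y)) z) [(0, cnj_vec u), (c, 0)]
    = (\<Sum>k\<in>UNIV. (dir_deriv \<xi> z u $ k + \<i> * dir_deriv \<xi> z (\<i> *s u) $ k) / 2 * c $ k)"
proof -
  let ?\<alpha> = "\<lambda>y. form10 (\<xi> y)"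
  define B where "B u v = (\<Sum>k\<in>UNIV. dir_deriv \<xi> z u $ k * v $ k)" for u v
  have B2: "linear (B u)" for u
    unfolding B_def by (rule linearI) (simp_all add: sum.distrib scaleR_sum_right algebra_simps)
  have lD: "linear (dir_deriv \<xi> z)" by (rule linear_dir_deriv[OF \<xi>])
  have B1: "linear (\<lambda>u. B u v)" for v
    unfolding B_def by (rule linearI) (simp_all add: linear_simps[OF lD] sum.distrib scaleR_sum_right algebra_simps)
  have BJ: "B u (\<i> *s v) = \<i> * B u v" for u v
    by (simp add: B_def sum_distrib_left algebra_simps)
  have D: "dir_deriv (\<lambda>y. form10 (\<xi> y) [v]) z u = B u v" for u v
  proof -
    have "bounded_linear (\<lambda>x::complex ^ 'n. \<Sum>k\<in>UNIV. x $ k * v $ k)"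
      by (intro bounded_linear_sum bounded_linear_compose[OF bounded_linear_mult_left bounded_linear_vec_nth])
    from dir_deriv_bounded_linear[OF this \<xi>] show ?thesis by (simp add: form10_1 B_def)
  qed
  have ext: "ext_d ?\<alpha> z [u, v] = B u v - B v u" for u v
    by (simp add: ext_d_def D numeral_2_eq_2)
  have m: "multilinear 2 (ext_d ?\<alpha> z)"
    by (rule multilinear_2I; unfold ext; intro linear_compose_sub B1 B2)
  have "delbar ?\<alpha> z l = pq_part 1 1 (ext_d ?\<alpha> z) l" if "length l = 2" for l
  proof -
    have m1: "multilinear (1 + 0) (?\<alpha> y)" for y
      by (simp add: form10_1) (intro linearI; simp add: sum.distrib scaleR_sum_right algebra_simps)
    have pq: "pq_part 1 0 (?\<alpha> y) l = ?\<alpha> y l" if l1: "length l = 1 + 0" for y l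
    proof -
      obtain v where l: "l = [v]" using l1 by (cases l) auto
      show ?thesis using cext_form10[of "\<xi> y" "(v, 0)"] by (simp add: l pq_part_Cons pq_part_Nil form10_1)
    qed
    show ?thesis
      using delbar_pure[of UNIV z 1 0 ?\<alpha> l, OF open_UNIV UNIV_I m1 pq] that by simp
  qed
  then have "cext (delbar ?\<alpha> z) [(0, cnj_vec u), (c, 0)] = cext (pq_part 1 1 (ext_d ?\<alpha> z)) [(0, cnj_vec u), (c, 0)]"
    by (intro cext_cong) simp
  also have "\<dots> = cext (ext_d ?\<alpha> z) [(0, cnj_vec u), (c, 0)]" by (rule cext_pq_1_1[OF m])
  also have "\<dots> = (B u c + \<i> * B (\<i> *s u) c) / 2"
    by (simp add: clin_def ext linear_0[OF B1] linear_0[OF B2] BJ field_simps)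
  also have "\<dots> = (\<Sum>k\<in>UNIV. (dir_deriv \<xi> z u $ k + \<i> * dir_deriv \<xi> z (\<i> *s u) $ k) / 2 * c $ k)"
    by (simp add: B_def sum_distrib_left sum_divide_distrib flip: sum.distrib) (simp add: field_simps)
  finally show ?thesis .
qed

text \<open>In the frame of coordinate vectors and differentials the operator is the flat one plus a
  zero-order term. That term is what \<open>qclin_Ac_01\<close> finds for \<open>Ac\<close>.\<close>

lemma dolbeault_Q_eq:
  fixes s :: "complex ^ 'n::finite \<Rightarrow> 'n qvec"
  assumes s: "s differentiable (at z)"
  shows "dolbeault_Q \<omega>0 s z (cnj_vec u) = qclin (dir_deriv s z) (0, cnj_vec u)
    + (0, \<chi> k. - \<i> * cext (del \<omega>0 z) [(fst (s z), 0), (0, cnj_vec u), (axis k 1, 0)])"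
proof (rule prod_eqI)
  have l0: "dir_deriv s z 0 = 0" by (rule linear_0[OF linear_dir_deriv[OF s]])
  have dfst: "dir_deriv (\<lambda>y. fst (s y) $ k) z v = fst (dir_deriv s z v) $ k" for k v
    using dir_deriv_bounded_linear[OF bounded_linear_compose[OF bounded_linear_vec_nth bounded_linear_fst] s] by simp
  have dsnd: "dir_deriv (\<lambda>y. snd (s y)) z v = snd (dir_deriv s z v)" for v
    by (rule dir_deriv_bounded_linear[OF bounded_linear_snd s])
  have sd: "(\<lambda>y. snd (s y)) differentiable (at z)" by (rule differentiable_bounded_linear[OF bounded_linear_snd s])
  show "fst (dolbeault_Q \<omega>0 s z (cnj_vec u)) = fst (qclin (dir_deriv s z) (0, cnj_vec u)
    + (0, \<chi> k. - \<i> * cext (del \<omega>0 z) [(fst (s z), 0), (0, cnj_vec u), (axis k 1, 0)]))"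
    by (simp add: dolbeault_Q_def vec_eq_iff clin_pure_01 dfst[abs_def] qclin_01 l0 qscale_def)
  have ax: "(\<Sum>k\<in>UNIV. (snd (dir_deriv s z u) $ k + \<i> * snd (dir_deriv s z (\<i> *s u)) $ k) / 2 * axis i 1 $ k)
    = (snd (dir_deriv s z u) $ i + \<i> * snd (dir_deriv s z (\<i> *s u)) $ i) / 2" for i
    by (simp add: axis_def if_distrib cong: if_cong)
  show "snd (dolbeault_Q \<omega>0 s z (cnj_vec u)) = snd (qclin (dir_deriv s z) (0, cnj_vec u)
    + (0, \<chi> k. - \<i> * cext (del \<omega>0 z) [(fst (s z), 0), (0, cnj_vec u), (axis k 1, 0)]))"
    unfolding dolbeault_Q_def snd_conv cext_delbar_form10[OF sd] dsnd ax
    by (simp add: vec_eq_iff qclin_01 l0 qscale_def del: cext.simps)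
qed

context generalized_chart
begin

lemma cov_Ac:
  assumes z: "z \<in> S" and s: "s differentiable (at z)"
  shows "cov (\<lambda>_. Ac z) (\<lambda>_. u) s z = \<Phi> z (dir_deriv (\<lambda>y. \<Psi> y (s y)) z u + A2 z u
      (\<Psi> z (s z)))"
proof -
  have "dir_deriv s z u = dir_deriv (\<lambda>y. \<Phi> y (\<Psi> y (s y))) z u"
    by (rule dir_deriv_cong_open[OF S z]) simp
  also have "\<dots> = dir_deriv (\<lambda>y. \<Phi> y (\<Psi> z (s z))) z u + \<Phi> z (dir_deriv (\<lambda>y. \<Psi> y
      (s y)) z u)"
    by (rule linear_family_dir_deriv[OF S z linear_\<Phi> \<Phi>_diff[OF z] \<Psi>_diff[OF z s]])
  finally show ?thesis by (simp add: cov_def Ac_def linear_add[OF linear_\<Phi>[OF z]])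
qed

text \<open>Through \<open>\<Psi>\<close> the metric consists of four real pairings by
  \<open>g\<close>, and compatibility of \<open>conn 1\<close> with \<open>g\<close> applies to
  each.\<close>

lemma Ac_metric:
  assumes z: "z \<in> S" and s: "s differentiable (at z)" and t: "t differentiable (at z)"
  shows "dir_deriv (\<lambda>y. gen_metric g \<beta> y (s y) (t y)) z u =
    gen_metric g \<beta> z (cov (\<lambda>_. Ac z) (\<lambda>_. u) s z) (t z) + gen_metric g \<beta> z (s z) (cov
        (\<lambda>_. Ac z) (\<lambda>_. u) t z)"
proof -
  define v where "v y = \<Psi> y (s y)" for y
  define w where "w y = \<Psi> y (t y)" for y
  have v: "v differentiable (at z)" and w: "w differentiable (at z)"
    unfolding v_def w_def by (rule \<Psi>_diff[OF z s] \<Psi>_diff[OF z t])+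
  have d: "(\<lambda>y. g y (X (a y)) (Y (b y))) differentiable (at z)"
    and D: "dir_deriv (\<lambda>y. g y (X (a y)) (Y (b y))) z u
      = g1 z u (X (a z)) (Y (b z)) + g z (X (dir_deriv a z u)) (Y (b z)) + g z (X (a z)) (Y (dir_deriv b z u))"
    if "bounded_linear X" "bounded_linear Y" "a differentiable (at z)" "b differentiable (at z)"
    for X Y :: "(complex ^ 'n) \<times> (complex ^ 'n) \<Rightarrow> complex ^ 'n" and a b
  proof -
    have X: "(\<lambda>y. X (a y)) differentiable (at z)" and Y: "(\<lambda>y. Y (b y)) differentiable (at z)"
      using that by (auto intro: differentiable_bounded_linear)
    have "(\<lambda>y. g y v (Y (b y))) differentiable (at z)" for v
      by (rule linear_family_differentiable[OF S z g_linear(2) g_diff[OF z] Y])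
    from linear_family_differentiable[where B = "\<lambda>y v. g y v (Y (b y))", OF S z g_linear(1) this X]
    show "(\<lambda>y. g y (X (a y)) (Y (b y))) differentiable (at z)" .
    show "dir_deriv (\<lambda>y. g y (X (a y)) (Y (b y))) z u
      = g1 z u (X (a z)) (Y (b z)) + g z (X (dir_deriv a z u)) (Y (b z)) + g z (X (a z)) (Y (dir_deriv b z u))"
      using dir_deriv_g[OF z X Y, of u] that by (simp add: dir_deriv_bounded_linear)
  qed
  note bl = bounded_linear_fst bounded_linear_snd
  have "dir_deriv (\<lambda>y. gen_metric g \<beta> y (s y) (t y)) z u
    = dir_deriv (\<lambda>y. 1 * complex_of_real (g y (fst (v y)) (fst (w y))) + 1 * complex_of_real (g y (snd (v y)) (snd (w y)))
      + (\<i> * complex_of_real (g y (snd (v y)) (fst (w y))) - \<i> * complex_of_real (g y (fst (v y)) (snd (w y))))) z u"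
    by (rule dir_deriv_cong_open[OF S z]) (simp add: gen_metric_eq v_def w_def algebra_simps)
  also have "\<dots> = 1 * complex_of_real (dir_deriv (\<lambda>y. g y (fst (v y)) (fst (w y))) z u)
    + 1 * complex_of_real (dir_deriv (\<lambda>y. g y (snd (v y)) (snd (w y))) z u)
    + (\<i> * complex_of_real (dir_deriv (\<lambda>y. g y (snd (v y)) (fst (w y))) z u)
      - \<i> * complex_of_real (dir_deriv (\<lambda>y. g y (fst (v y)) (snd (w y))) z u))"
    by (rule dir_deriv_eq) (intro has_derivative_add has_derivative_diff has_derivative_mult_right has_derivative_of_real'
        has_derivative_dir_deriv d[OF _ _ v w] bl)
  finally show ?thesis
    unfolding cov_Ac[OF z s] cov_Ac[OF z t] D[OF bl(1) bl(1) v w] D[OF bl(2) bl(2) v w] D[OF bl(2) bl(1) v w] D[OF bl(1) bl(2) v w]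
      conn_metric[OF z, of _ _ _ 1] gen_metric_eq[OF z] \<Psi>_\<Phi>[OF z]
    by (simp add: A2_def g_simps z flip: v_def w_def)
        (simp add: v_def[symmetric, abs_def] w_def[symmetric, abs_def] algebra_simps)
qed

text \<open>For uniqueness consider the difference \<open>D\<close> of two candidates. Equal
  (0,1)-parts make it complex linear in the direction, metric compatibility makes each
  \<open>D u\<close> skew-Hermitian, and these two properties exclude each other unless
  \<open>D = 0\<close>.\<close>

lemma chern_eq:
  assumes z: "z \<in> S"
  shows "chern (dolbeault_Q \<omega>0) (gen_metric g \<beta>) z = Ac z"
  unfolding chern_def
proof (rule the_equality, goal_cases)
  case 1
  show ?case
  proof (intro conjI allI impI)
    show "bilinear (Ac z)" by (rule bilinear_Ac[OF z])
    show "Ac z u (qscale c f) = qscale c (Ac z u f)" for u c f by (rule Ac_qscale[OF z])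
    show "qclin (\<lambda>u. cov (\<lambda>_. Ac z) (\<lambda>_. u) s z) (0, b) = dolbeault_Q \<omega>0 s z b"
      if s: "s differentiable (at z)" for s b
    proof -
      show ?thesis
        using dolbeault_Q_eq[OF s, of \<omega>0 "cnj_vec b"] qclin_Ac_01[OF z, of "s z" b]
        unfolding cov_def qclin_add cnj_vec_cnj_vec by simp
    qed
    show "dir_deriv (\<lambda>y. gen_metric g \<beta> y (s y) (t y)) z u =
        gen_metric g \<beta> z (cov (\<lambda>_. Ac z) (\<lambda>_. u) s z) (t z) + gen_metric g \<beta> z (s z) (cov
            (\<lambda>_. Ac z) (\<lambda>_. u) t z)"
      if "s differentiable (at z)" "t differentiable (at z)" for s t u
      by (rule Ac_metric[OF z that])
  qed
next
  case (2 A)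
  show "A = Ac z"
  proof (intro ext)
    fix u f
    define D where "D u = (\<lambda>f. A u f - Ac z u f)" for u
    have A01: "qclin (\<lambda>u. A u f) (0, b) = qclin (\<lambda>u. Ac z u f) (0, b)" for f b
    proof -
      have "qclin (\<lambda>u. cov (\<lambda>_. A) (\<lambda>_. u) (\<lambda>_. f) z) (0, b) = dolbeault_Q \<omega>0
          (\<lambda>_. f) z b"
        using 2 by (blast intro: differentiable_const)
      moreover have "qclin (\<lambda>u. Ac z u f) (0, b) = dolbeault_Q \<omega>0 (\<lambda>_. f) z b"
        using dolbeault_Q_eq[OF differentiable_const, of \<omega>0 f z "cnj_vec b"] qclin_Ac_01[OF z, of f b]
        by (simp add: qclin_01 qscale_def del: cext.simps)
      ultimately show ?thesis by (simp add: cov_def)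
    qed
    have A0: "A 0 f = 0" for f using 2 bilinear_lzero by blast
    have DJ: "D (\<i> *s u) f = qscale \<i> (D u f)" for u f
    proof -
      have "qscale 2 (qclin (\<lambda>u. A u f) (0, cnj_vec u)) = qscale 2 (qclin (\<lambda>u. Ac z u f) (0, cnj_vec u))"
        by (simp only: A01)
      then have "A u f + qscale \<i> (A (\<i> *s u) f) = Ac z u f + qscale \<i> (Ac z (\<i> *s u) f)"
        by (simp add: qclin_01 A0 bilinear_lzero[OF bilinear_Ac[OF z]])
      then have "D u f + qscale \<i> (D (\<i> *s u) f) = 0" by (simp add: D_def qscale_diff algebra_simps)
      then have "qscale \<i> (D u f + qscale \<i> (D (\<i> *s u) f)) = qscale \<i> 0" by simp
      moreover have "qscale (- 1) s = - s" for s :: "'n qvec" by (simp add: qscale_def prod_eq_iff vec_eq_iff)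
      ultimately show ?thesis by (simp add: qscale_add)
    qed
    have Dh: "gen_metric g \<beta> z (D u f) t = - gen_metric g \<beta> z f (D u t)" for u f t
    proof -
      have "dir_deriv (\<lambda>y. gen_metric g \<beta> y f t) z u = gen_metric g \<beta> z (A u f) t
          + gen_metric g \<beta> z f (A u t)"
        using 2[THEN conjunct2, THEN conjunct2, THEN conjunct2, rule_format, of "\<lambda>_. f" "\<lambda>_. t" u] by
            (simp add: cov_def)
      moreover have "dir_deriv (\<lambda>y. gen_metric g \<beta> y f t) z u = gen_metric g \<beta> z (Ac z u f) t
          + gen_metric g \<beta> z f (Ac z u t)"
        using Ac_metric[OF z, of "\<lambda>_. f" "\<lambda>_. t" u] by (simp add: cov_def)
      ultimately have "gen_metric g \<beta> z (A u f) t + gen_metric g \<beta> z f (A u t)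
        = gen_metric g \<beta> z (Ac z u f) t + gen_metric g \<beta> z f (Ac z u t)" by simp
      then show ?thesis by (simp add: D_def gen_metric_simps z algebra_simps)
    qed
    \<comment> \<open>Skewness in direction \<open>\<i> *s u\<close> gives, after pulling out the
      scalar (conjugated in the second slot), that \<open>D u\<close> is also Hermitian.\<close>
    have "gen_metric g \<beta> z (D u f) t = 0" for t
    proof -
      have "gen_metric g \<beta> z (D (\<i> *s u) f) t = - gen_metric g \<beta> z f (D (\<i> *s u) t)" by (rule Dh)
      then have "\<i> * gen_metric g \<beta> z (D u f) t = \<i> * gen_metric g \<beta> z f (D u t)"
        by (simp add: DJ gen_metric_simps z)
      then show ?thesis using Dh[of u f t] by simp
    qed
    then have "D u f = 0" by (rule gen_metric_definite[OF z])
    then show "A u f = Ac z u f" by (simp add: D_def)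
  qed
qed

section \<open>Curvature of the Chern connection and its trace\<close>

lemma dH_0: "z \<in> S \<Longrightarrow> dH z u v x t = 0"
  by (rule dH_eq_0) (use closed in auto)

lemma g_curv_pair:
  assumes z: "z \<in> S"
  shows "g z (curv (conn 1) z X Y Z) W = g z (curv (conn (- 1)) z Z W X) Y"
  using Rm_pair[OF z dH_0[OF z]] by (simp add: g_curv z)

text \<open>By the pair symmetry the first direction of the Bismut curvature becomes the argument of
  the other curvature, where \<open>curv_linear\<close> holds, and the second becomes a slot of
  \<open>g\<close>.\<close>

lemma linear_curv:
  assumes z: "z \<in> S"
  shows "linear (\<lambda>X. curv (conn (- 1)) z X Y Z)" "linear (\<lambda>Y. curv (conn (- 1)) z X Y Z)"
  by (rule linearI; rule nondegenerate[OF z];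
      simp add: g_simps z flip: g_curv_pair[OF z]; simp add: linear_simps[OF curv_linear[OF z]] g_simps z)+

definition "\<rho> z u v = Re (bismut_ricci g z [u, v])"

lemma bismut_ricci_\<rho>: "bismut_ricci g z [u, v] = complex_of_real (\<rho> z u v)"
  by (simp add: \<rho>_def bismut_ricci_def)

lemma \<rho>_eq: "z \<in> S \<Longrightarrow> \<rho> z u v = - (\<Sum>i\<in>UNIV. Im (curv (conn (- 1)) z u v (axis i 1) $ i))"
  using bismut_ricci_eq[of z u v] by (simp add: bismut_ricci_\<rho> complex_eq_iff)

lemma \<rho>_linear:
  assumes z: "z \<in> S" shows "linear (\<lambda>u. \<rho> z u v)" "linear (\<lambda>v. \<rho> z u v)"
  unfolding \<rho>_eq[OF z]
  by (rule linearI; simp add: linear_simps[OF linear_curv(1)[OF z]] linear_simps[OF linear_curv(2)[OF z]]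
      sum.distrib sum_distrib_left)+

lemmas \<rho>_simps = linear_simps[OF \<rho>_linear(1)] linear_simps[OF \<rho>_linear(2)]

text \<open>The real endomorphism obtained by raising an index of the Bismut-Ricci form; its
  complex-linear extension is what the second Ricci curvature turns out to be, up to -i.\<close>

definition "P z u = raise z (\<rho> z u)"

lemma g_P: "z \<in> S \<Longrightarrow> g z (P z u) x = \<rho> z u x"
  unfolding P_def by (rule g_raise[OF _ \<rho>_linear(2)])

lemma linear_P: assumes z: "z \<in> S" shows "linear (P z)"
  by (rule linearI; rule nondegenerate[OF z]) (simp_all add: g_P z g_simps \<rho>_simps)

lemmas P_simps = linear_simps[OF linear_P]

lemma curv_A2:
  assumes z: "z \<in> S"
  shows "curv A2 z u v w = (curv (conn 1) z u v (fst w), curv (conn 1) z u v (snd w))"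
proof -
  have "dir_deriv (\<lambda>y. A2 y v w) z u = (dir_deriv (\<lambda>y. conn 1 y v (fst w)) z u, dir_deriv
      (\<lambda>y. conn 1 y v (snd w)) z u)" for u v
    unfolding A2_def by (rule dir_deriv_eq) (intro has_derivative_Pair has_derivative_dir_deriv conn_diff z)
  then show ?thesis
    unfolding curv_eq[of A2, OF bilinear_A2[OF z]] curv_eq[of "conn 1", OF bilinear_conn[OF z]]
    by (simp add: A2_def)
qed

lemma curv_chern:
  assumes z: "z \<in> S"
  shows "curv (chern (dolbeault_Q \<omega>0) (gen_metric g \<beta>)) z u v (\<Phi> z w)
    = \<Phi> z (curv (conn 1) z u v (fst w), curv (conn 1) z u v (snd w))"
proof -
  let ?A = "chern (dolbeault_Q \<omega>0) (gen_metric g \<beta>)"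
  have "dir_deriv (\<lambda>y. ?A y v s) z u = dir_deriv (\<lambda>y. Ac y v s) z u" for u v s
    by (rule dir_deriv_cong_open[OF S z]) (simp add: chern_eq)
  then have "curv ?A z u v (\<Phi> z w) = curv Ac z u v (\<Phi> z w)"
    using bilinear_Ac[OF z] by (simp add: curv_eq chern_eq[OF z])
  also have "\<dots> = \<Phi> z (curv A2 z u v w)"
    by (rule curv_gauge[where E
        = \<Phi>, OF S z linear_\<Phi> C2_\<Phi> bilinear_A2 A2_diff[OF z] bilinear_Ac Ac_diff[OF z] Ac_\<Phi>])
  finally show ?thesis by (simp only: curv_A2[OF z])
qed

text \<open>Real test vectors suffice: the real part of the pairing sees the first component and the
  imaginary part the second.\<close>

lemma gen_metric_eqI:
  assumes z: "z \<in> S" and eq: "\<And>x. gen_metric g \<beta> z s (\<Phi> z (x, 0)) = gen_metric g \<beta> z t (\<Phi> z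
      (x, 0))"
  shows "s = t"
proof -
  have "g z (fst (\<Psi> z s)) x = g z (fst (\<Psi> z t)) x" "g z (snd (\<Psi> z s)) x = g z (snd (\<Psi> z t)) x" for x
    using eq[of x] by (simp_all add: gen_metric_eq z g_simps complex_eq_iff)
  then have "fst (\<Psi> z s) = fst (\<Psi> z t)" "snd (\<Psi> z s) = snd (\<Psi> z t)"
    using nondegenerate[OF z] by blast+
  then have "\<Psi> z s = \<Psi> z t" by (rule prod_eqI)
  then have "\<Phi> z (\<Psi> z s) = \<Phi> z (\<Psi> z t)" by simp
  then show ?thesis by (simp add: z)
qed

lemma second_ricci_\<Phi>:
  assumes z: "z \<in> S"
  shows "second_ricci g (dolbeault_Q \<omega>0) (gen_metric g \<beta>) z (\<Phi> z w) = qscale (- \<i>) (\<Phi> z (P z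
      (fst w), P z (snd w)))"
proof (rule gen_metric_eqI[OF z])
  fix x
  let ?L = "\<lambda>r. curv (conn (- 1)) z r x"
  let ?c = "\<lambda>r i j. clin (\<lambda>u. clin (\<lambda>v. complex_of_real (g z (?L r u) v)) (0, axis j 1)) (axis i 1, 0)"
  have h: "gen_metric g \<beta> z (\<Phi> z (curv (conn 1) z u v (fst w), curv (conn 1) z u v (snd w))) (\<Phi> z (x, 0))
    = complex_of_real (g z (?L (fst w) u) v) + \<i> * complex_of_real (g z (?L (snd w) u) v)" for u v
    \<comment> \<open>The pair symmetry moves the directions \<open>u\<close>, \<open>v\<close> into
      the argument and test slots of the Bismut curvature at \<open>(w, x)\<close>, so that
      contracting them takes the complex trace of an endomorphism.\<close>
    by (simp add: gen_metric_\<Phi>' z g_simps g_curv_pair)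
  have "gen_metric g \<beta> z (second_ricci g (dolbeault_Q \<omega>0) (gen_metric g \<beta>) z (\<Phi> z w)) (\<Phi> z (x, 0))
    = (\<Sum>i\<in>UNIV. \<Sum>j\<in>UNIV. matrix_inv (herm_matrix g z) $ j $ i * (?c (fst w) i j + \<i> * ?c (snd w) i j))"
    unfolding second_ricci_def
    by (simp add: gen_metric_sum gen_metric_simps gen_metric_qclin z curv_chern h clin_add clin_mult)
  also have "\<dots> = (\<Sum>i\<in>UNIV. \<Sum>j\<in>UNIV. matrix_inv (herm_matrix g z) $ j $ i * ?c (fst w) i j)
    + \<i> * (\<Sum>i\<in>UNIV. \<Sum>j\<in>UNIV. matrix_inv (herm_matrix g z) $ j $ i * ?c (snd w) i j)"
    by (simp add: distrib_left sum.distrib sum_distrib_left mult.left_commute)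
  also have "\<dots> = - \<i> * bismut_ricci g z [fst w, x] + \<i> * (- \<i> * bismut_ricci g z [snd w, x])"
    by (simp only: trace_herm_matrix[OF z curv_linear[OF z] curv_J[OF z]] bismut_ricci_eq[OF z])
  also have "\<dots> = gen_metric g \<beta> z (qscale (- \<i>) (\<Phi> z (P z (fst w), P z (snd w)))) (\<Phi> z (x, 0))"
    by (simp add: gen_metric_simps z gen_metric_\<Phi>' g_simps g_P bismut_ricci_\<rho> algebra_simps)
  finally show "gen_metric g \<beta> z (second_ricci g (dolbeault_Q \<omega>0) (gen_metric g \<beta>) z (\<Phi> z w))
      (\<Phi> z (x, 0))
    = gen_metric g \<beta> z (qscale (- \<i>) (\<Phi> z (P z (fst w), P z (snd w)))) (\<Phi> z (x, 0))" .
qed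

section \<open>Types of the Bismut-Ricci form and the block matrix\<close>

lemma multilinear_bismut_ricci: "z \<in> S \<Longrightarrow> multilinear 2 (bismut_ricci g z)"
  by (rule multilinear_2I; unfold bismut_ricci_\<rho>; intro linear_of_real \<rho>_linear)

lemma cext_bismut_ricci:
  assumes z: "z \<in> S"
  shows "cext (bismut_ricci g z) [(p, 0), (0, cnj_vec q')] = (hg z (P z p) q' - \<i> * hg z (P z (\<i> *s p)) q') / 2"
    and "cext (bismut_ricci g z) [(0, cnj_vec q), (0, cnj_vec q')] = (hg z (P z q) q' + \<i> * hg z (P z (\<i> *s q)) q') / 2"
    and "cext (bismut_ricci g z) [(p, 0), (p', 0)] = (hg z p' (P z p) - \<i> * hg z p' (P z (\<i> *s p))) / 2"
    and "cext (bismut_ricci g z) [(0, cnj_vec q), (p', 0)] = (hg z p' (P z q) + \<i> * hg z p' (P z (\<i> *s q))) / 2"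
proof -
  have l: "hg z (P z u) v = (complex_of_real (\<rho> z u v) + \<i> * complex_of_real (\<rho> z u (\<i> *s v))) / 2" for u v
    by (simp add: hg_def g_P z)
  have r: "hg z v (P z u) = (complex_of_real (\<rho> z u v) - \<i> * complex_of_real (\<rho> z u (\<i> *s v))) / 2" for u v
    using cnj_hg[OF z, of "P z u" v] by (simp add: l)
  show "cext (bismut_ricci g z) [(p, 0), (0, cnj_vec q')] = (hg z (P z p) q' - \<i> * hg z (P z (\<i> *s p)) q') / 2"
    "cext (bismut_ricci g z) [(0, cnj_vec q), (0, cnj_vec q')] = (hg z (P z q) q' + \<i> * hg z (P z (\<i> *s q)) q') / 2"
    "cext (bismut_ricci g z) [(p, 0), (p', 0)] = (hg z p' (P z p) - \<i> * hg z p' (P z (\<i> *s p))) / 2"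
    "cext (bismut_ricci g z) [(0, cnj_vec q), (p', 0)] = (hg z p' (P z q) + \<i> * hg z p' (P z (\<i> *s q))) / 2"
    unfolding l r by (simp_all add: clin_def bismut_ricci_\<rho> \<rho>_simps z field_simps)
qed

text \<open>The (1,1)-part of the Ricci form is the part of \<open>P\<close> commuting with J, which
  preserves the types of vectors; the (2,0)- and (0,2)-parts give the anticommuting part, which
  exchanges them. These are the diagonal and off-diagonal blocks of -P; the sign of the covector
  component of \<open>\<Phi>\<close> makes the off-diagonal entries positive.\<close>

lemma ricci_block_exp_b:
  assumes z: "z \<in> S"
  shows "ricci_block g z (exp_b (\<beta> z) (\<Phi> z w))
    = - exp_b (\<beta> z) (\<Phi> z (P z (fst w), P z (snd w)))"
proof -
  define p where "p = p10 w"
  define q where "q = q01 w"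
  let ?\<rho> = "bismut_ricci g z"
  note m = multilinear_bismut_ricci[OF z]
  have sm: "hg z ((1 / 2) *\<^sub>R u) v = hg z u v / 2" for u v by (simp add: hg_simps z scaleR_conv_of_real[where 'a = complex])
  have E: "exp_b (\<beta> z) (\<Phi> z w) = (p, \<chi> k. - hg z (axis k 1) q)"
    by (simp add: exp_b_\<Phi>[OF z] p_def q_def)
  have \<theta>: "cext (form10 (\<chi> k. - hg z (axis k 1) q)) [t] = - hg z (fst t) q" for t
    unfolding cext_form10 by (simp add: sum_negf mult.commute flip: hg_expand[OF z, of "fst t"])
  have Y: "metric_inv g z (\<lambda>t. cext (form10 (\<chi> k. - hg z (axis k 1) q)) [t]) = (0, cnj_vec (- q))"
    by (rule metric_inv_eqI[OF z]) (simp add: \<theta> metric_c_eq[OF z] hg_simps z del: cext.simps)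
  \<comment> \<open>(P - JPJ)/2 is the J-commuting part of \<open>P\<close>; in \<open>Y02\<close>
    below (P + JPJ)/2 is the anticommuting one.\<close>
  have X11: "metric_inv g z (flat (pq_part 1 1 ?\<rho>) (p, 0)) = ((1 / 2) *\<^sub>R (P z p - \<i> *s P z (\<i> *s p)), 0)"
  proof (rule metric_inv_eqI[OF z])
    fix p' q'
    show "metric_c g z ((1 / 2) *\<^sub>R (P z p - \<i> *s P z (\<i> *s p)), 0) (p', q') = flat (pq_part 1 1 ?\<rho>)
        (p, 0) (p', q')"
      using cext_pair(2)[OF m, of p p' "cnj_vec q'"] cext_bismut_ricci(1)[OF z, of p "cnj_vec q'"]
      by (simp add: flat_def metric_c_eq[OF z] sm hg_simps z hg_J_left del: cext.simps)
  qed
  have Y02: "metric_inv g z (flat (pq_part 0 2 ?\<rho>) (0, cnj_vec (- q)))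
    = ((1 / 2) *\<^sub>R (P z (- q) + \<i> *s P z (\<i> *s (- q))), 0)"
  proof (rule metric_inv_eqI[OF z])
    fix p' q'
    show "metric_c g z ((1 / 2) *\<^sub>R (P z (- q) + \<i> *s P z (\<i> *s (- q))), 0) (p', q')
      = flat (pq_part 0 2 ?\<rho>) (0, cnj_vec (- q)) (p', q')"
      using cext_pair(4)[OF m, of "- q" p' "cnj_vec q'"] cext_bismut_ricci(2)[OF z, of "- q" "cnj_vec q'"]
      by (simp add: flat_def metric_c_eq[OF z] sm hg_simps z hg_J_left del: cext.simps)
  qed
  have X20: "comp10 (flat (pq_part 2 0 ?\<rho>) (p, 0)) $ k = (hg z (axis k 1) (P z p) - \<i> * hg z (axis k 1) (P z
      (\<i> *s p))) / 2" for k
    unfolding comp10_def flat_def using cext_pair(1)[OF m] cext_bismut_ricci(3)[OF z] by simp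
  have Y11: "comp10 (flat (pq_part 1 1 ?\<rho>) (0, cnj_vec (- q))) $ k
    = (hg z (axis k 1) (P z (- q)) + \<i> * hg z (axis k 1) (P z (\<i> *s (- q)))) / 2" for k
    unfolding comp10_def flat_def using cext_pair(3)[OF m] cext_bismut_ricci(4)[OF z] by simp
  have 1: "- ((1 / 2) *\<^sub>R (P z p - \<i> *s P z (\<i> *s p))) + (1 / 2) *\<^sub>R (P z (- q) + \<i> *s P z (\<i> *s (- q)))
    = - p10 (P z (fst w), P z (snd w))"
    by (simp add: p_def q_def p10_def q01_def i_smult_simps P_simps z vec_eq_iff complex_eq_iff field_simps)
  have 2: "(hg z (axis k 1) (P z p) - \<i> * hg z (axis k 1) (P z (\<i> *s p))) / 2
     - (hg z (axis k 1) (P z (- q)) + \<i> * hg z (axis k 1) (P z (\<i> *s (- q)))) / 2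
    = hg z (axis k 1) (q01 (P z (fst w), P z (snd w)))" for k
    by (simp add: p_def q_def p10_def q01_def i_smult_simps P_simps z hg_simps hg_J_right field_simps)
  have "ricci_block g z (p, \<chi> k. - hg z (axis k 1) q)
    = (- p10 (P z (fst w), P z (snd w)), \<chi> k. hg z (axis k 1) (q01 (P z (fst w), P z (snd w))))"
    unfolding ricci_block_def Let_def fst_conv snd_conv Y X11 Y02 1 prod.inject
    by (intro conjI refl) (unfold vec_eq_iff vector_minus_component X20 Y11 2, simp)
  then show ?thesis
    unfolding E by (simp add: exp_b_\<Phi>[OF z] vec_eq_iff)
qed

lemma exp_b_neg: "z \<in> S \<Longrightarrow> exp_b (\<lambda>vs. - \<beta> z vs) (- exp_b (\<beta> z) (\<Phi> z w)) =
    - \<Phi> z w"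
  unfolding exp_b_\<Phi>
  by (simp add: exp_b_def \<Phi>_def comp10_def vec_eq_iff clin_def \<beta>_simps \<beta>_J field_simps)

lemma second_ricci_eq:
  assumes z: "z \<in> S"
  shows "second_ricci g (dolbeault_Q \<omega>0) (gen_metric g \<beta>) z s =
    qscale \<i> (exp_b (\<lambda>vs. - \<beta> z vs) (ricci_block g z (exp_b (\<beta> z) s)))"
proof -
  obtain w where s: "s = \<Phi> z w" using \<Phi>_\<Psi>[OF z] by metis
  have "qscale (- \<i>) t = qscale \<i> (- t)" for t :: "'n qvec"
    by (simp add: qscale_def prod_eq_iff vec_eq_iff)
  then show ?thesis
    by (simp add: s second_ricci_\<Phi> ricci_block_exp_b exp_b_neg z)
qed

text \<open>\<open>\<Phi>\<close> is invertible and \<open>g\<close> nondegenerate, so both sides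
  amount to \<open>P = 0\<close>; real vectors \<open>(u, 0)\<close> already detect it.\<close>

lemma second_ricci_eq_0_iff:
  assumes z: "z \<in> S"
  shows "(\<forall>s. second_ricci g (dolbeault_Q \<omega>0) (gen_metric g \<beta>) z s = 0) \<longleftrightarrow>
      (\<forall>u v. bismut_ricci g z [u, v] = 0)"
proof
  assume S0: "\<forall>s. second_ricci g (dolbeault_Q \<omega>0) (gen_metric g \<beta>) z s = 0"
  show "\<forall>u v. bismut_ricci g z [u, v] = 0"
  proof (intro allI)
    fix u v
    have "qscale (- \<i>) (\<Phi> z (P z u, P z 0)) = second_ricci g (dolbeault_Q \<omega>0) (gen_metric g \<beta>) z
        (\<Phi> z (u, 0))"
      by (simp add: second_ricci_\<Phi> z)
    also have "\<dots> = 0" using S0 by blast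
    finally have "qscale (- \<i>) (\<Phi> z (P z u, P z 0)) = 0" .
    then have "qscale \<i> (qscale (- \<i>) (\<Phi> z (P z u, P z 0))) = 0" by (simp only: qscale_simps)
    then have "\<Phi> z (P z u, P z 0) = \<Phi> z 0" by (simp add: linear_0[OF linear_\<Phi>[OF z]])
    then have "(P z u, P z 0) = 0" using \<Phi>_inject[OF z] by blast
    then have "P z u = 0" by (simp add: prod_eq_iff)
    then show "bismut_ricci g z [u, v] = 0" using g_P[OF z, of u v] by (simp add: bismut_ricci_\<rho> g_simps z)
  qed
next
  assume "\<forall>u v. bismut_ricci g z [u, v] = 0"
  then have "g z (P z u) x = g z 0 x" for u x by (simp add: g_P z g_simps bismut_ricci_\<rho>)
  then have "P z u = 0" for u by (rule nondegenerate[OF z])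
  then have "second_ricci g (dolbeault_Q \<omega>0) (gen_metric g \<beta>) z (\<Phi> z w) = 0" for w
    by (simp add: second_ricci_\<Phi> z linear_0[OF linear_\<Phi>] flip: zero_prod_def)
  then show "\<forall>s. second_ricci g (dolbeault_Q \<omega>0) (gen_metric g \<beta>) z s = 0"
    using \<Phi>_\<Psi>[OF z] by metis
qed

end

theorem proposition4p4:
  fixes M :: "'a topology"
    and \<A> :: "('a, 'n::finite) chart set"
    and g0 g :: "('a, 'n) chart \<Rightarrow> 'n metric"
    and \<beta> :: "('a, 'n) chart \<Rightarrow> 'n form_field"
  assumes "complex_manifold M \<A>"
    and "hermitian_metric \<A> g0" and "pluriclosed \<A> g0"
    and "hermitian_metric \<A> g" and "pluriclosed \<A> g"
    and "pq_form 2 0 \<A> \<beta>"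
    and "\<And>c z vs. c \<in> \<A> \<Longrightarrow> z \<in> chart_img c \<Longrightarrow> length vs = 3 \<Longrightarrow>
      delbar (\<beta> c) z vs = del (kahler_form (g0 c)) z vs - del (kahler_form (g c)) z vs"
  shows "(\<forall>c\<in>\<A>. \<forall>z\<in>chart_img c. \<forall>s.
      S_G g0 g \<beta> c z s =
        qscale \<i> (exp_b (\<lambda>vs. - \<beta> c z vs) (ricci_block (g c) z (exp_b (\<beta> c z) s))))
    \<and> (bismut_hermitian_einstein \<A> g \<longleftrightarrow> hermitian_einstein \<A> g0 g \<beta>)"
proof -
  \<comment> \<open>Both claims compare chart expressions point by point, so they follow from the
    local results once each chart is shown to carry the data of the locale.\<close>
  have chart: "generalized_chart (chart_img c) (g c) (\<beta> c) (kahler_form (g0 c))" if c: "c \<in> \<A>" for c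
  proof
    show "open (chart_img c)" using assms(1) c by (simp add: complex_manifold_def)
    show "smooth_on (chart_img c) (\<lambda>z. g c z u v)" for u v
      using assms(4) c by (simp add: hermitian_metric_def)
    show "bilinear (g c z)" "g c z u v = g c z v u" "u \<noteq> 0 \<Longrightarrow> g c z u u > 0"
      "g c z (\<i> *s u) (\<i> *s v) = g c z u v" if "z \<in> chart_img c" for z u v
      using assms(4) c that unfolding hermitian_metric_def by blast+
    show "del (delbar (kahler_form (g c))) z vs = 0" if "z \<in> chart_img c" "length vs = 4" for z vs
      using assms(5) c that unfolding pluriclosed_def by blast
    show "smooth_on (chart_img c) (\<lambda>z. \<beta> c z vs)" if "length vs = 2" for vs
      using assms(6) c that unfolding pq_form_def add_0_right by blast
    show "alternating_form 2 (\<beta> c z)" if "z \<in> chart_img c" for z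
      using assms(6) c that unfolding pq_form_def add_0_right by blast
    show "pq_part 2 0 (\<beta> c z) vs = \<beta> c z vs" if "z \<in> chart_img c" "length vs = 2" for z vs
      using assms(6) c that unfolding pq_form_def add_0_right by blast
    show "delbar (\<beta> c) z vs = del (kahler_form (g0 c)) z vs - del (kahler_form (g c)) z vs"
      if "z \<in> chart_img c" "length vs = 3" for z vs
      using assms(7) c that by blast
  qed
  note eq = generalized_chart.second_ricci_eq[OF chart]
  note iff = generalized_chart.second_ricci_eq_0_iff[OF chart]
  show ?thesis
    using eq iff assms(5)
    unfolding S_G_def bismut_hermitian_einstein_def hermitian_einstein_def by blast
qed

end
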